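(* Let $I$ be an instance of $(\mathbf{MSP})$ with $m=1$, $k_1\ge(|V|-1)^2$, $c_1\le 1$, $B\ge|E|$, $w(e)=1$ for all $e\in E$, $\eta_0>\eta_1$, and $D(s,t)=1$ for all $s\ne t$. Then there is a solution $X$, which can be computed in polynomial time, such that $\mathrm{H}(X)\le 2\,\mathrm{H}^*$ and $\mathrm{T}(X)\le 2\,\mathrm{T}^{\mathrm{H}^*}$, where $\mathrm{H}^*$ is the minimal value of $\mathrm{H}$ amongst all solutions $X'$ of $I$ with $\mathrm{T}(X')\le a$ ($a$ being the travel time bound belonging to the instance $I$), and $\mathrm{T}^{\mathrm{H}^*}$ is the minimal total travel time over all solutions with a total energy consumption of $\mathrm{H}^*$.
   Context: The optimization problem $(\mathbf{MSP})$ (Modal Split Problem). An instance consists of a directed, weighted graph $G=(V,E,w)$ with $w:E\to\mathbb{N}_{>0}$; a budget $B$; a demand $D:V^2\to\mathbb{N}_{\ge 0}$ with $D(v,v)=0$; a number $m$ of public transportation modes; for each mode $i=0,\dots,m$ a travel time $\tau_i$ per unit of distance, an energy consumption $\eta_i$ and a cost $c_i$ per unit of distance and vehicle, and a capacity $k_i$ per vehicle; and a travel time bound $a\ge 0$ (where $a=\infty$ means that the travel time is not bounded). Mode $0$ is private transport, with $c_0=0$ and $k_0=1$; it is allowed on every edge without any capacity constraint. The task is to find a solution $(F,L,M)$ (defined below) with $\mathrm{T}(F,L,M)\le a$ and $\mathrm{H}(F,L,M)$ minimal. The commodities are $K=\{(s,t)\in V^2: D(s,t)>0\}$. A layout is a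 map $L:E\to\mathbb{N}^m$ (entries $0$ allowed), giving the number of vehicles of each public mode on each edge; it is feasible if $\sum_{e}w(e)\sum_{i=1}^m c_iL(e)_i\le B$. For each $\kappa=(s,t)\in K$, a flow is a map $F_\kappa:E\to\mathbb{R}_{\ge 0}$ such that for every $v\in V$ the inflow minus the outflow, $\sum_{e\in \mathrm{in}(v)}F_\kappa(e)-\sum_{e\in \mathrm{out}(v)}F_\kappa(e)$, equals $0$ if $v\ne s,t$, equals $D(s,t)$ if $v=t$, and equals $-D(s,t)$ if $v=s$. A modal split consists of maps $M_\kappa:E\to[0,1]^{m+1}$, $\kappa\in K$, with $\sum_{i=0}^m M_\kappa(e)_i=1$ for all $e$ and $\sum_{\kappa\in K}F_\kappa(e)M_\kappa(e)_i\le k_iL(e)_i$ for all $e\in E$ and $i=1,\dots,m$. Put $F(e)=\sum_\kappa F_\kappa(e)$, and $M(e)_i=\frac{1}{F(e)}\sum_\kappa F_\kappa(e)M_\kappa(e)_i$ if $F(e)>0$, and $M(e)=(1,0,\dots,0)$ otherwise. A (feasible) solution is a triple $(F,L,M)$ of flows $F=(F_\kappa)_{\kappa\in K}$, a feasible layout $L$ and a feasible modal split $M$. Total travel time: $\mathrm{T}(F,L,M)=\sum_e w(e)\sum_{i=0}^m\tau_iF(e)M(e)_i$. Total energy consumption: $\mathrm{H}(F,L,M)=\sum_e w(e)\bigl(\eta_0F(e)M(e)_0+\sum_{i=1}^m\eta_iL(e)_i\bigr)$. *)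

theory Defs
  imports
    Complex_Main
    "HOL-Library.Log_Nat"
    "HOL-Computational_Algebra.Polynomial"
    "Graph_Theory.Pair_Digraph"
begin

section \<open>The modal split problem\<close>

text \<open>The per-unit parameters of the modes are rational, so that instances are finite objects that an
  algorithm can read. Mode 0 is private transport, modes 1 to \<open>modes I\<close> are public.
  A time bound \<open>None\<close> stands for an unbounded travel time.\<close>

record 'v msp =
  graph :: "'v pair_pre_digraph"
  weight :: "'v \<times> 'v \<Rightarrow> nat"
  budget :: rat
  demand :: "'v \<times> 'v \<Rightarrow> nat"
  modes :: nat
  travel_time :: "nat \<Rightarrow> rat"
  energy :: "nat \<Rightarrow> rat"
  cost :: "nat \<Rightarrow> rat"
  capacity :: "nat \<Rightarrow> rat"
  time_bound :: "rat option"

abbreviation vertices :: "'v msp \<Rightarrow> 'v set" where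
  "vertices I \<equiv> pverts (graph I)"

abbreviation edges :: "'v msp \<Rightarrow> ('v \<times> 'v) set" where
  "edges I \<equiv> parcs (graph I)"

definition msp_instance :: "'v msp \<Rightarrow> bool" where
  "msp_instance I \<longleftrightarrow>
     pair_fin_digraph (graph I) \<and>
     (\<forall>e\<in>edges I. weight I e > 0) \<and>
     budget I \<ge> 0 \<and>
     (\<forall>v\<in>vertices I. demand I (v, v) = 0) \<and>
     (\<forall>i\<le>modes I. travel_time I i \<ge> 0 \<and> energy I i \<ge> 0 \<and> cost I i \<ge> 0 \<and> capacity I i \<ge> 0) \<and>
     cost I 0 = 0 \<and> capacity I 0 = 1 \<and>
     (\<forall>a. time_bound I = Some a \<longrightarrow> a \<ge> 0)"

definition commodities :: "'v msp \<Rightarrow> ('v \<times> 'v) set" where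
  "commodities I = {\<kappa> \<in> vertices I \<times> vertices I. demand I \<kappa> > 0}"

text \<open>Flows and modal splits take the commodity first and the edge second; layouts and modal splits
  take the mode last.\<close>

record 'v msp_solution =
  flow :: "'v \<times> 'v \<Rightarrow> 'v \<times> 'v \<Rightarrow> real"
  layout :: "'v \<times> 'v \<Rightarrow> nat \<Rightarrow> nat"
  modal_split :: "'v \<times> 'v \<Rightarrow> 'v \<times> 'v \<Rightarrow> nat \<Rightarrow> real"

definition is_flow :: "'v msp \<Rightarrow> 'v \<times> 'v \<Rightarrow> ('v \<times> 'v \<Rightarrow> real) \<Rightarrow> bool" where
  "is_flow I \<kappa> f \<longleftrightarrow>
     (\<forall>e\<in>edges I. f e \<ge> 0) \<and>
     (\<forall>v\<in>vertices I.
        (\<Sum>e\<in>in_arcs (with_proj (graph I)) v. f e) - (\<Sum>e\<in>out_arcs (with_proj (graph I)) v. f e) =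
        (if v = snd \<kappa> then real (demand I \<kappa>)
         else if v = fst \<kappa> then - real (demand I \<kappa>)
         else 0))"

definition feasible_layout :: "'v msp \<Rightarrow> ('v \<times> 'v \<Rightarrow> nat \<Rightarrow> nat) \<Rightarrow> bool" where
  "feasible_layout I L \<longleftrightarrow>
     (\<Sum>e\<in>edges I. of_nat (weight I e) * (\<Sum>i=1..modes I. cost I i * of_nat (L e i))) \<le> budget I"

definition feasible_modal_split :: "'v msp \<Rightarrow> 'v msp_solution \<Rightarrow> bool" where
  "feasible_modal_split I X \<longleftrightarrow>
     (\<forall>\<kappa>\<in>commodities I. \<forall>e\<in>edges I.
        (\<forall>i\<le>modes I. modal_split X \<kappa> e i \<in> {0..1}) \<and>
        (\<Sum>i=0..modes I. modal_split X \<kappa> e i) = 1) \<and>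
     (\<forall>e\<in>edges I. \<forall>i\<in>{1..modes I}.
        (\<Sum>\<kappa>\<in>commodities I. flow X \<kappa> e * modal_split X \<kappa> e i)
          \<le> of_rat (capacity I i) * real (layout X e i))"

definition is_solution :: "'v msp \<Rightarrow> 'v msp_solution \<Rightarrow> bool" where
  "is_solution I X \<longleftrightarrow>
     (\<forall>\<kappa>\<in>commodities I. is_flow I \<kappa> (flow X \<kappa>)) \<and>
     feasible_layout I (layout X) \<and>
     feasible_modal_split I X"

definition total_flow :: "'v msp \<Rightarrow> 'v msp_solution \<Rightarrow> 'v \<times> 'v \<Rightarrow> real" where
  "total_flow I X e = (\<Sum>\<kappa>\<in>commodities I. flow X \<kappa> e)"

definition total_split :: "'v msp \<Rightarrow> 'v msp_solution \<Rightarrow> 'v \<times> 'v \<Rightarrow> nat \<Rightarrow> real" where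
  "total_split I X e i =
     (if total_flow I X e > 0
      then (\<Sum>\<kappa>\<in>commodities I. flow X \<kappa> e * modal_split X \<kappa> e i) / total_flow I X e
      else if i = 0 then 1 else 0)"

definition total_travel_time :: "'v msp \<Rightarrow> 'v msp_solution \<Rightarrow> real" where
  "total_travel_time I X =
     (\<Sum>e\<in>edges I. real (weight I e) *
        (\<Sum>i=0..modes I. of_rat (travel_time I i) * total_flow I X e * total_split I X e i))"

definition total_energy :: "'v msp \<Rightarrow> 'v msp_solution \<Rightarrow> real" where
  "total_energy I X =
     (\<Sum>e\<in>edges I. real (weight I e) *
        (of_rat (energy I 0) * total_flow I X e * total_split I X e 0
         + (\<Sum>i=1..modes I. of_rat (energy I i) * real (layout X e i))))"

definition within_time_bound :: "'v msp \<Rightarrow> 'v msp_solution \<Rightarrow> bool" where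
  "within_time_bound I X \<longleftrightarrow>
     (case time_bound I of None \<Rightarrow> True | Some a \<Rightarrow> total_travel_time I X \<le> of_rat a)"

definition is_minimum :: "real set \<Rightarrow> real \<Rightarrow> bool" where
  "is_minimum S x \<longleftrightarrow> x \<in> S \<and> (\<forall>y\<in>S. x \<le> y)"

definition is_min_energy :: "'v msp \<Rightarrow> real \<Rightarrow> bool" where
  "is_min_energy I h \<longleftrightarrow>
     is_minimum {total_energy I X | X. is_solution I X \<and> within_time_bound I X} h"

definition is_min_time_at_energy :: "'v msp \<Rightarrow> real \<Rightarrow> real \<Rightarrow> bool" where
  "is_min_time_at_energy I h t \<longleftrightarrow>
     is_minimum {total_travel_time I X | X. is_solution I X \<and> total_energy I X = h} t"


section \<open>Polynomial-time computation\<close>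

text \<open>A random access machine with logarithmic cost, programmed by structured commands.
  The memory consists of arrays of natural numbers; a program names finitely many of them by literals,
  and computes the index into them. Every evaluated node of an expression is charged one more than the
  number of binary digits of its value, so running time is polynomially related to that of
  a Turing machine. \<open>Sub\<close> is truncated subtraction, and division by 0 yields 0.\<close>

type_synonym store = "nat \<Rightarrow> nat \<Rightarrow> nat"

datatype aexp =
    Const nat
  | Load nat aexp
  | Add aexp aexp
  | Sub aexp aexp
  | Mul aexp aexp
  | Div aexp aexp

primrec aval :: "aexp \<Rightarrow> store \<Rightarrow> nat" where
  "aval (Const n) s = n"
| "aval (Load a e) s = s a (aval e s)"
| "aval (Add e f) s = aval e s + aval f s"
| "aval (Sub e f) s = aval e s - aval f s"
| "aval (Mul e f) s = aval e s * aval f s"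
| "aval (Div e f) s = aval e s div aval f s"

definition log_cost :: "nat \<Rightarrow> nat" where
  "log_cost n = 1 + floorlog 2 n"

primrec acost :: "aexp \<Rightarrow> store \<Rightarrow> nat" where
  "acost (Const n) s = log_cost n"
| "acost (Load a e) s = log_cost (aval (Load a e) s) + acost e s"
| "acost (Add e f) s = log_cost (aval (Add e f) s) + acost e s + acost f s"
| "acost (Sub e f) s = log_cost (aval (Sub e f) s) + acost e s + acost f s"
| "acost (Mul e f) s = log_cost (aval (Mul e f) s) + acost e s + acost f s"
| "acost (Div e f) s = log_cost (aval (Div e f) s) + acost e s + acost f s"

text \<open>\<open>Store a e f\<close> writes the value of \<open>f\<close> to the cell of array \<open>a\<close> whose index is the value of \<open>e\<close>.
  A condition holds if its value is not 0.\<close>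

datatype com =
    Skip
  | Store nat aexp aexp
  | Seq com com
  | Cond aexp com com
  | While aexp com

inductive exec :: "com \<Rightarrow> store \<Rightarrow> nat \<Rightarrow> store \<Rightarrow> bool" where
  exec_Skip: "exec Skip s 1 s"
| exec_Store: "exec (Store a e f) s (1 + acost e s + acost f s)
    (s(a := (s a)(aval e s := aval f s)))"
| exec_Seq: "exec c s t s' \<Longrightarrow> exec d s' t' s'' \<Longrightarrow> exec (Seq c d) s (1 + t + t') s''"
| exec_CondT: "aval e s \<noteq> 0 \<Longrightarrow> exec c s t s' \<Longrightarrow> exec (Cond e c d) s (1 + acost e s + t) s'"
| exec_CondF: "aval e s = 0 \<Longrightarrow> exec d s t s' \<Longrightarrow> exec (Cond e c d) s (1 + acost e s + t) s'"
| exec_WhileT: "aval e s \<noteq> 0 \<Longrightarrow> exec c s t s' \<Longrightarrow> exec (While e c) s' t' s'' \<Longrightarrow>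
    exec (While e c) s (1 + acost e s + t + t') s''"
| exec_WhileF: "aval e s = 0 \<Longrightarrow> exec (While e c) s (1 + acost e s) s"

text \<open>The input is written to array 0; all other cells are 0 initially.\<close>

definition input_store :: "nat list \<Rightarrow> store" where
  "input_store xs = (\<lambda>a i. if a = 0 \<and> i < length xs then xs ! i else 0)"

definition input_size :: "nat list \<Rightarrow> nat" where
  "input_size xs = sum_list (map log_cost xs)"


section \<open>Instances as inputs, solutions as outputs\<close>

text \<open>Instances are presented by a list of their vertices and a list of their edges; a vertex is
  encoded by its position.\<close>

definition enumerates :: "'v msp \<Rightarrow> 'v list \<Rightarrow> ('v \<times> 'v) list \<Rightarrow> bool" where
  "enumerates I vs es \<longleftrightarrow>
     distinct vs \<and> set vs = vertices I \<and> distinct es \<and> set es = edges I"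

definition position :: "'a list \<Rightarrow> 'a \<Rightarrow> nat" where
  "position xs x = length (takeWhile (\<lambda>y. y \<noteq> x) xs)"

text \<open>Applied to nonnegative numbers only: numerator and denominator in lowest terms.\<close>

definition encode_rat :: "rat \<Rightarrow> nat list" where
  "encode_rat x = [nat (fst (quotient_of x)), nat (snd (quotient_of x))]"

definition encode_msp :: "'v msp \<Rightarrow> 'v list \<Rightarrow> ('v \<times> 'v) list \<Rightarrow> nat list" where
  "encode_msp I vs es =
     [length vs, length es, modes I]
     @ concat (map (\<lambda>e. [position vs (fst e), position vs (snd e), weight I e]) es)
     @ map (demand I) (List.product vs vs)
     @ encode_rat (budget I)
     @ concat (map (\<lambda>i. encode_rat (travel_time I i) @ encode_rat (energy I i)
                        @ encode_rat (cost I i) @ encode_rat (capacity I i)) [0..<Suc (modes I)])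
     @ (case time_bound I of None \<Rightarrow> [0] | Some a \<Rightarrow> 1 # encode_rat a)"

definition is_fraction :: "real \<Rightarrow> nat \<Rightarrow> nat \<Rightarrow> bool" where
  "is_fraction x p q \<longleftrightarrow> q \<noteq> 0 \<and> x = real p / real q"

text \<open>With \<open>n\<close> vertices, \<open>q\<close> edges and \<open>m\<close> public modes, the data for commodity \<open>(vs ! i, vs ! j)\<close> and
  edge \<open>es ! l\<close> have index \<open>(i * n + j) * q + l\<close>. Arrays 1 and 2 hold the numerators and denominators of
  the flow, array 3 holds the layout, arrays 4 and 5 hold the numerators and denominators of
  the modal split. Values outside the commodities and edges are irrelevant.\<close>

definition encodes_solution ::
  "'v msp \<Rightarrow> 'v list \<Rightarrow> ('v \<times> 'v) list \<Rightarrow> 'v msp_solution \<Rightarrow> store \<Rightarrow> bool" where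
  "encodes_solution I vs es X s \<longleftrightarrow>
     (let n = length vs; q = length es; m = modes I in
       (\<forall>i<n. \<forall>j<n. \<forall>l<q. (vs ! i, vs ! j) \<in> commodities I \<longrightarrow>
          (let p = (i * n + j) * q + l in
            is_fraction (flow X (vs ! i, vs ! j) (es ! l)) (s 1 p) (s 2 p) \<and>
            (\<forall>r\<le>m. is_fraction (modal_split X (vs ! i, vs ! j) (es ! l) r)
                      (s 4 (p * Suc m + r)) (s 5 (p * Suc m + r))))) \<and>
       (\<forall>l<q. \<forall>r\<in>{1..m}. layout X (es ! l) r = s 3 (l * m + (r - 1))))"

end

theory Submission
  imports Defs
begin

text \<open>Let \<open>n = |V|\<close>, let \<open>d\<close> be the distance in the graph and \<open>W\<close> the sum of all \<open>d s t\<close>; every solution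
  has total flow at least \<open>W\<close>. Each vertex needs a vehicle or at least one unit of private flow on its
  outgoing edges, so every solution has energy at least \<open>n * \<eta>\<^sub>1\<close>. Averaging over all vertices yields a
  root whose shortest-path out-tree and in-tree, with at most \<open>2 * (n - 1)\<close> edges, connect all pairs by
  paths of total length \<open>U \<le> 2 * W - 2 * (n - 1)\<close>. Routing on shortest paths within the two trees puts
  at most \<open>(n - 1)\<^sup>2\<close> units on an edge, so that one vehicle per edge suffices.

  If public transport is not slower, or time is unbounded, everything travels publicly. Otherwise a
  uniform share of the flow travels privately, just enough to bring the time down to \<open>2 * (a - (\<tau>\<^sub>1 -
  \<tau>\<^sub>0) * (\<eta>\<^sub>1 / \<eta>\<^sub>0))\<close>, and no vehicles are used once all of the flow is private. This suffices: an
  optimal solution either takes at least half of that time, or it has slack more than \<open>(\<tau>\<^sub>1 - \<tau>\<^sub>0) *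
  (\<eta>\<^sub>1 / \<eta>\<^sub>0)\<close> in the time bound and then it is all public, since private flow on an edge could be moved
  to a vehicle as soon as it exceeds \<open>\<eta>\<^sub>1 / \<eta>\<^sub>0 < 1\<close> (or at once if the edge has a vehicle), so all cuts
  are crossed by vehicles, and then a small fraction of all flows could be moved to public paths.\<close>

section \<open>Weakest preconditions with polynomial resource bounds\<close>

text \<open>The algorithm does not know the optimum, so the amount of private flow is derived from
  the time bound alone and must be large enough for the time guarantee and small enough for the
  energy guarantee. The two fit because of the saving \<open>2 * (n - 1)\<close> in
  \<open>U\<close>: averaging gives \<open>n * U \<le> (n - 1) * (2 * W)\<close>, and
  \<open>W \<ge> n * (n - 1)\<close> turns the missing \<open>2 * W\<close> into this additive term.
  It becomes \<open>2 * (n - 1)\<close> fewer units of private flow, which pay for the vehicles on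
  the trees since \<open>\<eta>\<^sub>1 < \<eta>\<^sub>0\<close>. The remaining excess
  \<open>2 * (\<eta>\<^sub>1 / \<eta>\<^sub>0)\<close> costs \<open>2 * \<eta>\<^sub>1\<close>,
  twice the price of one vehicle of the optimum; an optimum without vehicles is treated apart. The
  capacity \<open>(n - 1)\<^sup>2\<close> is the number of commodities that do not start at a given
  vertex. Flows that carry at most one unit per edge and never enter their own source therefore fit
  into a single vehicle, and optimal flows turn out to be of this kind. Competing flows are
  real-valued, so exchange arguments move small fractions instead of paths.\<close>

lemma log_cost_ge_1: "1 \<le> log_cost n"
  by (simp add: log_cost_def)

lemma log_cost_mono: "m \<le> n \<Longrightarrow> log_cost m \<le> log_cost n"
  by (simp add: log_cost_def floorlog_mono)

lemma log_cost_leI: "v < N \<Longrightarrow> log_cost v \<le> N"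
proof -
  have "floorlog 2 v \<le> v"
    using floorlog_leD floorlog_le_iff[of 2 v v] by (simp add: less_exp)
  then show "v < N \<Longrightarrow> log_cost v \<le> N" by (simp add: log_cost_def)
qed

lemma log_cost_le_iff: "log_cost v \<le> Suc k \<longleftrightarrow> v < 2 ^ k"
  by (simp add: log_cost_def floorlog_le_iff)

lemma log_cost_mult: "log_cost (x * y) \<le> log_cost x + log_cost y"
proof -
  obtain a b where ab: "log_cost x = Suc a" "log_cost y = Suc b"
    using log_cost_ge_1 by (metis Suc_le_D One_nat_def)
  have "x < 2 ^ a" "y < 2 ^ b"
    using ab log_cost_le_iff by (metis order_refl)+
  then have "x * y < 2 ^ (a + b)"
    by (simp add: power_add mult_strict_mono)
  then show ?thesis
    using ab log_cost_le_iff[of "x * y" "a + b"] by simp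
qed

lemma log_cost_add: "log_cost (x + y) \<le> log_cost x + log_cost y"
proof -
  obtain a b where ab: "log_cost x = Suc a" "log_cost y = Suc b"
    using log_cost_ge_1 by (metis Suc_le_D One_nat_def)
  have "x < 2 ^ a" "y < 2 ^ b"
    using ab log_cost_le_iff by (metis order_refl)+
  \<comment> \<open>The product of the successors exceeds \<open>x + y\<close> and is bounded by the
    product of the two powers.\<close>
  then have "Suc x * Suc y \<le> 2 ^ (a + b)"
    by (simp add: power_add Suc_leI mult_le_mono del: mult_Suc mult_Suc_right)
  then have "x + y < 2 ^ (a + b)"
    by simp
  then show ?thesis
    using ab log_cost_le_iff[of "x + y" "a + b"] by simp
qed

section \<open>Values and costs of expressions\<close>

primrec expr_size :: "aexp \<Rightarrow> nat" where
  "expr_size (Const n) = log_cost n"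
| "expr_size (Load a e) = 1 + expr_size e"
| "expr_size (Add e f) = 1 + expr_size e + expr_size f"
| "expr_size (Sub e f) = 1 + expr_size e + expr_size f"
| "expr_size (Mul e f) = 1 + expr_size e + expr_size f"
| "expr_size (Div e f) = 1 + expr_size e + expr_size f"

definition cells_bounded :: "nat \<Rightarrow> store \<Rightarrow> bool" where
  "cells_bounded N s \<longleftrightarrow> (\<forall>a i. log_cost (s a i) \<le> N)"

lemma cells_bounded_pos: "cells_bounded N s \<Longrightarrow> 1 \<le> N"
  using log_cost_ge_1 order_trans unfolding cells_bounded_def by blast

text \<open>Lengths add up under sums and products and do not grow under differences and quotients.
  Constants enter \<open>expr_size\<close> with their own length, so for a fixed expression the
  growth over the cell bound is a constant factor.\<close>

lemma log_cost_aval: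
  assumes "cells_bounded N s"
  shows "log_cost (aval e s) \<le> expr_size e * N"
proof -
  have N: "1 \<le> N" using assms by (rule cells_bounded_pos)
  show ?thesis
  proof (induction e)
    case (Const n)
    then show ?case using N by simp
  next
    case (Load a e)
    then show ?case using assms by (auto simp: cells_bounded_def trans_le_add1)
  next
    case (Add e f)
    then show ?case using log_cost_add[of "aval e s" "aval f s"] by (simp add: algebra_simps)
  next
    case (Sub e f)
    then show ?case using log_cost_mono[of "aval e s - aval f s" "aval e s"]
      by (simp add: algebra_simps)
  next
    case (Mul e f)
    then show ?case using log_cost_mult[of "aval e s" "aval f s"] by (simp add: algebra_simps)
  next
    case (Div e f)
    then show ?case using log_cost_mono[of "aval e s div aval f s" "aval e s"]
      by (simp add: algebra_simps)
  qed
qed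

lemma expr_size_pos: "1 \<le> expr_size e"
  using log_cost_ge_1 by (cases e) auto

lemma acost_le:
  assumes "cells_bounded N s"
  shows "acost e s \<le> (expr_size e)\<^sup>2 * N"
proof -
  have N: "1 \<le> N" using assms by (rule cells_bounded_pos)
  \<comment> \<open>One estimate serves all operators: the length of the value at a node is absorbed
    by the linear and mixed terms of the square. \<open>Load\<close> is the case
    \<open>b = 0\<close>.\<close>
  have binary: "log_cost v + x + y \<le> (1 + a + b)\<^sup>2 * N"
    if "log_cost v \<le> (1 + a + b) * N" "x \<le> a\<^sup>2 * N" "y \<le> b\<^sup>2 * N" "1 \<le> a" for v x y a b :: nat
  proof -
    have "(1 + a + b) + a\<^sup>2 + b\<^sup>2 \<le> (1 + a + b)\<^sup>2"
      by (simp add: power2_eq_square algebra_simps)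
    then have "((1 + a + b) + a\<^sup>2 + b\<^sup>2) * N \<le> (1 + a + b)\<^sup>2 * N"
      by (rule mult_le_mono1)
    moreover have "log_cost v + x + y \<le> ((1 + a + b) + a\<^sup>2 + b\<^sup>2) * N"
      using that unfolding distrib_right by linarith
    ultimately show ?thesis by linarith
  qed
  show ?thesis
  proof (induction e)
    case (Const n)
    have "log_cost n \<le> (log_cost n)\<^sup>2 * N"
      using N log_cost_ge_1[of n] by (simp add: power2_eq_square)
    then show ?case by simp
  next
    case (Load a e)
    then show ?case
      using binary[of "aval (Load a e) s" "expr_size e" 0 "acost e s" 0]
        log_cost_aval[OF assms, of "Load a e"] expr_size_pos[of e] by simp
  next
    case (Add e f)
    then show ?case
      using binary[of _ "expr_size e" "expr_size f"] log_cost_aval[OF assms, of "Add e f"]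
        expr_size_pos[of e] by simp
  next
    case (Sub e f)
    then show ?case
      using binary[of _ "expr_size e" "expr_size f"] log_cost_aval[OF assms, of "Sub e f"]
        expr_size_pos[of e] by simp
  next
    case (Mul e f)
    then show ?case
      using binary[of _ "expr_size e" "expr_size f"] log_cost_aval[OF assms, of "Mul e f"]
        expr_size_pos[of e] by simp
  next
    case (Div e f)
    then show ?case
      using binary[of _ "expr_size e" "expr_size f"] log_cost_aval[OF assms, of "Div e f"]
        expr_size_pos[of e] by simp
  qed
qed

text \<open>The postcondition is reached by a run in which every loop makes at most \<open>N\<close> iterations and every
  stored value has logarithmic cost at most \<open>N\<close>.\<close>

primrec wp :: "nat \<Rightarrow> com \<Rightarrow> (store \<Rightarrow> bool) \<Rightarrow> store \<Rightarrow> bool" where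
  "wp N Skip Q s = Q s"
| "wp N (Store a e f) Q s =
     (log_cost (aval f s) \<le> N \<and> Q (s(a := (s a)(aval e s := aval f s))))"
| "wp N (Seq c d) Q s = wp N c (wp N d Q) s"
| "wp N (Cond e c d) Q s = (if aval e s \<noteq> 0 then wp N c Q s else wp N d Q s)"
| "wp N (While e c) Q s =
     ((\<lambda>X s. if aval e s = 0 then Q s else wp N c X s) ^^ N) (\<lambda>s. aval e s = 0 \<and> Q s) s"

definition cost_poly :: "aexp \<Rightarrow> nat poly" where
  "cost_poly e = [:0, (expr_size e)\<^sup>2:]"

text \<open>The factor \<open>[:1, 1:]\<close> is \<open>N + 1\<close>: at most \<open>N\<close>
  iterations and the last evaluation of the condition. A conditional is charged for both
  branches.\<close>

primrec time_poly :: "com \<Rightarrow> nat poly" where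
  "time_poly Skip = 1"
| "time_poly (Store a e f) = 1 + cost_poly e + cost_poly f"
| "time_poly (Seq c d) = 1 + time_poly c + time_poly d"
| "time_poly (Cond e c d) = 1 + cost_poly e + time_poly c + time_poly d"
| "time_poly (While e c) = (1 + cost_poly e + time_poly c) * [:1, 1:]"

lemma acost_le_poly: "cells_bounded N s \<Longrightarrow> acost e s \<le> poly (cost_poly e) N"
  using acost_le by (simp add: cost_poly_def mult.commute)

text \<open>The same \<open>N\<close> bounds the iterations of every loop and the length of every
  cell, so the time is a polynomial in \<open>N\<close> that depends on the program only. The loop
  case is an induction over the unrolled iterations in \<open>wp\<close>.\<close>

lemma wp_sound:
  assumes "wp N c Q s" "cells_bounded N s"
  shows "\<exists>t s'. exec c s t s' \<and> t \<le> poly (time_poly c) N \<and> cells_bounded N s' \<and> Q s'"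
  using assms
proof (induction c arbitrary: Q s)
  case Skip
  then show ?case using exec_Skip by fastforce
next
  case (Store a e f)
  have "exec (Store a e f) s (1 + acost e s + acost f s)
      (s(a := (s a)(aval e s := aval f s)))" by (rule exec_Store)
  moreover have "acost e s + acost f s \<le> poly (cost_poly e) N + poly (cost_poly f) N"
    using acost_le_poly Store.prems(2) by (intro add_mono)
  moreover have "cells_bounded N (s(a := (s a)(aval e s := aval f s)))"
    using Store.prems by (auto simp: cells_bounded_def)
  ultimately show ?case using Store.prems(1) by fastforce
next
  case (Seq c d)
  from Seq.IH(1)[of "wp N d Q" s] Seq.prems obtain t s' where
    1: "exec c s t s'" "t \<le> poly (time_poly c) N" "cells_bounded N s'" "wp N d Q s'"
    by auto
  from Seq.IH(2)[OF 1(4,3)] obtain t' s'' where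
    2: "exec d s' t' s''" "t' \<le> poly (time_poly d) N" "cells_bounded N s''" "Q s''"
    by auto
  show ?case using exec_Seq[OF 1(1) 2(1)] 1 2 by fastforce
next
  case (Cond e c d)
  have cost: "acost e s \<le> poly (cost_poly e) N" using acost_le_poly Cond.prems(2) .
  show ?case
  proof (cases "aval e s = 0")
    case True
    with Cond.prems Cond.IH(2)[of Q s] obtain t s' where
      1: "exec d s t s'" "t \<le> poly (time_poly d) N" "cells_bounded N s'" "Q s'" by auto
    show ?thesis using exec_CondF[OF True 1(1)] 1 cost by fastforce
  next
    case False
    with Cond.prems Cond.IH(1)[of Q s] obtain t s' where
      1: "exec c s t s'" "t \<le> poly (time_poly c) N" "cells_bounded N s'" "Q s'" by auto
    show ?thesis using exec_CondT[OF False 1(1)] 1 cost by fastforce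
  qed
next
  case (While e c)
  let ?step = "1 + poly (cost_poly e) N + poly (time_poly c) N"
  let ?F = "\<lambda>X s. if aval e s = 0 then Q s else wp N c X s"
  have "\<exists>t s'. exec (While e c) s t s' \<and> t \<le> Suc k * ?step \<and> cells_bounded N s' \<and> Q s'"
    if "(?F ^^ k) (\<lambda>s. aval e s = 0 \<and> Q s) s" "cells_bounded N s" for k s
    using that
  proof (induction k arbitrary: s)
    case 0
    then have "exec (While e c) s (1 + acost e s) s" by (intro exec_WhileF) simp
    then show ?case using 0 acost_le_poly[of N s e] by fastforce
  next
    case (Suc k)
    have cost: "acost e s \<le> poly (cost_poly e) N" using acost_le_poly Suc.prems(2) .
    show ?case
    proof (cases "aval e s = 0")
      case True
      then have "exec (While e c) s (1 + acost e s) s" by (rule exec_WhileF)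
      then show ?thesis using Suc.prems True cost by fastforce
    next
      case False
      with Suc.prems While.IH[of "(?F ^^ k) (\<lambda>s. aval e s = 0 \<and> Q s)" s]
      obtain t s' where 1: "exec c s t s'" "t \<le> poly (time_poly c) N" "cells_bounded N s'"
        "(?F ^^ k) (\<lambda>s. aval e s = 0 \<and> Q s) s'" by auto
      from Suc.IH[OF 1(4,3)] obtain t' s'' where
        2: "exec (While e c) s' t' s''" "t' \<le> Suc k * ?step" "cells_bounded N s''" "Q s''"
        by auto
      have "1 + acost e s + t + t' \<le> Suc (Suc k) * ?step"
        using 1(2) 2(2) cost by simp
      then show ?thesis using exec_WhileT[OF False 1(1) 2(1)] 2 by blast
    qed
  qed
  from this[of N s] While.prems show ?case
    by (simp add: mult.commute add_ac)
qed

lemma wp_mono: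
  assumes "wp N c Q s" "\<And>s. Q s \<Longrightarrow> R s"
  shows "wp N c R s"
  using assms
proof (induction c arbitrary: Q R s)
  case (Seq c d)
  show ?case using Seq.prems(1)
    by (auto intro: Seq.IH(1) Seq.IH(2)[OF _ Seq.prems(2)])
next
  case (While e c)
  let ?F = "\<lambda>Q X s. if aval e s = 0 then Q s else wp N c X s"
  have "(?F R ^^ k) (\<lambda>s. aval e s = 0 \<and> R s) s" if "(?F Q ^^ k) (\<lambda>s. aval e s = 0 \<and> Q s) s" for k s
    using that
  proof (induction k arbitrary: s)
    case 0
    then show ?case using While.prems(2) by simp
  next
    case (Suc k)
    show ?case
    proof (cases "aval e s = 0")
      case True
      then show ?thesis using Suc.prems While.prems(2) by simp
    next
      case False
      then have "wp N c ((?F Q ^^ k) (\<lambda>s. aval e s = 0 \<and> Q s)) s" using Suc.prems by simp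
      then have "wp N c ((?F R ^^ k) (\<lambda>s. aval e s = 0 \<and> R s)) s"
        by (rule While.IH) (rule Suc.IH)
      then show ?thesis using False by simp
    qed
  qed
  then show ?case using While.prems by simp
qed (auto split: if_splits)

text \<open>\<open>wp\<close> asserts termination, hence it is strict. This excludes a further
  iteration at measure 0 in the loop rule.\<close>

lemma not_wp_False: "\<not> wp N c (\<lambda>_. False) s"
proof (induction c arbitrary: s)
  case (Seq c d)
  then show ?case using wp_mono[of N c "wp N d (\<lambda>_. False)" s "\<lambda>_. False"] by auto
next
  case (While e c)
  let ?F = "\<lambda>X s. if aval e s = 0 then False else wp N c X s"
  have "\<not> (?F ^^ k) (\<lambda>s. False) s" for k s
  proof (induction k arbitrary: s)
    case (Suc k)
    have "\<not> wp N c ((?F ^^ k) (\<lambda>s. False)) s"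
      using While.IH[of s] wp_mono[of N c "(?F ^^ k) (\<lambda>s. False)" s "\<lambda>_. False"] Suc.IH
      by blast
    then show ?case by simp
  qed simp
  then show ?case by simp
qed auto

text \<open>The initial measure bounds the number of iterations, so \<open>\<mu> s \<le> N\<close>
  yields termination and the unrolling depth of \<open>wp\<close> at once.\<close>

lemma wp_while:
  fixes \<mu> :: "store \<Rightarrow> nat"
  assumes "I s" "\<mu> s \<le> N"
    and step: "\<And>s. I s \<Longrightarrow> aval e s \<noteq> 0 \<Longrightarrow> wp N c (\<lambda>s'. I s' \<and> \<mu> s' < \<mu> s) s"
    and exit: "\<And>s. I s \<Longrightarrow> aval e s = 0 \<Longrightarrow> Q s"
  shows "wp N (While e c) Q s"
proof -
  let ?F = "\<lambda>X s. if aval e s = 0 then Q s else wp N c X s"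
  have "(?F ^^ k) (\<lambda>s. aval e s = 0 \<and> Q s) s" if "I s" "\<mu> s \<le> k \<or> aval e s = 0" for k s
    using that
  proof (induction k arbitrary: s)
    case 0
    \<comment> \<open>At depth 0 the measure is 0 or the condition fails; an iteration from measure
      0 would have to decrease it further.\<close>
    have "aval e s = 0"
    proof (rule ccontr)
      assume "aval e s \<noteq> 0"
      with step[OF 0(1) this] 0 have "wp N c (\<lambda>_. False) s"
        by (auto elim: wp_mono)
      moreover have "\<not> wp N c (\<lambda>_. False) s"
        by (rule not_wp_False)
      ultimately show False by simp
    qed
    then show ?case using 0 exit by simp
  next
    case (Suc k)
    show ?case
    proof (cases "aval e s = 0")
      case True
      then show ?thesis using Suc.prems exit by simp
    next
      case False
      have "wp N c ((?F ^^ k) (\<lambda>s. aval e s = 0 \<and> Q s)) s"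
        using step[OF Suc.prems(1) False]
      proof (rule wp_mono)
        fix s' assume "I s' \<and> \<mu> s' < \<mu> s"
        then show "(?F ^^ k) (\<lambda>s. aval e s = 0 \<and> Q s) s'"
          using Suc.prems False by (intro Suc.IH) auto
      qed
      then show ?thesis using False by simp
    qed
  qed
  then show ?thesis using assms(1,2) by simp
qed

section \<open>Unit flows\<close>

definition net :: "('v \<times> 'v) set \<Rightarrow> ('v \<times> 'v \<Rightarrow> real) \<Rightarrow> 'v \<Rightarrow> real" where
  "net E f v = (\<Sum>e | e \<in> E \<and> snd e = v. f e) - (\<Sum>e | e \<in> E \<and> fst e = v. f e)"

lemma net_scale: "net E (\<lambda>e. x * f e) v = x * net E f v"
  by (simp add: net_def sum_distrib_left right_diff_distrib)

lemma net_add: "net E (\<lambda>e. f e + g e) v = net E f v + net E g v"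
  by (simp add: net_def sum.distrib)

lemma net_diff: "net E (\<lambda>e. f e - g e) v = net E f v - net E g v"
  by (simp add: net_def sum_subtractf)

lemma net_edge:
  assumes "finite E" "(x, y) \<in> E"
  shows "net E (\<lambda>e. of_bool (e = (x, y))) v = of_bool (v = y) - of_bool (v = x)"
proof -
  have "(\<Sum>e | e \<in> E \<and> h e = v. of_bool (e = (x, y))) = (of_bool (v = h (x, y)) :: real)"
    for h :: "'a \<times> 'a \<Rightarrow> 'a"
    using assms by (subst of_bool_def, subst sum.delta) auto
  then show ?thesis by (simp add: net_def)
qed

text \<open>Summation by parts. Lower bounds on flows are instances for a suitable potential
  \<open>h\<close>: distances to the target bound the length of a flow, indicators of vertex sets
  give cuts.\<close>

lemma sum_potential_net:
  assumes "finite V" "finite E" "E \<subseteq> V \<times> V"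
  shows "(\<Sum>v\<in>V. h v * net E f v) = (\<Sum>e\<in>E. f e * (h (snd e) - h (fst e)))"
proof -
  have group: "(\<Sum>v\<in>V. h v * (\<Sum>e | e \<in> E \<and> p e = v. f e)) = (\<Sum>e\<in>E. f e * h (p e))"
    if "p ` E \<subseteq> V" for p
  proof -
    have "(\<Sum>v\<in>V. h v * (\<Sum>e | e \<in> E \<and> p e = v. f e))
        = (\<Sum>v\<in>V. \<Sum>e | e \<in> E \<and> p e = v. f e * h (p e))"
      by (auto simp: sum_distrib_left mult.commute intro!: sum.cong)
    also have "\<dots> = (\<Sum>e\<in>E. f e * h (p e))"
      using assms that by (intro sum.group) auto
    finally show ?thesis .
  qed
  have "snd ` E \<subseteq> V" "fst ` E \<subseteq> V" using assms(3) by auto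
  then show ?thesis
    by (simp add: net_def right_diff_distrib sum_subtractf group)
qed

definition unit_flow :: "'v set \<Rightarrow> ('v \<times> 'v) set \<Rightarrow> 'v \<times> 'v \<Rightarrow> ('v \<times> 'v \<Rightarrow> real) \<Rightarrow> bool" where
  "unit_flow V E \<kappa> f \<longleftrightarrow> (\<forall>e\<in>E. 0 \<le> f e) \<and>
     (\<forall>v\<in>V. net E f v = of_bool (v = snd \<kappa>) - of_bool (v = fst \<kappa>))"

lemma unit_flow_potential:
  assumes "finite V" "finite E" "E \<subseteq> V \<times> V" "unit_flow V E (s, t) f" "s \<in> V" "t \<in> V"
  shows "(\<Sum>e\<in>E. f e * (h (snd e) - h (fst e))) = h t - h s"
proof -
  have "(\<Sum>e\<in>E. f e * (h (snd e) - h (fst e)))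
      = (\<Sum>v\<in>V. h v * (of_bool (v = t) - of_bool (v = s)))"
    using assms(4) by (simp flip: sum_potential_net[OF assms(1-3)] add: unit_flow_def)
  also have "\<dots> = (\<Sum>v\<in>V. if v = t then h v else 0) - (\<Sum>v\<in>V. if v = s then h v else 0)"
    by (auto simp: right_diff_distrib sum_subtractf of_bool_def if_distrib[of "(*) _"]
        intro!: arg_cong2[where f = "(-)"] sum.cong)
  also have "\<dots> = h t - h s"
    using assms(1,5,6) by simp
  finally show ?thesis .
qed

text \<open>Linear programming duality: \<open>h\<close> falls by at most one along an edge, so it
  is a dual feasible potential of the shortest-path program.\<close>

lemma unit_flow_ge_dist:
  fixes h :: "'v \<Rightarrow> nat"
  assumes "finite V" "finite E" "E \<subseteq> V \<times> V" "unit_flow V E (s, t) f" "s \<in> V" "t \<in> V"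
    and h: "\<And>u v. (u, v) \<in> E \<Longrightarrow> h u \<le> h v + 1" "h t = 0"
  shows "real (h s) \<le> (\<Sum>e\<in>E. f e)"
proof -
  have "(\<Sum>e\<in>E. f e * (real (h (fst e)) - real (h (snd e)))) \<le> (\<Sum>e\<in>E. f e * 1)"
    using assms(4) h(1)[of "fst e" "snd e" for e]
    by (intro sum_mono mult_left_mono) (fastforce simp: unit_flow_def)+
  moreover have "(\<Sum>e\<in>E. f e * (real (h (fst e)) - real (h (snd e))))
      = - (\<Sum>e\<in>E. f e * (real (h (snd e)) - real (h (fst e))))"
    by (simp add: sum_negf[symmetric] algebra_simps)
  ultimately show ?thesis
    using unit_flow_potential[OF assms(1-6), of "\<lambda>v. real (h v)"] h(2) by simp
qed

section \<open>Cuts, cycles and path flows\<close>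

lemma unit_flow_cut:
  assumes "finite V" "finite E" "E \<subseteq> V \<times> V" "unit_flow V E (s, t) f" "s \<in> V" "t \<in> V"
  shows "(\<Sum>e | e \<in> E \<and> fst e \<notin> A \<and> snd e \<in> A. f e) - (\<Sum>e | e \<in> E \<and> fst e \<in> A \<and> snd e \<notin> A. f e)
    = of_bool (t \<in> A) - of_bool (s \<in> A)"
proof -
  have "(\<Sum>e\<in>E. f e * (of_bool (snd e \<in> A) - of_bool (fst e \<in> A)))
      = (\<Sum>e\<in>E. (if fst e \<notin> A \<and> snd e \<in> A then f e else 0)
           - (if fst e \<in> A \<and> snd e \<notin> A then f e else 0))"
    by (intro sum.cong) auto
  also have "\<dots> = (\<Sum>e | e \<in> E \<and> fst e \<notin> A \<and> snd e \<in> A. f e)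
      - (\<Sum>e | e \<in> E \<and> fst e \<in> A \<and> snd e \<notin> A. f e)"
    using assms(2) by (simp add: sum_subtractf sum.inter_filter)
  finally show ?thesis
    using unit_flow_potential[OF assms, of "\<lambda>v. of_bool (v \<in> A)"] by simp
qed

text \<open>No edge leaves the set of vertices reachable from \<open>s\<close>, whereas a unit flow
  to a vertex outside would have to leave it.\<close>

lemma unit_flow_reachable:
  assumes "finite V" "finite E" "E \<subseteq> V \<times> V" "unit_flow V E (s, t) f" "s \<in> V" "t \<in> V"
  shows "(s, t) \<in> E\<^sup>*"
proof (rule ccontr)
  define A where "A = E\<^sup>* `` {s}"
  assume "(s, t) \<notin> E\<^sup>*"
  then have "t \<notin> A" "s \<in> A" by (auto simp: A_def)
  moreover have "{e \<in> E. fst e \<in> A \<and> snd e \<notin> A} = {}"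
    by (auto simp: A_def intro: rtrancl_into_rtrancl)
  then have "(\<Sum>e | e \<in> E \<and> fst e \<in> A \<and> snd e \<notin> A. f e) = 0"
    by (metis (mono_tags) sum.empty)
  moreover have "0 \<le> (\<Sum>e | e \<in> E \<and> fst e \<notin> A \<and> snd e \<in> A. f e)"
    using assms(4) by (intro sum_nonneg) (auto simp: unit_flow_def)
  ultimately show False
    using unit_flow_cut[OF assms, of A] by simp
qed

text \<open>An edge that carries more than a path flow could lies on a cycle of the flow.\<close>

lemma unit_flow_excess_cycle:
  assumes "finite V" "finite E" "E \<subseteq> V \<times> V" "unit_flow V E (s, t) f" "s \<in> V" "t \<in> V"
    and e: "(u, v) \<in> E" "f (u, v) > of_bool (v \<noteq> s)"
  shows "(v, u) \<in> {e \<in> E. 0 < f e}\<^sup>*"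
proof (rule ccontr)
  let ?R = "{e \<in> E. 0 < f e}"
  define A where "A = ?R\<^sup>* `` {v}"
  assume "(v, u) \<notin> ?R\<^sup>*"
  then have uv: "u \<notin> A" "v \<in> A" by (auto simp: A_def)
  have nonneg: "0 \<le> f e" if "e \<in> E" for e
    using assms(4) that by (simp add: unit_flow_def)
  have leave: "f e = 0" if "e \<in> E" "fst e \<in> A" "snd e \<notin> A" for e
  proof (rule ccontr)
    assume "f e \<noteq> 0"
    then have "e \<in> ?R" using nonneg[OF that(1)] that(1) by simp
    then have "(fst e, snd e) \<in> ?R" by simp
    then have "snd e \<in> A"
      using that(2) unfolding A_def by (auto simp del: prod.collapse intro: rtrancl_into_rtrancl)
    then show False using that(3) by simp
  qed
  have "(\<Sum>e | e \<in> E \<and> fst e \<in> A \<and> snd e \<notin> A. f e) = 0"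
    using leave by (intro sum.neutral) auto
  moreover have "f (u, v) \<le> (\<Sum>e | e \<in> E \<and> fst e \<notin> A \<and> snd e \<in> A. f e)"
    using e uv nonneg assms(2) by (intro member_le_sum) auto
  \<comment> \<open>For \<open>v = s\<close> the source lies in \<open>A\<close>, so the net flow
    into \<open>A\<close> is at most 0; otherwise it is at most 1. As nothing flows out of
    \<open>A\<close>, this bounds the flow on the edge into \<open>v\<close>.\<close>
  moreover have "of_bool (t \<in> A) - of_bool (s \<in> A) \<le> (of_bool (v \<noteq> s) :: real)"
    using uv by auto
  ultimately show False
    using unit_flow_cut[OF assms(1-6), of A] e(2) by linarith
qed

text \<open>\<open>c\<close> counts the traversals of a walk, which may repeat edges; this suffices
  where the result is scaled down afterwards.\<close>

lemma path_flow:
  assumes "(x, y) \<in> R\<^sup>*" "R \<subseteq> E" "finite E"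
  shows "\<exists>c. (\<forall>e. 0 \<le> c e) \<and> (\<forall>e. e \<notin> R \<longrightarrow> c e = 0) \<and>
    (\<forall>v. net E c v = of_bool (v = y) - of_bool (v = x))"
  using assms(1)
proof (induction rule: rtrancl_induct)
  case base
  show ?case by (intro exI[of _ "\<lambda>_. 0"]) (auto simp: net_def)
next
  case (step y z)
  then obtain c where c: "\<forall>e. 0 \<le> c e" "\<forall>e. e \<notin> R \<longrightarrow> c e = 0"
    "\<forall>v. net E c v = of_bool (v = y) - of_bool (v = x)" by blast
  have "(y, z) \<in> E" using step(2) assms(2) by blast
  then show ?case
    using c step(2) net_edge[OF assms(3), of y z]
    by (intro exI[of _ "\<lambda>e. c e + of_bool (e = (y, z))"]) (auto simp: net_add)
qed

text \<open>On a shortest path the distance \<open>\<delta>\<close> to \<open>y\<close> drops along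
  every edge used. Hence no edge is used twice and none leads back to \<open>x\<close>; the latter
  is the form in which capacities are checked.\<close>

lemma simple_path_flow:
  assumes "(x, y) \<in> R\<^sup>*" "R \<subseteq> E" "finite E"
  shows "\<exists>c. (\<forall>e. 0 \<le> c e \<and> c e \<le> of_bool (snd e \<noteq> x)) \<and> (\<forall>e. e \<notin> R \<longrightarrow> c e = 0) \<and>
    (\<forall>v. net E c v = of_bool (v = y) - of_bool (v = x))"
proof -
  define \<delta> where "\<delta> x = (LEAST k. (x, y) \<in> R ^^ k)" for x
  have next_vertex: "\<exists>x'. (x, x') \<in> R \<and> (x', y) \<in> R\<^sup>* \<and> \<delta> x' < \<delta> x"
    if xy: "(x, y) \<in> R\<^sup>*" "x \<noteq> y" for x
  proof -
    have path: "(x, y) \<in> R ^^ \<delta> x"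
      using xy(1) unfolding \<delta>_def by (metis LeastI rtrancl_imp_relpow)
    moreover have "\<delta> x \<noteq> 0" using path xy(2) by (intro notI) simp
    ultimately obtain k x' where k: "\<delta> x = Suc k" "(x, x') \<in> R" "(x', y) \<in> R ^^ k"
      by (metis not0_implies_Suc relpow_Suc_D2)
    then have "\<delta> x' \<le> k" unfolding \<delta>_def by (intro Least_le)
    with k show ?thesis by (auto intro: relpow_imp_rtrancl)
  qed
  \<comment> \<open>The distance bounds belong to the induction: they show that the edge put in
    front of the path is not yet on it.\<close>
  have "\<exists>c. (\<forall>e. 0 \<le> c e \<and> c e \<le> 1 \<and> (c e \<noteq> 0 \<longrightarrow> e \<in> R \<and> \<delta> (snd e) < \<delta> (fst e) \<and> \<delta> (fst e) \<le> \<delta> x)) \<and>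
    (\<forall>v. net E c v = of_bool (v = y) - of_bool (v = x))"
    using assms(1)
  proof (induction "\<delta> x" arbitrary: x rule: less_induct)
    case less
    show ?case
    proof (cases "x = y")
      case True
      then show ?thesis by (intro exI[of _ "\<lambda>_. 0"]) (auto simp: net_def)
    next
      case False
      from next_vertex[OF less.prems False] obtain x' where
        x': "(x, x') \<in> R" "(x', y) \<in> R\<^sup>*" "\<delta> x' < \<delta> x" by blast
      from less.hyps[OF x'(3,2)] obtain c where
        c: "\<forall>e. 0 \<le> c e \<and> c e \<le> 1 \<and>
          (c e \<noteq> 0 \<longrightarrow> e \<in> R \<and> \<delta> (snd e) < \<delta> (fst e) \<and> \<delta> (fst e) \<le> \<delta> x')"
        "\<forall>v. net E c v = of_bool (v = y) - of_bool (v = x')" by blast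
      have "c (x, x') = 0" using c(1) x'(3) by fastforce
      moreover have "\<delta> (fst e) \<le> \<delta> x" if "c e \<noteq> 0" for e
        using c(1) that x'(3) by fastforce
      moreover have "(x, x') \<in> E" using x'(1) assms(2) by blast
      ultimately show ?thesis
        using c x' net_edge[OF assms(3), of x x']
        by (intro exI[of _ "\<lambda>e. c e + of_bool (e = (x, x'))"]) (auto simp: net_add)
    qed
  qed
  then obtain c where c: "\<forall>e. 0 \<le> c e \<and> c e \<le> 1 \<and>
      (c e \<noteq> 0 \<longrightarrow> e \<in> R \<and> \<delta> (snd e) < \<delta> (fst e) \<and> \<delta> (fst e) \<le> \<delta> x)"
    "\<forall>v. net E c v = of_bool (v = y) - of_bool (v = x)" by blast
  have "c e \<le> of_bool (snd e \<noteq> x)" for e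
    using c(1)[rule_format, of e] by (cases "c e = 0") auto
  with c show ?thesis by blast
qed

text \<open>Makes cycle cancelling possible for real flows: a small enough multiple of a cycle
  within the support of a flow can be subtracted from it.\<close>

lemma exists_scale_below:
  fixes f w :: "'a \<Rightarrow> real"
  assumes "finite E" "\<forall>e\<in>E. 0 \<le> w e \<and> 0 \<le> f e \<and> (0 < w e \<longrightarrow> 0 < f e)"
  shows "\<exists>\<epsilon>>0. \<forall>e\<in>E. \<epsilon> * w e \<le> f e"
  using assms
proof (induction rule: finite_induct)
  case empty
  show ?case by (intro exI[of _ 1]) simp
next
  case (insert e E)
  then obtain \<epsilon> where \<epsilon>: "\<epsilon> > 0" "\<forall>e\<in>E. \<epsilon> * w e \<le> f e" by auto
  show ?case
  proof (cases "w e = 0")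
    case True
    with \<epsilon> insert.prems show ?thesis by auto
  next
    case False
    then have pos: "0 < w e" "0 < f e" using insert.prems by (auto simp: less_le)
    have "min \<epsilon> (f e / w e) * w e' \<le> f e'" if "e' \<in> E" for e'
      using \<epsilon> that insert.prems mult_right_mono[of "min \<epsilon> (f e / w e)" \<epsilon> "w e'"]
      by fastforce
    moreover have "min \<epsilon> (f e / w e) * w e \<le> f e"
      using pos mult_right_mono[of "min \<epsilon> (f e / w e)" "f e / w e" "w e"] by simp
    ultimately show ?thesis using \<epsilon>(1) pos
      by (intro exI[of _ "min \<epsilon> (f e / w e)"]) auto
  qed
qed

section \<open>Cost-optimal modal splits\<close>

text \<open>A solution is represented by its flows \<open>f\<close>, the public parts \<open>g\<close> of these flows, and its layout.\<close>

locale unit_demand_network =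
  fixes V :: "'v set" and E :: "('v \<times> 'v) set"
    and \<tau>\<^sub>0 \<tau>\<^sub>1 \<eta>\<^sub>0 \<eta>\<^sub>1 k c B :: real
  assumes finite_V: "finite V" and edges: "E \<subseteq> V \<times> V" and two_vertices: "2 \<le> card V"
    and times: "0 \<le> \<tau>\<^sub>0" "0 \<le> \<tau>\<^sub>1" and energies: "0 \<le> \<eta>\<^sub>1" "\<eta>\<^sub>1 < \<eta>\<^sub>0"
    and large_capacity: "(real (card V) - 1)\<^sup>2 \<le> k"
    and cheap: "0 \<le> c" "c \<le> 1" "real (card E) \<le> B"
begin

definition K :: "('v \<times> 'v) set" where
  "K = (SIGMA s:V. V - {s})"

definition feasible :: "('v \<times> 'v \<Rightarrow> 'v \<times> 'v \<Rightarrow> real) \<Rightarrow> ('v \<times> 'v \<Rightarrow> 'v \<times> 'v \<Rightarrow> real) \<Rightarrow> ('v \<times> 'v \<Rightarrow> nat) \<Rightarrow> bool"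
  where "feasible f g L \<longleftrightarrow>
    (\<forall>\<kappa>\<in>K. unit_flow V E \<kappa> (f \<kappa>)) \<and>
    (\<forall>\<kappa>\<in>K. \<forall>e\<in>E. 0 \<le> g \<kappa> e \<and> g \<kappa> e \<le> f \<kappa> e) \<and>
    (\<forall>e\<in>E. (\<Sum>\<kappa>\<in>K. g \<kappa> e) \<le> k * real (L e)) \<and>
    c * real (\<Sum>e\<in>E. L e) \<le> B"

definition total :: "('v \<times> 'v \<Rightarrow> 'v \<times> 'v \<Rightarrow> real) \<Rightarrow> real" where
  "total f = (\<Sum>\<kappa>\<in>K. \<Sum>e\<in>E. f \<kappa> e)"

definition priv :: "('v \<times> 'v \<Rightarrow> 'v \<times> 'v \<Rightarrow> real) \<Rightarrow> ('v \<times> 'v \<Rightarrow> 'v \<times> 'v \<Rightarrow> real) \<Rightarrow> real" where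
  "priv f g = total f - total g"

definition time :: "('v \<times> 'v \<Rightarrow> 'v \<times> 'v \<Rightarrow> real) \<Rightarrow> ('v \<times> 'v \<Rightarrow> 'v \<times> 'v \<Rightarrow> real) \<Rightarrow> real" where
  "time f g = \<tau>\<^sub>0 * priv f g + \<tau>\<^sub>1 * total g"

definition energy :: "('v \<times> 'v \<Rightarrow> 'v \<times> 'v \<Rightarrow> real) \<Rightarrow> ('v \<times> 'v \<Rightarrow> 'v \<times> 'v \<Rightarrow> real) \<Rightarrow> ('v \<times> 'v \<Rightarrow> nat) \<Rightarrow> real"
  where "energy f g L = \<eta>\<^sub>0 * priv f g + \<eta>\<^sub>1 * real (\<Sum>e\<in>E. L e)"

lemma finite_E: "finite E"
  using finite_V edges by (meson finite_SigmaI finite_subset)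

lemma finite_K: "finite K"
  by (simp add: K_def finite_V)

lemma \<eta>\<^sub>0_pos: "0 < \<eta>\<^sub>0"
  using energies by linarith

lemma K_D: "\<kappa> \<in> K \<Longrightarrow> fst \<kappa> \<in> V \<and> snd \<kappa> \<in> V \<and> fst \<kappa> \<noteq> snd \<kappa>"
  by (auto simp: K_def)

lemma mem_K: "(s, t) \<in> K \<longleftrightarrow> s \<in> V \<and> t \<in> V \<and> s \<noteq> t"
  by (auto simp: K_def)

lemma feasible_nonneg: "feasible f g L \<Longrightarrow> \<kappa> \<in> K \<Longrightarrow> e \<in> E \<Longrightarrow> 0 \<le> f \<kappa> e"
  by (auto simp: feasible_def unit_flow_def)

lemma total_swap: "total f = (\<Sum>e\<in>E. \<Sum>\<kappa>\<in>K. f \<kappa> e)"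
  unfolding total_def by (rule sum.swap)

lemma total_fun_upd: "\<kappa> \<in> K \<Longrightarrow> total (f(\<kappa> := \<phi>)) = total f + (\<Sum>e\<in>E. \<phi> e - f \<kappa> e)"
  unfolding total_def using finite_K
  by (simp add: sum.remove[of K \<kappa>] sum_subtractf)

lemma priv_eq: "priv f g = (\<Sum>\<kappa>\<in>K. \<Sum>e\<in>E. f \<kappa> e - g \<kappa> e)"
  by (simp add: priv_def total_def sum_subtractf)

lemma priv_nonneg: "feasible f g L \<Longrightarrow> 0 \<le> priv f g"
  unfolding priv_eq by (intro sum_nonneg) (auto simp: feasible_def)

lemma total_nonneg: "feasible f g L \<Longrightarrow> 0 \<le> total g"
  unfolding total_def by (intro sum_nonneg) (auto simp: feasible_def)

lemma time_nonneg: "feasible f g L \<Longrightarrow> 0 \<le> time f g"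
  using priv_nonneg total_nonneg times by (simp add: time_def)

text \<open>\<open>(n - 1)\<^sup>2\<close> counts the commodities that do not start at
  \<open>v\<close>: \<open>n - 1\<close> sources with \<open>n - 1\<close> targets each. So one
  vehicle on an edge into \<open>v\<close> carries all flows that use at most one unit of it and
  avoid entering their own source.\<close>

lemma sum_le_capacity:
  assumes "\<And>\<kappa>. \<kappa> \<in> K \<Longrightarrow> \<phi> \<kappa> \<le> of_bool (v \<noteq> fst \<kappa>)"
  assumes "v \<in> V"
  shows "(\<Sum>\<kappa>\<in>K. \<phi> \<kappa>) \<le> k"
proof -
  have "(\<Sum>\<kappa>\<in>K. \<phi> \<kappa>) \<le> (\<Sum>\<kappa>\<in>K. of_bool (v \<noteq> fst \<kappa>))"
    using assms(1) by (rule sum_mono)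
  also have "\<dots> = (\<Sum>s\<in>V. \<Sum>t\<in>V-{s}. of_bool (v \<noteq> s))"
    unfolding K_def by (subst sum.Sigma) (simp_all add: finite_V case_prod_unfold)
  also have "\<dots> = (\<Sum>s\<in>V. (real (card V) - 1) * of_bool (v \<noteq> s))"
    using finite_V two_vertices by (intro sum.cong) (auto simp: of_nat_diff)
  also have "\<dots> = (real (card V) - 1) * real (card (V - {v}))"
    using finite_V by (simp add: sum_distrib_left[symmetric] sum.If_cases of_bool_def
        set_diff_eq Collect_conj_eq conj_commute eq_commute)
  also have "\<dots> = (real (card V) - 1)\<^sup>2"
    using finite_V assms(2) two_vertices by (simp add: of_nat_diff power2_eq_square)
  finally show ?thesis using large_capacity by linarith
qed

lemma budget_ok:
  assumes "\<And>e. e \<in> E \<Longrightarrow> L e \<le> 1"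
  shows "c * real (\<Sum>e\<in>E. L e) \<le> B"
proof -
  have "(\<Sum>e\<in>E. L e) \<le> (\<Sum>e\<in>E. 1)" using assms by (intro sum_mono) auto
  then have "real (\<Sum>e\<in>E. L e) \<le> real (card E)" by (simp del: of_nat_sum)
  moreover have "c * real (\<Sum>e\<in>E. L e) \<le> 1 * real (\<Sum>e\<in>E. L e)"
    using cheap by (intro mult_right_mono) (auto simp del: of_nat_sum)
  ultimately show ?thesis using cheap(3) by linarith
qed

lemma total_ge_dist:
  fixes d :: "'v \<Rightarrow> 'v \<Rightarrow> nat"
  assumes "feasible f g L"
    and "\<And>t. t \<in> V \<Longrightarrow> d t t = 0" "\<And>u v t. (u, v) \<in> E \<Longrightarrow> t \<in> V \<Longrightarrow> d u t \<le> d v t + 1"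
  shows "real (\<Sum>(s, t)\<in>K. d s t) \<le> total f"
  unfolding total_def of_nat_sum
proof (rule sum_mono)
  fix \<kappa> assume \<kappa>: "\<kappa> \<in> K"
  then have "unit_flow V E (fst \<kappa>, snd \<kappa>) (f \<kappa>)" using assms(1) by (simp add: feasible_def)
  from unit_flow_ge_dist[OF finite_V finite_E edges this, of "\<lambda>v. d v (snd \<kappa>)"]
  show "real (case \<kappa> of (s, t) \<Rightarrow> d s t) \<le> (\<Sum>e\<in>E. f \<kappa> e)"
    using K_D[OF \<kappa>] assms(2,3) by (simp add: case_prod_unfold)
qed

lemma energy_ge_card:
  assumes "feasible f g L"
  shows "real (card V) * \<eta>\<^sub>1 \<le> energy f g L"
proof -
  \<comment> \<open>The part of the energy that is charged to the edge \<open>e\<close>.\<close>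
  let ?p = "\<lambda>e. \<eta>\<^sub>0 * (\<Sum>\<kappa>\<in>K. f \<kappa> e - g \<kappa> e) + \<eta>\<^sub>1 * real (L e)"
  have p_nonneg: "0 \<le> ?p e" if "e \<in> E" for e
    using assms that \<eta>\<^sub>0_pos energies
    by (intro add_nonneg_nonneg mult_nonneg_nonneg sum_nonneg) (auto simp: feasible_def)
  have "\<eta>\<^sub>1 \<le> (\<Sum>e | e \<in> E \<and> fst e = v. ?p e)" if v: "v \<in> V" for v
  proof (cases "\<exists>e\<in>E. fst e = v \<and> L e \<noteq> 0")
    case True
    then obtain e where e: "e \<in> E" "fst e = v" "L e \<noteq> 0" by blast
    have "\<eta>\<^sub>1 * 1 \<le> \<eta>\<^sub>1 * real (L e)"
      using e energies by (intro mult_left_mono) auto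
    also have "\<dots> \<le> ?p e"
      using assms e \<eta>\<^sub>0_pos by (auto simp: feasible_def intro!: mult_nonneg_nonneg sum_nonneg)
    also have "\<dots> \<le> (\<Sum>e | e \<in> E \<and> fst e = v. ?p e)"
      using e p_nonneg finite_E by (intro member_le_sum) auto
    finally show ?thesis by simp
  next
    case False
    \<comment> \<open>No vehicle leaves \<open>v\<close>, so all flow out of \<open>v\<close> is
      private. The commodity from \<open>v\<close> to any other vertex contributes at least one
      unit, at the higher price \<open>\<eta>\<^sub>0\<close>.\<close>
    then have L0: "L e = 0" if "e \<in> E" "fst e = v" for e using that by blast
    have g0: "g \<kappa> e = 0" if "e \<in> E" "fst e = v" "\<kappa> \<in> K" for e \<kappa>
    proof -
      have "(\<Sum>\<kappa>\<in>K. g \<kappa> e) \<le> k * real (L e)" using assms that(1) by (simp add: feasible_def)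
      moreover have g: "0 \<le> g \<kappa> e" if "\<kappa> \<in> K" for \<kappa>
        using assms that \<open>e \<in> E\<close> by (simp add: feasible_def)
      moreover have "g \<kappa> e \<le> (\<Sum>\<kappa>\<in>K. g \<kappa> e)"
        using finite_K that(3) g by (intro member_le_sum) auto
      ultimately show ?thesis using L0[OF that(1,2)] that(3) by (intro antisym) auto
    qed
    have "\<exists>t\<in>V. t \<noteq> v"
    proof (rule ccontr)
      assume "\<not> (\<exists>t\<in>V. t \<noteq> v)"
      then have "V \<subseteq> {v}" by blast
      then show False using two_vertices card_mono[of "{v}" V] by simp
    qed
    then obtain t where t: "t \<in> V" "t \<noteq> v" by blast
    then have \<kappa>: "(v, t) \<in> K" using v by (simp add: mem_K)
    have flow: "unit_flow V E (v, t) (f (v, t))" using assms \<kappa> by (simp add: feasible_def)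
    have "0 \<le> (\<Sum>e | e \<in> E \<and> snd e = v. f (v, t) e)"
      using assms \<kappa> by (intro sum_nonneg) (auto simp: feasible_nonneg)
    then have "1 \<le> (\<Sum>e | e \<in> E \<and> fst e = v. f (v, t) e)"
      using flow v t by (auto simp: unit_flow_def net_def)
    also have "\<dots> \<le> (\<Sum>e | e \<in> E \<and> fst e = v. \<Sum>\<kappa>\<in>K. f \<kappa> e)"
      using assms \<kappa> finite_K by (intro sum_mono member_le_sum) (auto simp: feasible_nonneg)
    finally have "\<eta>\<^sub>0 * 1 \<le> \<eta>\<^sub>0 * (\<Sum>e | e \<in> E \<and> fst e = v. \<Sum>\<kappa>\<in>K. f \<kappa> e)"
      using \<eta>\<^sub>0_pos by (intro mult_left_mono) auto
    also have "\<dots> = (\<Sum>e | e \<in> E \<and> fst e = v. ?p e)"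
      using L0 g0 by (simp add: sum_distrib_left)
    finally show ?thesis using energies by linarith
  qed
  then have "(\<Sum>v\<in>V. \<eta>\<^sub>1) \<le> (\<Sum>v\<in>V. \<Sum>e | e \<in> E \<and> fst e = v. ?p e)"
    by (rule sum_mono)
  also have "\<dots> = (\<Sum>e\<in>E. ?p e)"
    using finite_V finite_E edges by (intro sum.group) auto
  also have "\<dots> = energy f g L"
    by (simp add: energy_def priv_def total_swap sum.distrib sum_distrib_left[symmetric] sum_subtractf)
  finally show ?thesis by simp
qed

end

section \<open>Exchange arguments at an optimum\<close>

locale optimal_split = unit_demand_network V E \<tau>\<^sub>0 \<tau>\<^sub>1 \<eta>\<^sub>0 \<eta>\<^sub>1 k c B
  for V :: "'v set" and E \<tau>\<^sub>0 \<tau>\<^sub>1 \<eta>\<^sub>0 \<eta>\<^sub>1 k c B +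
  fixes f g L a
  assumes feas: "feasible f g L" and in_time: "time f g \<le> a"
    and min_energy: "\<And>f' g' L'. feasible f' g' L' \<Longrightarrow> time f' g' \<le> a \<Longrightarrow> energy f g L \<le> energy f' g' L'"
    and min_time: "\<And>f' g' L'. feasible f' g' L' \<Longrightarrow> energy f' g' L' = energy f g L \<Longrightarrow> time f g \<le> time f' g'"
    and slower: "\<tau>\<^sub>0 < \<tau>\<^sub>1"
begin

text \<open>Cancel \<open>h\<close> and scale the public part by the same factor on each edge. If
  private flow disappears, the energy drops, contrary to \<open>min_energy\<close>. Otherwise only
  public flow disappears: the energy stays and the time drops, since
  \<open>\<tau>\<^sub>1 > \<tau>\<^sub>0 \<ge> 0\<close>, contrary to
  \<open>min_time\<close>.\<close>

lemma no_circulation: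
  assumes \<kappa>: "\<kappa> \<in> K" and h: "\<And>e. e \<in> E \<Longrightarrow> 0 \<le> h e \<and> h e \<le> f \<kappa> e"
    and circ: "\<And>v. v \<in> V \<Longrightarrow> net E h v = 0" and e: "e\<^sub>1 \<in> E" "0 < h e\<^sub>1"
  shows False
proof -
  define f' where "f' = f(\<kappa> := \<lambda>e. f \<kappa> e - h e)"
  \<comment> \<open>Where \<open>f \<kappa> e = 0\<close>, also \<open>g \<kappa> e = 0\<close>, so
    the default value of the quotient does no harm.\<close>
  define g' where "g' = g(\<kappa> := \<lambda>e. g \<kappa> e * (1 - h e / f \<kappa> e))"
  \<comment> \<open>\<open>x\<close> and \<open>y\<close> are the private and the public amounts
    that are cancelled.\<close>
  define x where "x = (\<Sum>e\<in>E. (f \<kappa> e - g \<kappa> e) * (h e / f \<kappa> e))"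
  define y where "y = (\<Sum>e\<in>E. g \<kappa> e * (h e / f \<kappa> e))"
  have g: "0 \<le> g \<kappa> e" "g \<kappa> e \<le> f \<kappa> e" if "e \<in> E" for e
    using feas \<kappa> that by (auto simp: feasible_def)
  have fh: "f \<kappa> e * (h e / f \<kappa> e) = h e" if "e \<in> E" for e
    using h[OF that] by (cases "f \<kappa> e = 0") auto
  have ratio: "0 \<le> h e / f \<kappa> e" "h e / f \<kappa> e \<le> 1" if "e \<in> E" for e
    using h[OF that] by (auto simp: divide_le_eq_1)
  have g'le: "g' \<kappa>' e \<le> g \<kappa>' e" if "e \<in> E" for \<kappa>' e
    using g[OF that] ratio[OF that] by (auto simp: g'_def mult_left_le)
  have xy: "0 \<le> x" "0 \<le> y"
    unfolding x_def y_def by (intro sum_nonneg mult_nonneg_nonneg ratio; use g in simp)+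
  have "x + y = (\<Sum>e\<in>E. h e)"
    unfolding x_def y_def sum.distrib[symmetric]
  proof (rule sum.cong)
    fix e assume "e \<in> E"
    have "(f \<kappa> e - g \<kappa> e) * r + g \<kappa> e * r = f \<kappa> e * r" for r by (simp add: algebra_simps)
    then show "(f \<kappa> e - g \<kappa> e) * (h e / f \<kappa> e) + g \<kappa> e * (h e / f \<kappa> e) = h e"
      using fh[OF \<open>e \<in> E\<close>] by (simp only:)
  qed simp
  moreover have "0 < (\<Sum>e\<in>E. h e)"
    using finite_E e h by (intro sum_pos2) auto
  ultimately have pos: "0 < x + y" by simp
  have "feasible f' g' L"
    unfolding feasible_def
  proof (intro conjI ballI)
    fix \<kappa>' assume "\<kappa>' \<in> K"
    then show "unit_flow V E \<kappa>' (f' \<kappa>')"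
      using feas h circ by (auto simp: feasible_def f'_def unit_flow_def net_diff)
  next
    fix \<kappa>' e assume "\<kappa>' \<in> K" and e: "e \<in> E"
    moreover have "g \<kappa> e * (1 - h e / f \<kappa> e) \<le> f \<kappa> e - h e"
      using mult_right_mono[OF g(2)[OF e], of "1 - h e / f \<kappa> e"] ratio[OF e] fh[OF e]
      by (simp add: right_diff_distrib)
    ultimately show "0 \<le> g' \<kappa>' e" "g' \<kappa>' e \<le> f' \<kappa>' e"
      using feas g ratio by (auto simp: feasible_def g'_def f'_def)
  next
    fix e assume e: "e \<in> E"
    have "(\<Sum>\<kappa>\<in>K. g' \<kappa> e) \<le> (\<Sum>\<kappa>\<in>K. g \<kappa> e)" using g'le[OF e] by (rule sum_mono)
    also have "\<dots> \<le> k * real (L e)" using feas e by (simp add: feasible_def)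
    finally show "(\<Sum>\<kappa>\<in>K. g' \<kappa> e) \<le> k * real (L e)" .
  qed (use feas in \<open>simp add: feasible_def\<close>)
  moreover have tot_g: "total g' = total g - y"
    unfolding g'_def total_fun_upd[OF \<kappa>] by (simp add: y_def sum_subtractf right_diff_distrib sum_negf)
  have priv: "priv f' g' = priv f g - x"
  proof -
    have "total f' = total f - (\<Sum>e\<in>E. h e)"
      unfolding f'_def total_fun_upd[OF \<kappa>] by (simp add: sum_negf)
    then show ?thesis
      using tot_g \<open>x + y = (\<Sum>e\<in>E. h e)\<close> by (simp add: priv_def)
  qed
  have T: "time f' g' = time f g - \<tau>\<^sub>0 * x - \<tau>\<^sub>1 * y"
    by (simp add: time_def priv tot_g algebra_simps)
  have H: "energy f' g' L = energy f g L - \<eta>\<^sub>0 * x"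
    by (simp add: energy_def priv algebra_simps)
  have "0 \<le> \<tau>\<^sub>0 * x" "0 \<le> \<tau>\<^sub>1 * y" using xy times by auto
  then have "time f' g' \<le> a" using T in_time by linarith
  ultimately have "energy f g L \<le> energy f' g' L"
    by (intro min_energy)
  then have "x = 0"
    using H \<eta>\<^sub>0_pos xy by (simp add: mult_le_0_iff)
  then have "0 < y" "energy f' g' L = energy f g L" using pos H by auto
  then have "time f g \<le> time f' g'" using \<open>feasible f' g' L\<close> by (intro min_time)
  then show False
    using T \<open>x = 0\<close> \<open>0 < y\<close> slower times by (simp add: mult_le_0_iff)
qed

text \<open>An edge with more flow than this closes with a path of positive flow to a cycle, and a
  small multiple of that cycle is a removable circulation. So optimal flows obey the same edge bound
  as simple paths, although they may split.\<close>

lemma flow_le: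
  assumes \<kappa>: "\<kappa> \<in> K" and e: "(u, v) \<in> E"
  shows "f \<kappa> (u, v) \<le> of_bool (v \<noteq> fst \<kappa>)"
proof (rule ccontr)
  assume "\<not> ?thesis"
  then have gt: "f \<kappa> (u, v) > of_bool (v \<noteq> fst \<kappa>)" by simp
  have flow: "unit_flow V E (fst \<kappa>, snd \<kappa>) (f \<kappa>)" using feas \<kappa> by (simp add: feasible_def)
  let ?R = "{e \<in> E. 0 < f \<kappa> e}"
  have "(v, u) \<in> ?R\<^sup>*"
    using unit_flow_excess_cycle[OF finite_V finite_E edges flow _ _ e gt] K_D[OF \<kappa>] by simp
  from path_flow[OF this, of E] finite_E obtain p where
    p: "\<forall>e. 0 \<le> p e" "\<forall>e. e \<notin> ?R \<longrightarrow> p e = 0"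
      "\<forall>w. net E p w = of_bool (w = u) - of_bool (w = v)" by auto
  define w where "w e' = p e' + of_bool (e' = (u, v))" for e'
  have w0: "0 \<le> w e'" for e' using p(1)[rule_format, of e'] by (simp add: w_def)
  have fpos: "0 < f \<kappa> (u, v)" using gt by (simp add: order.strict_trans1[OF _ gt])
  have "\<forall>e'\<in>E. 0 \<le> w e' \<and> 0 \<le> f \<kappa> e' \<and> (0 < w e' \<longrightarrow> 0 < f \<kappa> e')"
  proof (intro ballI conjI impI)
    fix e' assume e': "e' \<in> E"
    show "0 \<le> f \<kappa> e'" using feas \<kappa> e' by (rule feasible_nonneg)
    assume "0 < w e'"
    then have "e' = (u, v) \<or> p e' \<noteq> 0" by (auto simp: w_def)
    then show "0 < f \<kappa> e'" using fpos p(2) by blast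
  qed (rule w0)
  from exists_scale_below[OF finite_E this] obtain \<epsilon> where
    \<epsilon>: "\<epsilon> > 0" "\<forall>e\<in>E. \<epsilon> * w e \<le> f \<kappa> e" by blast
  have "net E w v' = 0" for v'
    unfolding w_def using p(3) net_edge[OF finite_E e] by (simp add: net_add)
  then show False
    using no_circulation[OF \<kappa>, of "\<lambda>e. \<epsilon> * w e" "(u, v)"] \<epsilon> w0 e p(1)
    by (simp add: net_scale) (simp add: w_def add_nonneg_pos)
qed

lemma sum_flow_le: "e \<in> E \<Longrightarrow> (\<Sum>\<kappa>\<in>K. f \<kappa> e) \<le> k"
  using flow_le[of _ "fst e" "snd e"] edges
  by (intro sum_le_capacity[of _ "snd e"]) auto

text \<open>The whole flow on an edge fits into one vehicle, so vehicles beyond the first can be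
  removed. The exchange arguments use this 0-1 layout, for which the budget is no obstacle.\<close>

definition L1 :: "'v \<times> 'v \<Rightarrow> nat" where
  "L1 e = (if L e = 0 then 0 else 1)"

lemma g_bounds: "\<kappa> \<in> K \<Longrightarrow> e \<in> E \<Longrightarrow> 0 \<le> g \<kappa> e \<and> g \<kappa> e \<le> f \<kappa> e"
  using feas by (simp add: feasible_def)

lemma sum_public_le: "e \<in> E \<Longrightarrow> (\<Sum>\<kappa>\<in>K. g \<kappa> e) \<le> k * real (L1 e)"
proof (cases "L e = 0")
  case True
  then show "e \<in> E \<Longrightarrow> ?thesis" using feas by (auto simp: feasible_def L1_def)
next
  case False
  assume e: "e \<in> E"
  have "(\<Sum>\<kappa>\<in>K. g \<kappa> e) \<le> (\<Sum>\<kappa>\<in>K. f \<kappa> e)"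
    using g_bounds e by (intro sum_mono) auto
  then show ?thesis using sum_flow_le[OF e] False by (simp add: L1_def)
qed

lemma feasible_L1: "feasible f g L1"
  unfolding feasible_def using feas sum_public_le budget_ok[of L1]
  by (auto simp: feasible_def L1_def)

text \<open>Removing vehicles cannot raise the energy, and minimality forbids lowering it. For
  \<open>\<eta>\<^sub>1 = 0\<close> the layouts may still differ, so only the energies are
  identified.\<close>

lemma energy_L1: "energy f g L1 = energy f g L"
proof (rule antisym)
  have "(\<Sum>e\<in>E. L1 e) \<le> (\<Sum>e\<in>E. L e)" by (intro sum_mono) (auto simp: L1_def)
  then show "energy f g L1 \<le> energy f g L"
    unfolding energy_def using energies by (intro add_left_mono mult_left_mono) (auto simp del: of_nat_sum)
qed (rule min_energy[OF feasible_L1 in_time])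

lemma no_public_flow:
  assumes "e \<in> E" "L e = 0" "\<kappa> \<in> K"
  shows "g \<kappa> e = 0"
proof (rule antisym)
  have "g \<kappa> e \<le> (\<Sum>\<kappa>\<in>K. g \<kappa> e)"
    using finite_K assms g_bounds by (intro member_le_sum) auto
  then show "g \<kappa> e \<le> 0" using sum_public_le[OF assms(1)] assms(2) by (simp add: L1_def)
qed (use g_bounds assms in blast)

text \<open>Within the slack of the time bound, private flow on an edge can be moved to a vehicle that is
  already there or newly added.\<close>

lemma private_flow_le:
  assumes slack: "time f g + (\<tau>\<^sub>1 - \<tau>\<^sub>0) * (\<eta>\<^sub>1 / \<eta>\<^sub>0) < a" and e\<^sub>1: "e\<^sub>1 \<in> E"
  shows "\<eta>\<^sub>0 * (\<Sum>\<kappa>\<in>K. f \<kappa> e\<^sub>1 - g \<kappa> e\<^sub>1) \<le> \<eta>\<^sub>1 * (1 - real (L1 e\<^sub>1))"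
proof (rule ccontr)
  define p where "p = (\<Sum>\<kappa>\<in>K. f \<kappa> e\<^sub>1 - g \<kappa> e\<^sub>1)"
  \<comment> \<open>The energy of the vehicle that has to be added; it is 0 if the edge already has
    one.\<close>
  define b where "b = \<eta>\<^sub>1 * (1 - real (L1 e\<^sub>1))"
  assume "\<not> ?thesis"
  then have pb: "b < \<eta>\<^sub>0 * p" by (simp add: p_def b_def)
  have b: "0 \<le> b" "b \<le> \<eta>\<^sub>1" using energies by (auto simp: b_def L1_def)
  have p0: "0 < p" using pb b \<eta>\<^sub>0_pos by (metis order_le_less_trans zero_less_mult_pos)
  \<comment> \<open>The amount to be moved: all private flow on the edge, or as much as the slack
    admits, each unit taking \<open>\<tau>\<^sub>1 - \<tau>\<^sub>0\<close> more time.\<close>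
  define \<delta> where "\<delta> = min p ((a - time f g) / (\<tau>\<^sub>1 - \<tau>\<^sub>0))"
  define \<theta> where "\<theta> = \<delta> / p"
  have "\<eta>\<^sub>1 / \<eta>\<^sub>0 < (a - time f g) / (\<tau>\<^sub>1 - \<tau>\<^sub>0)"
    using slack slower by (simp add: pos_less_divide_eq algebra_simps)
  moreover have "b / \<eta>\<^sub>0 < p" using pb \<eta>\<^sub>0_pos by (simp add: pos_divide_less_eq mult.commute)
  moreover have "b / \<eta>\<^sub>0 \<le> \<eta>\<^sub>1 / \<eta>\<^sub>0" using b(2) \<eta>\<^sub>0_pos by (simp add: divide_right_mono)
  \<comment> \<open>Both entries of the minimum exceed \<open>b / \<eta>\<^sub>0\<close>: the flow
    by assumption, the slack because it admits more than
    \<open>\<eta>\<^sub>1 / \<eta>\<^sub>0\<close> units. So the saving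
    \<open>\<eta>\<^sub>0 * \<delta>\<close> exceeds the price \<open>b\<close>.\<close>
  ultimately have "b / \<eta>\<^sub>0 < \<delta>" by (simp add: \<delta>_def)
  then have b\<delta>: "b < \<eta>\<^sub>0 * \<delta>" using \<eta>\<^sub>0_pos by (simp add: pos_divide_less_eq mult.commute)
  have \<delta>: "0 < \<delta>" "\<delta> \<le> p" "(\<tau>\<^sub>1 - \<tau>\<^sub>0) * \<delta> \<le> a - time f g"
  proof -
    show "0 < \<delta>" using b\<delta> b(1) \<eta>\<^sub>0_pos by (metis order_le_less_trans zero_less_mult_pos)
    show "\<delta> \<le> p" by (simp add: \<delta>_def)
    have "\<delta> \<le> (a - time f g) / (\<tau>\<^sub>1 - \<tau>\<^sub>0)" by (simp add: \<delta>_def)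
    then show "(\<tau>\<^sub>1 - \<tau>\<^sub>0) * \<delta> \<le> a - time f g"
      using slower by (simp add: pos_le_divide_eq mult.commute)
  qed
  have \<theta>: "0 \<le> \<theta>" "\<theta> \<le> 1" "\<theta> * p = \<delta>" using \<delta> p0 by (auto simp: \<theta>_def)
  define g' where "g' \<kappa> e = g \<kappa> e + of_bool (e = e\<^sub>1) * (\<theta> * (f \<kappa> e - g \<kappa> e))" for \<kappa> e
  define L' where "L' = L1(e\<^sub>1 := 1)"
  have feas': "feasible f g' L'"
    unfolding feasible_def
  proof (intro conjI ballI)
    fix \<kappa> e assume "\<kappa> \<in> K" "e \<in> E"
    note bounds = g_bounds[OF this]
    then show "0 \<le> g' \<kappa> e" using \<theta> by (simp add: g'_def)
    have "\<theta> * (f \<kappa> e - g \<kappa> e) \<le> 1 * (f \<kappa> e - g \<kappa> e)"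
      using \<theta> bounds by (intro mult_right_mono) auto
    then show "g' \<kappa> e \<le> f \<kappa> e" using bounds by (cases "e = e\<^sub>1") (simp_all add: g'_def)
  next
    fix e assume e: "e \<in> E"
    show "(\<Sum>\<kappa>\<in>K. g' \<kappa> e) \<le> k * real (L' e)"
    proof (cases "e = e\<^sub>1")
      case True
      have "g' \<kappa> e \<le> f \<kappa> e" if "\<kappa> \<in> K" for \<kappa>
      proof -
        have "\<theta> * (f \<kappa> e - g \<kappa> e) \<le> 1 * (f \<kappa> e - g \<kappa> e)"
          using \<theta> g_bounds[OF that e] by (intro mult_right_mono) auto
        then show ?thesis using g_bounds[OF that e] by (cases "e = e\<^sub>1") (simp_all add: g'_def)
      qed
      then have "(\<Sum>\<kappa>\<in>K. g' \<kappa> e) \<le> (\<Sum>\<kappa>\<in>K. f \<kappa> e)" by (rule sum_mono)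
      then show ?thesis using sum_flow_le[OF e] True by (simp add: L'_def)
    next
      case False
      then show ?thesis using sum_public_le[OF e] by (simp add: g'_def L'_def)
    qed
  next
    show "c * real (\<Sum>e\<in>E. L' e) \<le> B"
      by (rule budget_ok) (auto simp: L'_def L1_def)
  qed (use feas in \<open>simp add: feasible_def\<close>)
  have tot: "total g' = total g + \<delta>"
  proof -
    have "(\<Sum>\<kappa>\<in>K. \<theta> * (f \<kappa> e\<^sub>1 - g \<kappa> e\<^sub>1)) = \<delta>"
      using \<theta>(3) by (simp add: p_def sum_distrib_left)
    moreover have "(\<Sum>\<kappa>\<in>K. g' \<kappa> e) = (\<Sum>\<kappa>\<in>K. g \<kappa> e) +
        (if e = e\<^sub>1 then \<Sum>\<kappa>\<in>K. \<theta> * (f \<kappa> e\<^sub>1 - g \<kappa> e\<^sub>1) else 0)" for e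
      by (auto simp: g'_def sum.distrib)
    ultimately show ?thesis
      using e\<^sub>1 finite_E by (simp add: total_swap sum.distrib)
  qed
  then have T: "time f g' = time f g + (\<tau>\<^sub>1 - \<tau>\<^sub>0) * \<delta>"
    by (simp add: time_def priv_def algebra_simps)
  have vehicles: "real (\<Sum>e\<in>E. L' e) = real (\<Sum>e\<in>E. L1 e) + (1 - real (L1 e\<^sub>1))"
    using finite_E e\<^sub>1 by (simp add: L'_def sum.remove[of E e\<^sub>1])
  have "energy f g' L' = energy f g L1 - \<eta>\<^sub>0 * \<delta> + b"
    unfolding energy_def vehicles by (simp add: priv_def tot b_def algebra_simps del: of_nat_sum)
  moreover have "energy f g L \<le> energy f g' L'"
    using T \<delta>(3) by (intro min_energy feas') auto
  ultimately show False using b\<delta> energy_L1 by simp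
qed

text \<open>A vertex set that no vehicle leaves would be left by private flow only, less than one
  unit per edge since \<open>\<eta>\<^sub>1 / \<eta>\<^sub>0 < 1\<close>. But every ordered pair
  across the cut sends one unit over it, and there are at least as many such pairs as edges.\<close>

lemma layout_strongly_connected:
  assumes slack: "time f g + (\<tau>\<^sub>1 - \<tau>\<^sub>0) * (\<eta>\<^sub>1 / \<eta>\<^sub>0) < a" and xy: "x \<in> V" "y \<in> V"
  shows "(x, y) \<in> {e \<in> E. L e \<noteq> 0}\<^sup>*"
proof (rule ccontr)
  define S where "S = {e \<in> E. L e \<noteq> 0}"
  define A where "A = S\<^sup>* `` {x}"
  assume "(x, y) \<notin> {e \<in> E. L e \<noteq> 0}\<^sup>*"
  then have A: "x \<in> A" "y \<notin> A" by (auto simp: A_def S_def)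
  have "A \<subseteq> V"
  proof
    fix z assume "z \<in> A"
    then have "(x, z) \<in> S\<^sup>*" by (simp add: A_def)
    then show "z \<in> V" using xy(1) edges by induction (auto simp: S_def)
  qed
  define X where "X = A \<times> (V - A)"
  define out where "out = {e \<in> E. fst e \<in> A \<and> snd e \<notin> A}"
  have "X \<subseteq> K" using \<open>A \<subseteq> V\<close> by (auto simp: X_def mem_K)
  then have X: "X \<subseteq> K" "finite X" "(x, y) \<in> X"
    using A xy finite_K by (auto simp: X_def intro: finite_subset)
  have out: "out \<subseteq> X" "finite out" "out \<subseteq> E"
    using edges finite_E by (auto simp: out_def X_def)
  have L0: "L e = 0" if "e \<in> out" for e
  proof (rule ccontr)
    assume "L e \<noteq> 0"
    then have "(fst e, snd e) \<in> S" "(x, fst e) \<in> S\<^sup>*" using that by (auto simp: S_def out_def A_def)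
    then have "(x, snd e) \<in> S\<^sup>*" by (rule rtrancl_into_rtrancl[rotated])
    then show False using that by (auto simp: out_def A_def)
  qed
  have "real (card X) = (\<Sum>\<kappa>\<in>X. 1)" by simp
  also have "\<dots> \<le> (\<Sum>\<kappa>\<in>X. \<Sum>e\<in>out. f \<kappa> e)"
  proof (rule sum_mono)
    fix \<kappa> assume "\<kappa> \<in> X"
    then have \<kappa>: "\<kappa> \<in> K" "fst \<kappa> \<in> A" "snd \<kappa> \<notin> A" using X by (auto simp: X_def)
    then have flow: "unit_flow V E (fst \<kappa>, snd \<kappa>) (f \<kappa>)" using feas by (simp add: feasible_def)
    have "0 \<le> (\<Sum>e | e \<in> E \<and> fst e \<notin> A \<and> snd e \<in> A. f \<kappa> e)"
      using feas \<kappa>(1) by (intro sum_nonneg) (auto simp: feasible_nonneg)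
    then show "1 \<le> (\<Sum>e\<in>out. f \<kappa> e)"
      using unit_flow_cut[OF finite_V finite_E edges flow, of A] K_D[OF \<kappa>(1)] \<kappa>(2,3)
      by (simp add: out_def)
  qed
  also have "\<dots> \<le> (\<Sum>\<kappa>\<in>K. \<Sum>e\<in>out. f \<kappa> e)"
    using X finite_K feas out by (intro sum_mono2 sum_nonneg) (auto simp: feasible_nonneg)
  also have "\<dots> = (\<Sum>e\<in>out. \<Sum>\<kappa>\<in>K. f \<kappa> e)" by (rule sum.swap)
  also have "\<dots> \<le> (\<Sum>e\<in>out. \<eta>\<^sub>1 / \<eta>\<^sub>0)"
  proof (rule sum_mono)
    fix e assume e: "e \<in> out"
    then have "\<eta>\<^sub>0 * (\<Sum>\<kappa>\<in>K. f \<kappa> e - g \<kappa> e) \<le> \<eta>\<^sub>1"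
      using private_flow_le[OF slack, of e] L0 out by (auto simp: L1_def)
    moreover have "(\<Sum>\<kappa>\<in>K. f \<kappa> e - g \<kappa> e) = (\<Sum>\<kappa>\<in>K. f \<kappa> e)"
      using no_public_flow[of e] L0 out e by (intro sum.cong) auto
    ultimately show "(\<Sum>\<kappa>\<in>K. f \<kappa> e) \<le> \<eta>\<^sub>1 / \<eta>\<^sub>0"
      using \<eta>\<^sub>0_pos by (simp add: pos_le_divide_eq mult.commute)
  qed
  also have "\<dots> = real (card out) * (\<eta>\<^sub>1 / \<eta>\<^sub>0)" by simp
  also have "\<dots> \<le> real (card X) * (\<eta>\<^sub>1 / \<eta>\<^sub>0)"
    using card_mono[OF X(2) out(1)] energies by (intro mult_right_mono) auto
  also have "\<dots> < real (card X) * 1"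
    using X energies by (intro mult_strict_left_mono) (auto simp: card_gt_0_iff)
  finally show False by simp
qed

text \<open>Were some flow private, moving a small fraction of all flows onto public paths would save energy
  without adding vehicles.\<close>

lemma no_private_flow:
  assumes slack: "time f g + (\<tau>\<^sub>1 - \<tau>\<^sub>0) * (\<eta>\<^sub>1 / \<eta>\<^sub>0) < a"
  shows "priv f g = 0"
proof (rule ccontr)
  assume "priv f g \<noteq> 0"
  then have priv: "0 < priv f g" using priv_nonneg[OF feas] by simp
  define S where "S = {e \<in> E. L e \<noteq> 0}"
  have S: "S \<subseteq> E" by (auto simp: S_def)
  \<comment> \<open>Simple paths along edges with vehicles; as none enters its own source, a single
    vehicle per edge carries all of them together.\<close>
  have "\<forall>\<kappa>\<in>K. \<exists>p. (\<forall>e. 0 \<le> p e \<and> p e \<le> of_bool (snd e \<noteq> fst \<kappa>)) \<and> (\<forall>e. e \<notin> S \<longrightarrow> p e = 0) \<and>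
      (\<forall>v. net E p v = of_bool (v = snd \<kappa>) - of_bool (v = fst \<kappa>))"
  proof
    fix \<kappa> assume "\<kappa> \<in> K"
    then have "(fst \<kappa>, snd \<kappa>) \<in> S\<^sup>*"
      unfolding S_def using layout_strongly_connected[OF slack] K_D by blast
    from simple_path_flow[OF this S finite_E]
    show "\<exists>p. (\<forall>e. 0 \<le> p e \<and> p e \<le> of_bool (snd e \<noteq> fst \<kappa>)) \<and> (\<forall>e. e \<notin> S \<longrightarrow> p e = 0) \<and>
      (\<forall>v. net E p v = of_bool (v = snd \<kappa>) - of_bool (v = fst \<kappa>))" .
  qed
  then obtain p where p: "\<And>\<kappa> e. \<kappa> \<in> K \<Longrightarrow> 0 \<le> p \<kappa> e \<and> p \<kappa> e \<le> of_bool (snd e \<noteq> fst \<kappa>)"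
    "\<And>\<kappa> e. \<kappa> \<in> K \<Longrightarrow> e \<notin> S \<Longrightarrow> p \<kappa> e = 0"
    "\<And>\<kappa> v. \<kappa> \<in> K \<Longrightarrow> net E (p \<kappa>) v = of_bool (v = snd \<kappa>) - of_bool (v = fst \<kappa>)"
    by metis
  have "0 < a - time f g"
  proof -
    have "0 \<le> (\<tau>\<^sub>1 - \<tau>\<^sub>0) * (\<eta>\<^sub>1 / \<eta>\<^sub>0)"
      using slower energies \<eta>\<^sub>0_pos by (intro mult_nonneg_nonneg) auto
    then show ?thesis using slack by linarith
  qed
  \<comment> \<open>The absolute value and the summand 1 keep the denominator positive; moving the
    fraction \<open>\<epsilon>\<close> then adds at most the slack to the time.\<close>
  define \<epsilon> where "\<epsilon> = min 1 ((a - time f g) / (\<tau>\<^sub>1 * \<bar>total p\<bar> + 1))"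
  have den: "0 < \<tau>\<^sub>1 * \<bar>total p\<bar> + 1" using times by (simp add: add_nonneg_pos)
  have \<epsilon>: "0 < \<epsilon>" "\<epsilon> \<le> 1"
    using \<open>0 < a - time f g\<close> den by (auto simp: \<epsilon>_def)
  have "\<epsilon> * (\<tau>\<^sub>1 * \<bar>total p\<bar> + 1) \<le> (a - time f g) / (\<tau>\<^sub>1 * \<bar>total p\<bar> + 1) * (\<tau>\<^sub>1 * \<bar>total p\<bar> + 1)"
    using den by (intro mult_right_mono) (auto simp: \<epsilon>_def)
  then have \<epsilon>_time: "\<epsilon> * (\<tau>\<^sub>1 * \<bar>total p\<bar> + 1) \<le> a - time f g"
    using den by simp
  \<comment> \<open>A convex combination with the entirely public path flows \<open>p\<close>. On
    edges with vehicles both public loads are at most \<open>k\<close>, elsewhere both vanish, so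
    \<open>L1\<close> still suffices while the private flow shrinks by the factor
    \<open>1 - \<epsilon>\<close>.\<close>
  define f' where "f' \<kappa> e = (1 - \<epsilon>) * f \<kappa> e + \<epsilon> * p \<kappa> e" for \<kappa> e
  define g' where "g' \<kappa> e = (1 - \<epsilon>) * g \<kappa> e + \<epsilon> * p \<kappa> e" for \<kappa> e
  have feas': "feasible f' g' L1"
    unfolding feasible_def
  proof (intro conjI ballI)
    fix \<kappa> assume \<kappa>: "\<kappa> \<in> K"
    then have "unit_flow V E \<kappa> (f \<kappa>)" using feas by (simp add: feasible_def)
    moreover have "(1 - \<epsilon>) * x + \<epsilon> * x = x" for x :: real by (simp add: algebra_simps)
    moreover have "f' \<kappa> = (\<lambda>e. (1 - \<epsilon>) * f \<kappa> e + \<epsilon> * p \<kappa> e)" by (simp add: f'_def fun_eq_iff)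
    ultimately show "unit_flow V E \<kappa> (f' \<kappa>)"
      using p(1,3)[OF \<kappa>] \<epsilon> by (simp add: unit_flow_def net_add net_scale del: of_bool_eq_iff)
  next
    fix \<kappa> e assume \<kappa>e: "\<kappa> \<in> K" "e \<in> E"
    show "0 \<le> g' \<kappa> e" using p(1)[OF \<kappa>e(1)] g_bounds[OF \<kappa>e] \<epsilon> by (simp add: g'_def)
    show "g' \<kappa> e \<le> f' \<kappa> e"
      using g_bounds[OF \<kappa>e] \<epsilon> by (simp add: g'_def f'_def mult_left_mono)
  next
    fix e assume e: "e \<in> E"
    show "(\<Sum>\<kappa>\<in>K. g' \<kappa> e) \<le> k * real (L1 e)"
    proof (cases "L e = 0")
      case True
      then have "g' \<kappa> e = 0" if "\<kappa> \<in> K" for \<kappa>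
        using no_public_flow[OF e True that] p(2)[OF that, of e] by (simp add: g'_def S_def)
      then show ?thesis using True by (simp add: L1_def)
    next
      case False
      have "(\<Sum>\<kappa>\<in>K. p \<kappa> e) \<le> k"
        using p(1) e edges by (intro sum_le_capacity[of _ "snd e"]) auto
      then have "\<epsilon> * (\<Sum>\<kappa>\<in>K. p \<kappa> e) \<le> \<epsilon> * k"
        using \<epsilon> by (intro mult_left_mono) auto
      moreover have "(1 - \<epsilon>) * (\<Sum>\<kappa>\<in>K. g \<kappa> e) \<le> (1 - \<epsilon>) * k"
        using \<epsilon> sum_public_le[OF e] False by (intro mult_left_mono) (auto simp: L1_def)
      moreover have "(\<Sum>\<kappa>\<in>K. g' \<kappa> e) = (1 - \<epsilon>) * (\<Sum>\<kappa>\<in>K. g \<kappa> e) + \<epsilon> * (\<Sum>\<kappa>\<in>K. p \<kappa> e)"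
        by (simp add: g'_def sum.distrib sum_distrib_left)
      ultimately show ?thesis
        using False by (simp add: L1_def algebra_simps)
    qed
  qed (rule budget_ok, simp add: L1_def)
  have tot: "total f' = (1 - \<epsilon>) * total f + \<epsilon> * total p" "total g' = (1 - \<epsilon>) * total g + \<epsilon> * total p"
    by (simp_all add: total_def f'_def g'_def sum.distrib sum_distrib_left)
  then have priv': "priv f' g' = (1 - \<epsilon>) * priv f g" by (simp add: priv_def algebra_simps)
  have "time f' g' = (1 - \<epsilon>) * time f g + \<epsilon> * (\<tau>\<^sub>1 * total p)"
    by (simp add: time_def priv' tot algebra_simps)
  also have "\<dots> \<le> time f g + \<epsilon> * (\<tau>\<^sub>1 * \<bar>total p\<bar> + 1)"
  proof (rule add_mono)
    show "(1 - \<epsilon>) * time f g \<le> time f g"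
      using \<epsilon> time_nonneg[OF feas] by (intro mult_left_le_one_le) auto
    have "\<tau>\<^sub>1 * total p \<le> \<tau>\<^sub>1 * \<bar>total p\<bar>" using times by (intro mult_left_mono) auto
    then show "\<epsilon> * (\<tau>\<^sub>1 * total p) \<le> \<epsilon> * (\<tau>\<^sub>1 * \<bar>total p\<bar> + 1)"
      using \<epsilon> by (intro mult_left_mono) auto
  qed
  also have "\<dots> \<le> a" using \<epsilon>_time by simp
  finally have "energy f g L \<le> energy f' g' L1" by (intro min_energy feas')
  then have "\<eta>\<^sub>0 * priv f g \<le> \<eta>\<^sub>0 * ((1 - \<epsilon>) * priv f g)"
    unfolding energy_L1[symmetric] by (simp add: energy_def priv')
  then show False
    using \<eta>\<^sub>0_pos priv \<epsilon> by (simp add: algebra_simps zero_less_mult_iff mult_le_0_iff)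
qed

end

section \<open>Comparison of the construction with an optimum\<close>

context unit_demand_network
begin

lemma two_le_real_card: "2 \<le> real (card V)"
  using two_vertices by simp

text \<open>Every vertex accounts for an energy of \<open>\<eta>\<^sub>1\<close> in any solution,
  and the two trees have fewer than two edges per vertex.\<close>

lemma vehicles_le_energy:
  assumes "feasible f g L" "l \<le> 2 * (real (card V) - 1)"
  shows "\<eta>\<^sub>1 * l \<le> 2 * energy f g L"
proof -
  have "\<eta>\<^sub>1 * l \<le> \<eta>\<^sub>1 * (2 * real (card V))"
    using assms(2) energies by (intro mult_left_mono) auto
  then show ?thesis using energy_ge_card[OF assms(1)] by (simp add: mult.commute)
qed

lemma public_time_le:
  assumes "feasible f g L" "W \<le> total f" "U \<le> 2 * W" "\<tau>\<^sub>1 \<le> \<tau>\<^sub>0 \<or> priv f g = 0"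
  shows "\<tau>\<^sub>1 * U \<le> 2 * time f g"
proof -
  have "\<tau>\<^sub>1 * U \<le> \<tau>\<^sub>1 * (2 * total f)"
    using assms(2,3) times by (intro mult_left_mono) auto
  moreover have "\<tau>\<^sub>1 * priv f g \<le> \<tau>\<^sub>0 * priv f g"
    using assms(4) priv_nonneg[OF assms(1)] by (auto intro: mult_right_mono)
  ultimately show ?thesis by (simp add: time_def priv_def algebra_simps)
qed

text \<open>The amount of private flow, in a solution with total flow \<open>U\<close>, that brings the travel time down to
  \<open>2 * (a - (\<tau>\<^sub>1 - \<tau>\<^sub>0) * (\<eta>\<^sub>1 / \<eta>\<^sub>0))\<close>, twice the lower bound on optimal times with private flow.\<close>

definition private_target :: "real \<Rightarrow> real \<Rightarrow> real" where
  "private_target a U = (\<tau>\<^sub>1 * U - 2 * a) / (\<tau>\<^sub>1 - \<tau>\<^sub>0) + 2 * (\<eta>\<^sub>1 / \<eta>\<^sub>0)"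

end

context optimal_split
begin

text \<open>With large slack the optimum is all public and takes at least half the time of
  \<open>U\<close> public units; making some of them private only helps. With small slack its time
  is at least \<open>a - (\<tau>\<^sub>1 - \<tau>\<^sub>0) * (\<eta>\<^sub>1 /
  \<eta>\<^sub>0)\<close>, half of the time for which the target was solved.\<close>

lemma private_target_time:
  assumes "W \<le> total f" "U \<le> 2 * W" "x \<le> U" "private_target a U \<le> x" "0 \<le> x"
  shows "\<tau>\<^sub>0 * x + \<tau>\<^sub>1 * (U - x) \<le> 2 * time f g"
proof (cases "time f g + (\<tau>\<^sub>1 - \<tau>\<^sub>0) * (\<eta>\<^sub>1 / \<eta>\<^sub>0) < a")
  case True
  from public_time_le[OF feas assms(1,2)] no_private_flow[OF True]
  have "\<tau>\<^sub>1 * U \<le> 2 * time f g" by blast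
  moreover have "\<tau>\<^sub>0 * x \<le> \<tau>\<^sub>1 * x" using slower assms(5) by (intro mult_right_mono) auto
  ultimately show ?thesis by (simp add: algebra_simps)
next
  case False
  have "(\<tau>\<^sub>1 - \<tau>\<^sub>0) * private_target a U \<le> (\<tau>\<^sub>1 - \<tau>\<^sub>0) * x"
    using assms(4) slower by (intro mult_left_mono) auto
  moreover have "(\<tau>\<^sub>1 - \<tau>\<^sub>0) * private_target a U = \<tau>\<^sub>1 * U - 2 * a + 2 * ((\<tau>\<^sub>1 - \<tau>\<^sub>0) * (\<eta>\<^sub>1 / \<eta>\<^sub>0))"
    unfolding private_target_def using slower by (simp add: distrib_left)
  moreover have "\<tau>\<^sub>0 * x + \<tau>\<^sub>1 * (U - x) = \<tau>\<^sub>1 * U - (\<tau>\<^sub>1 - \<tau>\<^sub>0) * x"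
    by (simp add: algebra_simps)
  ultimately show ?thesis using False by linarith
qed

lemma private_time_le:
  assumes "W \<le> total f" "U \<le> 2 * W"
  shows "\<tau>\<^sub>0 * U \<le> 2 * time f g"
proof -
  have "\<tau>\<^sub>0 * U \<le> \<tau>\<^sub>0 * (2 * total f)"
    using assms times by (intro mult_left_mono) auto
  moreover have "\<tau>\<^sub>0 * total g \<le> \<tau>\<^sub>1 * total g"
    using slower total_nonneg[OF feas] by (intro mult_right_mono) auto
  ultimately show ?thesis by (simp add: time_def priv_def algebra_simps)
qed

text \<open>The time bound forces private flow on the optimum as well: \<open>(\<tau>\<^sub>1 -
  \<tau>\<^sub>0) * priv f g \<ge> \<tau>\<^sub>1 * total f - a\<close>. This is doubled and
  compared with the bound on \<open>U\<close>; the saved length \<open>2 * (n - 1)\<close> survives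
  as saved private flow.\<close>

lemma private_target_le:
  assumes "W \<le> total f" "U \<le> 2 * W - 2 * (real (card V) - 1)"
  shows "private_target a U \<le> 2 * priv f g + 2 * (\<eta>\<^sub>1 / \<eta>\<^sub>0) - 2 * (real (card V) - 1)"
proof -
  have "\<tau>\<^sub>1 * U \<le> \<tau>\<^sub>1 * (2 * total f - 2 * (real (card V) - 1))"
    using assms times by (intro mult_left_mono) auto
  \<comment> \<open>Since \<open>\<tau>\<^sub>0 \<ge> 0\<close>, the saving may be counted at the
    smaller rate \<open>\<tau>\<^sub>1 - \<tau>\<^sub>0\<close>.\<close>
  also have "\<dots> \<le> 2 * \<tau>\<^sub>1 * total f - 2 * (\<tau>\<^sub>1 - \<tau>\<^sub>0) * (real (card V) - 1)"
    using mult_nonneg_nonneg[OF times(1), of "real (card V) - 1"] two_vertices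
    by (simp add: algebra_simps)
  also have "\<dots> \<le> 2 * (a + (\<tau>\<^sub>1 - \<tau>\<^sub>0) * priv f g) - 2 * (\<tau>\<^sub>1 - \<tau>\<^sub>0) * (real (card V) - 1)"
    using in_time by (simp add: time_def priv_def algebra_simps)
  finally have "\<tau>\<^sub>1 * U - 2 * a \<le> (\<tau>\<^sub>1 - \<tau>\<^sub>0) * (2 * priv f g - 2 * (real (card V) - 1))"
    by (simp add: algebra_simps)
  then have "(\<tau>\<^sub>1 * U - 2 * a) / (\<tau>\<^sub>1 - \<tau>\<^sub>0) \<le> 2 * priv f g - 2 * (real (card V) - 1)"
    using slower by (simp add: pos_divide_le_eq mult.commute)
  then show ?thesis by (simp add: private_target_def)
qed

lemma ratio_less_1: "\<eta>\<^sub>1 / \<eta>\<^sub>0 < 1"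
  using energies \<eta>\<^sub>0_pos by simp

text \<open>The excess \<open>2 * (\<eta>\<^sub>1 / \<eta>\<^sub>0) < 2\<close> of the target is
  covered by the saving \<open>2 * (n - 1) \<ge> 2\<close>, and all-private travel has no vehicles
  to pay for.\<close>

lemma private_energy_le:
  assumes "W \<le> total f" "U \<le> 2 * W - 2 * (real (card V) - 1)" "U \<le> private_target a U"
  shows "\<eta>\<^sub>0 * U \<le> 2 * energy f g L"
proof -
  have "2 * (\<eta>\<^sub>1 / \<eta>\<^sub>0) - 2 * (real (card V) - 1) \<le> 0"
    using ratio_less_1 two_le_real_card by argo
  then have "U \<le> 2 * priv f g"
    using private_target_le[OF assms(1,2)] assms(3) by argo
  then have "\<eta>\<^sub>0 * U \<le> \<eta>\<^sub>0 * (2 * priv f g)" using \<eta>\<^sub>0_pos by (intro mult_left_mono) auto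
  moreover have "0 \<le> \<eta>\<^sub>1 * real (\<Sum>e\<in>E. L e)"
    using energies by (intro mult_nonneg_nonneg) (auto simp del: of_nat_sum)
  ultimately show ?thesis by (simp add: energy_def)
qed

text \<open>If the target is positive, the saved \<open>2 * (n - 1)\<close> private units, at the
  price \<open>\<eta>\<^sub>0\<close>, pay for the vehicles on the trees, at the price
  \<open>\<eta>\<^sub>1\<close>. The excess in the target costs \<open>2 * \<eta>\<^sub>1\<close>,
  twice the price of one vehicle of the optimum.\<close>

lemma mixed_energy_le:
  assumes "W \<le> total f" "U \<le> 2 * W - 2 * (real (card V) - 1)" "private_target a U < U"
    and l: "l \<le> 2 * (real (card V) - 1)"
  shows "\<eta>\<^sub>0 * max 0 (private_target a U) + \<eta>\<^sub>1 * l \<le> 2 * energy f g L"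
proof (cases "private_target a U \<le> 0")
  case True
  then show ?thesis using vehicles_le_energy[OF feas l] by (simp add: max_def)
next
  case False
  define n1 where "n1 = real (card V) - 1"
  have n1: "1 \<le> n1" using two_vertices by (simp add: n1_def)
  have l': "\<eta>\<^sub>1 * l \<le> \<eta>\<^sub>1 * (2 * n1)"
    using l energies by (intro mult_left_mono) (auto simp: n1_def)
  have n1': "\<eta>\<^sub>1 * n1 \<le> \<eta>\<^sub>0 * n1" using energies n1 by (intro mult_right_mono) auto
  show ?thesis
  proof (cases "(\<Sum>e\<in>E. L e) = 0")
    case True
    have "priv f g = total f"
    proof -
      have "L e = 0" if "e \<in> E" for e using True finite_E that by simp
      then have "total g = 0" unfolding total_def using no_public_flow by simp
      then show ?thesis by (simp add: priv_def)
    qed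
    \<comment> \<open>With no vehicle to pay for the excess, \<open>private_target a U < U\<close>
      takes over: all flow of the optimum is private, so \<open>U\<close> is at most
      \<open>2 * priv f g - 2 * n1\<close>.\<close>
    then have "private_target a U \<le> 2 * priv f g - 2 * n1"
      using assms(1-3) by (simp add: n1_def)
    then have "\<eta>\<^sub>0 * private_target a U \<le> \<eta>\<^sub>0 * (2 * priv f g - 2 * n1)"
      using \<eta>\<^sub>0_pos by (intro mult_left_mono) auto
    then show ?thesis using False l' n1' True by (simp add: energy_def algebra_simps)
  next
    case vehicle: False
    have "\<eta>\<^sub>0 * private_target a U \<le> \<eta>\<^sub>0 * (2 * priv f g + 2 * (\<eta>\<^sub>1 / \<eta>\<^sub>0) - 2 * n1)"
      using private_target_le[OF assms(1,2)] \<eta>\<^sub>0_pos by (intro mult_left_mono) (auto simp: n1_def)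
    moreover have "\<eta>\<^sub>0 * (2 * priv f g + 2 * (\<eta>\<^sub>1 / \<eta>\<^sub>0) - 2 * n1) = 2 * \<eta>\<^sub>0 * priv f g + 2 * \<eta>\<^sub>1 - 2 * (\<eta>\<^sub>0 * n1)"
      using \<eta>\<^sub>0_pos by (simp add: algebra_simps)
    moreover have "\<eta>\<^sub>1 * 1 \<le> \<eta>\<^sub>1 * real (\<Sum>e\<in>E. L e)"
      using vehicle energies by (intro mult_left_mono) (auto simp del: of_nat_sum sum_eq_0_iff)
    ultimately show ?thesis using False l' n1' by (simp add: energy_def)
  qed
qed

end

section \<open>Instances with unit demands\<close>

locale unit_demand_instance =
  fixes I :: "'v msp"
  assumes inst: "msp_instance I" and modes: "modes I = 1"
    and large_capacity': "capacity I 1 \<ge> (of_nat (card (vertices I)) - 1)\<^sup>2"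
    and cheap': "cost I 1 \<le> 1" "budget I \<ge> of_nat (card (edges I))"
    and unit_weight: "\<forall>e\<in>edges I. weight I e = 1"
    and energies': "energy I 0 > energy I 1"
    and unit_demand: "\<forall>s\<in>vertices I. \<forall>t\<in>vertices I. s \<noteq> t \<longrightarrow> demand I (s, t) = 1"
    and two_vertices': "2 \<le> card (vertices I)"
begin

sublocale unit_demand_network "vertices I" "edges I" "of_rat (travel_time I 0)" "of_rat (travel_time I 1)"
  "of_rat (energy I 0)" "of_rat (energy I 1)" "of_rat (capacity I 1)" "of_rat (cost I 1)" "of_rat (budget I)"
proof
  have graph: "pair_fin_digraph (graph I)" using inst by (simp add: msp_instance_def)
  then show "finite (vertices I)" by (rule pair_fin_digraph.pair_finite_verts)
  show "edges I \<subseteq> vertices I \<times> vertices I"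
    using graph pair_wf_digraph.in_arcsD1 pair_wf_digraph.in_arcsD2
    by (fastforce simp: pair_fin_digraph_def)
  have "(of_rat ((of_nat (card (vertices I)) - 1)\<^sup>2) :: real) \<le> of_rat (capacity I 1)"
    using large_capacity' by (simp only: of_rat_less_eq)
  then show "(real (card (vertices I)) - 1)\<^sup>2 \<le> of_rat (capacity I 1)"
    by (simp add: of_rat_power of_rat_diff)
  have "(of_rat (of_nat (card (edges I))) :: real) \<le> of_rat (budget I)"
    using cheap'(2) by (simp only: of_rat_less_eq)
  then show "real (card (edges I)) \<le> of_rat (budget I)" by simp
qed (use inst modes energies' cheap' two_vertices' in
    \<open>auto simp: msp_instance_def of_rat_less\<close>)

declare One_nat_def [simp del]

lemma commodities_eq: "commodities I = K"
proof -
  have loops: "\<forall>v\<in>vertices I. demand I (v, v) = 0" using inst by (simp add: msp_instance_def)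
  have "(s, t) \<in> commodities I \<longleftrightarrow> (s, t) \<in> K" for s t
    by (cases "s = t") (use loops unit_demand in \<open>auto simp: commodities_def mem_K\<close>)
  then show ?thesis by (intro set_eqI) (metis prod.collapse)
qed

lemma is_flow_iff:
  assumes \<kappa>: "\<kappa> \<in> K"
  shows "is_flow I \<kappa> h \<longleftrightarrow> unit_flow (vertices I) (edges I) \<kappa> h"
proof -
  have "demand I (fst \<kappa>, snd \<kappa>) = 1" using K_D[OF \<kappa>] unit_demand by blast
  then have demand: "demand I \<kappa> = 1" by simp
  have "in_arcs (with_proj (graph I)) v = {e \<in> edges I. snd e = v}"
    "out_arcs (with_proj (graph I)) v = {e \<in> edges I. fst e = v}" for v
    by (simp_all add: in_arcs_def out_arcs_def)
  moreover have "(if v = snd \<kappa> then real (demand I \<kappa>) else if v = fst \<kappa> then - real (demand I \<kappa>) else 0)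
      = of_bool (v = snd \<kappa>) - of_bool (v = fst \<kappa>)" for v
    using K_D[OF \<kappa>] demand by (cases "v = snd \<kappa>") auto
  ultimately show ?thesis
    by (simp only: is_flow_def unit_flow_def net_def)
qed

definition public_part :: "'v msp_solution \<Rightarrow> 'v \<times> 'v \<Rightarrow> 'v \<times> 'v \<Rightarrow> real" where
  "public_part X \<kappa> e = flow X \<kappa> e * modal_split X \<kappa> e 1"

lemma feasible_layout_iff:
  "feasible_layout I L \<longleftrightarrow> of_rat (cost I 1) * real (\<Sum>e\<in>edges I. L e 1) \<le> of_rat (budget I)"
proof -
  have "feasible_layout I L \<longleftrightarrow> cost I 1 * of_nat (\<Sum>e\<in>edges I. L e 1) \<le> budget I"
    using unit_weight modes by (simp add: feasible_layout_def sum_distrib_left)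
  also have "\<dots> \<longleftrightarrow> (of_rat (cost I 1 * of_nat (\<Sum>e\<in>edges I. L e 1)) :: real) \<le> of_rat (budget I)"
    by (simp only: of_rat_less_eq)
  also have "\<dots> \<longleftrightarrow> of_rat (cost I 1) * real (\<Sum>e\<in>edges I. L e 1) \<le> of_rat (budget I)"
    by (simp add: of_rat_mult del: of_nat_sum)
  finally show ?thesis .
qed

lemma feasible_modal_split_iff:
  "feasible_modal_split I X \<longleftrightarrow>
    (\<forall>\<kappa>\<in>K. \<forall>e\<in>edges I. 0 \<le> modal_split X \<kappa> e 0 \<and> 0 \<le> modal_split X \<kappa> e 1 \<and>
      modal_split X \<kappa> e 0 + modal_split X \<kappa> e 1 = 1) \<and>
    (\<forall>e\<in>edges I. (\<Sum>\<kappa>\<in>K. public_part X \<kappa> e) \<le> of_rat (capacity I 1) * real (layout X e 1))"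
proof -
  have "(\<forall>i\<le>1. m i \<in> {0..1}) \<and> (\<Sum>i=0..1. m i) = 1 \<longleftrightarrow>
      0 \<le> m 0 \<and> 0 \<le> m 1 \<and> m 0 + m 1 = 1" for m :: "nat \<Rightarrow> real"
  proof -
    have "(\<Sum>i=0..1. m i) = m 0 + m 1" by (simp add: One_nat_def)
    moreover have "(\<forall>i\<le>1. m i \<in> {0..1}) \<longleftrightarrow> m 0 \<in> {0..1} \<and> m 1 \<in> {0..1}"
      by (metis One_nat_def le_Suc_eq le_zero_eq order_refl)
    ultimately show ?thesis by (simp only: atLeastAtMost_iff) linarith
  qed
  then show ?thesis
    by (simp only: feasible_modal_split_def modes commodities_eq public_part_def
        atLeastAtMost_singleton ball_simps simp_thms)
qed

lemma is_solution_feasible: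
  assumes "is_solution I X"
  shows "feasible (flow X) (public_part X) (\<lambda>e. layout X e 1)"
  unfolding feasible_def
proof (intro conjI ballI)
  fix \<kappa> assume "\<kappa> \<in> K"
  then show "unit_flow (vertices I) (edges I) \<kappa> (flow X \<kappa>)"
    using assms by (simp add: is_solution_def commodities_eq is_flow_iff)
  fix e assume e: "e \<in> edges I"
  have "0 \<le> flow X \<kappa> e"
    using \<open>unit_flow (vertices I) (edges I) \<kappa> (flow X \<kappa>)\<close> e by (simp add: unit_flow_def)
  moreover have "0 \<le> modal_split X \<kappa> e 1" "modal_split X \<kappa> e 1 \<le> 1"
    using assms \<open>\<kappa> \<in> K\<close> e by (auto simp: is_solution_def feasible_modal_split_iff)
       (smt (verit))
  ultimately show "0 \<le> public_part X \<kappa> e" "public_part X \<kappa> e \<le> flow X \<kappa> e"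
    by (auto simp: public_part_def mult_left_le)
qed (use assms in \<open>auto simp: is_solution_def feasible_layout_iff feasible_modal_split_iff simp del: of_nat_sum\<close>)

text \<open>Multiplication by the total flow undoes the averaging. If the total flow is 0, then so
  is every single flow on the edge, and the default split is multiplied by 0.\<close>

lemma split_times_flow:
  assumes "is_solution I X" "e \<in> edges I"
  shows "total_flow I X e * total_split I X e 1 = (\<Sum>\<kappa>\<in>K. public_part X \<kappa> e)"
    and "total_flow I X e * total_split I X e 0 = (\<Sum>\<kappa>\<in>K. flow X \<kappa> e) - (\<Sum>\<kappa>\<in>K. public_part X \<kappa> e)"
proof -
  have nonneg: "0 \<le> flow X \<kappa> e" if "\<kappa> \<in> K" for \<kappa>
    using feasible_nonneg[OF is_solution_feasible[OF assms(1)] that assms(2)] .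
  have split: "modal_split X \<kappa> e 0 = 1 - modal_split X \<kappa> e 1" if "\<kappa> \<in> K" for \<kappa>
    using assms that by (auto simp: is_solution_def feasible_modal_split_iff eq_diff_eq)
  have priv: "(\<Sum>\<kappa>\<in>K. flow X \<kappa> e * modal_split X \<kappa> e 0)
      = (\<Sum>\<kappa>\<in>K. flow X \<kappa> e) - (\<Sum>\<kappa>\<in>K. public_part X \<kappa> e)"
    using split by (simp add: public_part_def right_diff_distrib sum_subtractf)
  have zero: "flow X \<kappa> e = 0" if "\<not> total_flow I X e > 0" "\<kappa> \<in> K" for \<kappa>
  proof -
    have "total_flow I X e = 0"
      using that(1) sum_nonneg[of K "\<lambda>\<kappa>. flow X \<kappa> e"] nonneg by (simp add: total_flow_def commodities_eq)
    then show ?thesis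
      using that(2) nonneg finite_K by (simp add: total_flow_def commodities_eq sum_nonneg_eq_0_iff)
  qed
  show "total_flow I X e * total_split I X e 1 = (\<Sum>\<kappa>\<in>K. public_part X \<kappa> e)"
    using zero by (cases "total_flow I X e > 0") (auto simp: total_split_def commodities_eq public_part_def)
  show "total_flow I X e * total_split I X e 0 = (\<Sum>\<kappa>\<in>K. flow X \<kappa> e) - (\<Sum>\<kappa>\<in>K. public_part X \<kappa> e)"
    using zero priv by (cases "total_flow I X e > 0")
      (auto simp: total_split_def commodities_eq public_part_def total_flow_def)
qed

lemma total_travel_time_eq:
  assumes "is_solution I X"
  shows "total_travel_time I X = time (flow X) (public_part X)"
proof -
  have "total_travel_time I X = (\<Sum>e\<in>edges I.
      of_rat (travel_time I 0) * ((\<Sum>\<kappa>\<in>K. flow X \<kappa> e) - (\<Sum>\<kappa>\<in>K. public_part X \<kappa> e))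
      + of_rat (travel_time I 1) * (\<Sum>\<kappa>\<in>K. public_part X \<kappa> e))"
    unfolding total_travel_time_def
    using unit_weight split_times_flow[OF assms]
    by (intro sum.cong) (auto simp: modes mult.assoc One_nat_def)
  then show ?thesis
    by (simp add: time_def priv_def total_swap sum.distrib sum_distrib_left[symmetric] sum_subtractf)
qed

lemma total_energy_eq:
  assumes "is_solution I X"
  shows "total_energy I X = energy (flow X) (public_part X) (\<lambda>e. layout X e 1)"
proof -
  have "total_energy I X = (\<Sum>e\<in>edges I.
      of_rat (msp.energy I 0) * ((\<Sum>\<kappa>\<in>K. flow X \<kappa> e) - (\<Sum>\<kappa>\<in>K. public_part X \<kappa> e))
      + of_rat (msp.energy I 1) * real (layout X e 1))"
    unfolding total_energy_def
    using unit_weight split_times_flow[OF assms]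
    by (intro sum.cong) (auto simp: modes mult.assoc One_nat_def)
  then show ?thesis
    by (simp add: energy_def priv_def total_swap sum.distrib sum_distrib_left[symmetric] sum_subtractf)
qed

text \<open>Together with the converse translation this makes the two kinds of competitors
  interchangeable, so that optimality carries over.\<close>

lemma feasible_is_solution:
  assumes "feasible f g L"
  shows "\<exists>X. is_solution I X \<and> total_travel_time I X = time f g \<and> total_energy I X = energy f g L"
proof -
  \<comment> \<open>Where \<open>f \<kappa> e = 0\<close> the quotient is 0, which yields the
    all-private split.\<close>
  define X where "X = \<lparr>flow = f, layout = \<lambda>e i. L e,
    modal_split = \<lambda>\<kappa> e i. if i = 1 then g \<kappa> e / f \<kappa> e else 1 - g \<kappa> e / f \<kappa> e\<rparr>"
  have bounds: "0 \<le> g \<kappa> e" "g \<kappa> e \<le> f \<kappa> e" if "\<kappa> \<in> K" "e \<in> edges I" for \<kappa> e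
    using assms that by (auto simp: feasible_def)
  have pub: "public_part X \<kappa> e = g \<kappa> e" if "\<kappa> \<in> K" "e \<in> edges I" for \<kappa> e
    using bounds[OF that] by (cases "f \<kappa> e = 0") (auto simp: public_part_def X_def)
  have sol: "is_solution I X"
    unfolding is_solution_def
  proof (intro conjI ballI)
    fix \<kappa> assume "\<kappa> \<in> commodities I"
    then show "is_flow I \<kappa> (flow X \<kappa>)"
      using assms by (simp add: commodities_eq is_flow_iff X_def feasible_def)
  next
    show "feasible_layout I (layout X)"
      using assms by (simp add: feasible_layout_iff X_def feasible_def)
  next
    show "feasible_modal_split I X"
      unfolding feasible_modal_split_iff
    proof (intro conjI ballI)
      fix \<kappa> e assume "\<kappa> \<in> K" "e \<in> edges I"
      note b = bounds[OF this]
      then have "g \<kappa> e / f \<kappa> e \<le> 1" by (cases "f \<kappa> e = 0") (auto simp: divide_le_eq_1)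
      then show "0 \<le> modal_split X \<kappa> e 0" "0 \<le> modal_split X \<kappa> e 1"
        "modal_split X \<kappa> e 0 + modal_split X \<kappa> e 1 = 1"
        using b by (auto simp: X_def)
    next
      fix e assume e: "e \<in> edges I"
      then have "(\<Sum>\<kappa>\<in>K. public_part X \<kappa> e) = (\<Sum>\<kappa>\<in>K. g \<kappa> e)"
        using pub by (intro sum.cong) auto
      then show "(\<Sum>\<kappa>\<in>K. public_part X \<kappa> e) \<le> of_rat (capacity I 1) * real (layout X e 1)"
        using assms e by (simp add: X_def feasible_def)
    qed
  qed
  have "total (public_part X) = total g"
    unfolding total_def using pub by (intro sum.cong) auto
  then show ?thesis
    using sol total_travel_time_eq[OF sol] total_energy_eq[OF sol]
    by (intro exI[of _ X]) (auto simp: time_def energy_def priv_def X_def)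
qed

abbreviation optimal_solution :: "'v msp_solution \<Rightarrow> real \<Rightarrow> bool" where
  "optimal_solution X \<equiv>
    optimal_split (vertices I) (edges I) (of_rat (travel_time I 0)) (of_rat (travel_time I 1))
    (of_rat (msp.energy I 0)) (of_rat (msp.energy I 1)) (of_rat (capacity I 1)) (of_rat (cost I 1))
    (of_rat (budget I))
    (flow X) (public_part X) (\<lambda>e. layout X e 1)"

text \<open>\<open>a\<close> may lie anywhere between the optimal time and the bound of the
  instance, as a smaller bound admits fewer competitors. Without a bound it can be taken large,
  which turns the unbounded case into one with slack.\<close>

lemma optimal_splitI:
  assumes "is_min_energy I H" "is_solution I X" "total_energy I X = H"
    and min: "\<And>Y. is_solution I Y \<Longrightarrow> total_energy I Y = H \<Longrightarrow> total_travel_time I X \<le> total_travel_time I Y"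
    and a: "total_travel_time I X \<le> a"
    and bound: "\<And>b. time_bound I = Some b \<Longrightarrow> a \<le> of_rat b"
    and slower: "travel_time I 0 < travel_time I 1"
  shows "optimal_solution X a"
proof
  note eqs = total_travel_time_eq[OF assms(2), symmetric] total_energy_eq[OF assms(2), symmetric]
  show "feasible (flow X) (public_part X) (\<lambda>e. layout X e 1)"
    using assms(2) by (rule is_solution_feasible)
  show "time (flow X) (public_part X) \<le> a" using a eqs by simp
  show "(of_rat (travel_time I 0) :: real) < of_rat (travel_time I 1)"
    using slower by (simp add: of_rat_less)
  fix f' g' L' assume "feasible f' g' L'"
  from feasible_is_solution[OF this] obtain Y where
    Y: "is_solution I Y" "total_travel_time I Y = time f' g'" "total_energy I Y = energy f' g' L'"
    by blast
  show "energy (flow X) (public_part X) (\<lambda>e. layout X e 1) \<le> energy f' g' L'" if "time f' g' \<le> a"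
  proof -
    have "within_time_bound I Y"
      using Y(2) that bound by (force simp: within_time_bound_def split: option.split)
    then show ?thesis
      using assms(1,3) Y eqs unfolding is_min_energy_def is_minimum_def by auto
  qed
  show "time (flow X) (public_part X) \<le> time f' g'"
    if "energy f' g' L' = energy (flow X) (public_part X) (\<lambda>e. layout X e 1)"
    using min[OF Y(1)] Y that eqs assms(3) by simp
qed

text \<open>The target, clipped to the range from 0 to \<open>U\<close>, as a fraction of
  \<open>U\<close>. One fraction serves all commodities and edges, so the algorithm has to compute a
  single quotient.\<close>

definition private_share :: "real \<Rightarrow> real" where
  "private_share U = (case time_bound I of None \<Rightarrow> 0
    | Some b \<Rightarrow> if travel_time I 0 < travel_time I 1
        then min U (max 0 (private_target (of_rat b) U)) / U else 0)"

text \<open>The interface between algorithm and analysis: potentials \<open>d\<close> that bound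
  flow lengths from below, a small edge set \<open>S\<close>, unit flows within \<open>S\<close>
  that avoid their own sources, and a total flow with the saving.\<close>

lemma two_approximation:
  fixes d :: "'v \<Rightarrow> 'v \<Rightarrow> nat"
  assumes optimum: "is_min_energy I H" "is_min_time_at_energy I H T"
    and d: "\<And>t. t \<in> vertices I \<Longrightarrow> d t t = 0"
      "\<And>u v t. (u, v) \<in> edges I \<Longrightarrow> t \<in> vertices I \<Longrightarrow> d u t \<le> d v t + 1"
    and S: "S \<subseteq> edges I" "real (card S) \<le> 2 * (real (card (vertices I)) - 1)"
    and flow: "\<And>\<kappa>. \<kappa> \<in> K \<Longrightarrow> unit_flow (vertices I) (edges I) \<kappa> (flow X \<kappa>)"
      "\<And>\<kappa> e. \<kappa> \<in> K \<Longrightarrow> e \<in> edges I \<Longrightarrow> flow X \<kappa> e \<le> of_bool (e \<in> S \<and> snd e \<noteq> fst \<kappa>)"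
    and U: "0 < total (flow X)"
      "total (flow X) \<le> 2 * real (\<Sum>(s, t)\<in>K. d s t) - 2 * (real (card (vertices I)) - 1)"
    and split: "\<And>\<kappa> e. \<kappa> \<in> K \<Longrightarrow> e \<in> edges I \<Longrightarrow>
        modal_split X \<kappa> e 0 = private_share (total (flow X)) \<and>
        modal_split X \<kappa> e 1 = 1 - private_share (total (flow X))"
    and layout: "\<And>e. e \<in> edges I \<Longrightarrow>
        layout X e 1 = (if e \<in> S \<and> private_share (total (flow X)) < 1 then 1 else 0)"
  shows "is_solution I X \<and> total_energy I X \<le> 2 * H \<and> total_travel_time I X \<le> 2 * T"
proof -
  define \<mu> where "\<mu> = private_share (total (flow X))"
  define U where "U = total (flow X)"
  define W where "W = real (\<Sum>(s, t)\<in>K. d s t)"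
  have U: "0 < U" "U \<le> 2 * W - 2 * (real (card (vertices I)) - 1)"
    using U by (auto simp: U_def W_def)
  then have UW: "U \<le> 2 * W" using two_le_real_card by argo
  have \<mu>: "0 \<le> \<mu>" "\<mu> \<le> 1"
    using U by (auto simp: \<mu>_def private_share_def U_def[symmetric] split: option.split)
  have flow0: "0 \<le> flow X \<kappa> e" if "\<kappa> \<in> K" "e \<in> edges I" for \<kappa> e
    using flow(1) that by (simp add: unit_flow_def)
  have pub: "public_part X \<kappa> e = (1 - \<mu>) * flow X \<kappa> e" if "\<kappa> \<in> K" "e \<in> edges I" for \<kappa> e
    using split[OF that] by (simp add: public_part_def \<mu>_def)
  have sol: "is_solution I X"
    unfolding is_solution_def
  proof (intro conjI ballI)
    fix \<kappa> assume "\<kappa> \<in> commodities I"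
    then show "is_flow I \<kappa> (flow X \<kappa>)"
      using flow(1) by (simp add: commodities_eq is_flow_iff)
  next
    show "feasible_layout I (layout X)"
      unfolding feasible_layout_iff using layout by (intro budget_ok) auto
  next
    show "feasible_modal_split I X"
      unfolding feasible_modal_split_iff
    proof (intro conjI ballI)
      fix \<kappa> e assume "\<kappa> \<in> K" "e \<in> edges I"
      from split[OF this] show "0 \<le> modal_split X \<kappa> e 0" "0 \<le> modal_split X \<kappa> e 1"
        "modal_split X \<kappa> e 0 + modal_split X \<kappa> e 1 = 1"
        using \<mu> by (auto simp: \<mu>_def[symmetric])
    next
      fix e assume e: "e \<in> edges I"
      have eq: "(\<Sum>\<kappa>\<in>K. public_part X \<kappa> e) = (1 - \<mu>) * (\<Sum>\<kappa>\<in>K. flow X \<kappa> e)"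
        using pub e by (simp add: sum_distrib_left)
      show "(\<Sum>\<kappa>\<in>K. public_part X \<kappa> e) \<le> of_rat (capacity I 1) * real (layout X e 1)"
      proof (cases "e \<in> S \<and> \<mu> < 1")
        case True
        have "(\<Sum>\<kappa>\<in>K. flow X \<kappa> e) \<le> of_rat (capacity I 1)"
          using flow(2)[OF _ e] e edges True by (intro sum_le_capacity[of _ "snd e"]) auto
        moreover have "(1 - \<mu>) * (\<Sum>\<kappa>\<in>K. flow X \<kappa> e) \<le> (\<Sum>\<kappa>\<in>K. flow X \<kappa> e)"
          using \<mu> flow0 e by (intro mult_left_le_one_le sum_nonneg) auto
        ultimately show ?thesis using layout[OF e] True eq by (simp add: \<mu>_def)
      next
        case False
        have "flow X \<kappa> e = 0" if "\<kappa> \<in> K" "e \<notin> S" for \<kappa>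
          using flow(2)[OF that(1) e] flow0[OF that(1) e] that(2) by simp
        \<comment> \<open>An edge without a vehicle carries no flow if it lies outside
          \<open>S\<close>; within \<open>S\<close> vehicles are missing only if everything is
          private.\<close>
        then have "(\<Sum>\<kappa>\<in>K. flow X \<kappa> e) = 0 \<or> \<mu> = 1"
          using False \<mu> by (cases "e \<in> S") (simp_all add: sum.neutral)
        then have "(\<Sum>\<kappa>\<in>K. public_part X \<kappa> e) = 0" unfolding eq by (elim disjE) simp_all
        moreover have "layout X e 1 = 0" using layout[OF e] False by (simp add: \<mu>_def)
        ultimately show ?thesis by simp
      qed
    qed
  qed
  have "total (public_part X) = (1 - \<mu>) * U"
    using pub by (simp add: total_def U_def sum_distrib_left)
  then have priv: "priv (flow X) (public_part X) = \<mu> * U" "total (public_part X) = U - \<mu> * U"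
    by (simp_all add: priv_def U_def algebra_simps)
  define l where "l = real (\<Sum>e\<in>edges I. layout X e 1)"
  have l: "l \<le> 2 * (real (card (vertices I)) - 1)" "1 \<le> \<mu> \<Longrightarrow> l = 0"
  proof -
    have "(\<Sum>e\<in>edges I. layout X e 1) \<le> (\<Sum>e\<in>edges I. of_bool (e \<in> S))"
      using layout by (intro sum_mono) auto
    also have "\<dots> = card S" using finite_E S(1) by (simp add: Int_absorb1)
    finally show "l \<le> 2 * (real (card (vertices I)) - 1)"
      using S(2) by (simp add: l_def del: of_nat_sum)
    show "1 \<le> \<mu> \<Longrightarrow> l = 0" using layout by (simp add: l_def \<mu>_def)
  qed
  have time_X: "total_travel_time I X
      = of_rat (travel_time I 0) * (\<mu> * U) + of_rat (travel_time I 1) * (U - \<mu> * U)"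
    and energy_X: "total_energy I X = of_rat (msp.energy I 0) * (\<mu> * U) + of_rat (msp.energy I 1) * l"
    by (simp_all add: total_travel_time_eq[OF sol] total_energy_eq[OF sol] time_def energy_def priv l_def)
  obtain Y where Y: "is_solution I Y" "total_energy I Y = H" "total_travel_time I Y = T"
    and Y_min: "\<And>Z. is_solution I Z \<Longrightarrow> total_energy I Z = H \<Longrightarrow> T \<le> total_travel_time I Z"
    using optimum(2) unfolding is_min_time_at_energy_def is_minimum_def by blast
  let ?f = "flow Y" and ?g = "public_part Y" and ?L = "\<lambda>e. layout Y e 1"
  have feas: "feasible ?f ?g ?L" using Y(1) by (rule is_solution_feasible)
  have H: "energy ?f ?g ?L = H" and T: "time ?f ?g = T"
    using Y(2,3) by (simp_all add: total_energy_eq[OF Y(1)] total_travel_time_eq[OF Y(1)])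
  have W: "W \<le> total ?f" unfolding W_def using feas d by (rule total_ge_dist)
  have vehicles_only: "total_energy I X \<le> 2 * H \<and> total_travel_time I X \<le> 2 * T"
    if "\<mu> = 0" "travel_time I 1 \<le> travel_time I 0 \<or> priv ?f ?g = 0"
  proof
    show "total_energy I X \<le> 2 * H"
      using vehicles_le_energy[OF feas l(1)] that(1) by (simp add: energy_X H)
    have "(of_rat (travel_time I 1) :: real) \<le> of_rat (travel_time I 0) \<or> priv ?f ?g = 0"
      using that(2) by (simp add: of_rat_less_eq)
    from public_time_le[OF feas W UW this] show "total_travel_time I X \<le> 2 * T"
      using that(1) by (simp add: time_X T)
  qed
  have optimal: "optimal_solution Y a"
    if "T \<le> a" "\<And>b. time_bound I = Some b \<Longrightarrow> a \<le> of_rat b" "travel_time I 0 < travel_time I 1" for a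
    using optimal_splitI[OF optimum(1) Y(1,2), of a] Y(3) Y_min that by simp
  consider (public) "travel_time I 1 \<le> travel_time I 0"
    | (unbounded) "travel_time I 0 < travel_time I 1" "time_bound I = None"
    | (bounded) b where "travel_time I 0 < travel_time I 1" "time_bound I = Some b"
    by (metis not_le option.exhaust)
  then have "total_energy I X \<le> 2 * H \<and> total_travel_time I X \<le> 2 * T"
  proof cases
    case public
    then show ?thesis
      using \<open>travel_time I 1 \<le> travel_time I 0\<close>
      by (intro vehicles_only) (auto simp: \<mu>_def private_share_def split: option.split)
  next
    case unbounded
    let ?slack = "(of_rat (travel_time I 1) - of_rat (travel_time I 0)) *
      (of_rat (msp.energy I 1) / of_rat (msp.energy I 0)) :: real"
    have "0 \<le> ?slack"
      using unbounded(1) energies \<eta>\<^sub>0_pos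
      by (intro mult_nonneg_nonneg divide_nonneg_nonneg) (simp_all add: of_rat_less_eq)
    \<comment> \<open>This bound is past the threshold of \<open>no_private_flow\<close>, so the
      optimum is all public.\<close>
    then have "optimal_solution Y (T + ?slack + 1)"
      using unbounded by (intro optimal) auto
    then interpret opt: optimal_split "vertices I" "edges I" "of_rat (travel_time I 0)"
      "of_rat (travel_time I 1)" "of_rat (msp.energy I 0)" "of_rat (msp.energy I 1)"
      "of_rat (capacity I 1)" "of_rat (cost I 1)" "of_rat (budget I)" ?f ?g ?L "T + ?slack + 1" .
    have "priv ?f ?g = 0" using opt.no_private_flow T by simp
    then show ?thesis
      using unbounded by (intro vehicles_only) (auto simp: \<mu>_def private_share_def)
  next
    case bounded
    \<comment> \<open>\<open>Y\<close> is the fastest among all solutions of energy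
      \<open>H\<close>, whether or not they obey the bound. Comparison with a solution
      \<open>Z\<close> that attains \<open>H\<close> within the bound shows that \<open>Y\<close>
      obeys it too.\<close>
    obtain Z where Z: "is_solution I Z" "within_time_bound I Z" "total_energy I Z = H"
      using optimum(1) unfolding is_min_energy_def is_minimum_def by blast
    have "T \<le> of_rat b"
      using Y_min[OF Z(1,3)] Z(2) bounded(2) by (simp add: within_time_bound_def)
    then have "optimal_solution Y (of_rat b)"
      using bounded by (intro optimal) auto
    then interpret opt: optimal_split "vertices I" "edges I" "of_rat (travel_time I 0)"
      "of_rat (travel_time I 1)" "of_rat (msp.energy I 0)" "of_rat (msp.energy I 1)"
      "of_rat (capacity I 1)" "of_rat (cost I 1)" "of_rat (budget I)" ?f ?g ?L "of_rat b" .
    let ?p = "private_target (of_rat b) U"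
    have \<mu>U: "\<mu> * U = min U (max 0 ?p)"
      using bounded U by (simp add: \<mu>_def private_share_def U_def[symmetric])
    show ?thesis
    proof (cases "U \<le> ?p")
      case True
      then have \<mu>U: "\<mu> * U = U" using \<mu>U U by simp
      then have "l = 0" using l(2) U by simp
      then show ?thesis
        using opt.private_time_le[OF W UW] opt.private_energy_le[OF W U(2) True]
        by (simp add: energy_X time_X H T \<mu>U)
    next
      case False
      then have \<mu>U: "\<mu> * U = max 0 ?p" using \<mu>U U by simp
      have "of_rat (travel_time I 0) * (\<mu> * U) + of_rat (travel_time I 1) * (U - \<mu> * U) \<le> 2 * time ?f ?g"
        using False U unfolding \<mu>U by (intro opt.private_target_time[OF W UW]) auto
      moreover have "of_rat (msp.energy I 0) * (\<mu> * U) + of_rat (msp.energy I 1) * l \<le> 2 * energy ?f ?g ?L"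
        unfolding \<mu>U using False by (intro opt.mixed_energy_le[OF W U(2) _ l(1)]) auto
      ultimately show ?thesis by (simp add: energy_X time_X H T)
    qed
  qed
  with sol show ?thesis by simp
qed

end

section \<open>Rules for loops and frames\<close>

definition For :: "nat \<Rightarrow> aexp \<Rightarrow> com \<Rightarrow> com" where
  "For x b c = Seq (Store x (Const 0) (Const 0))
     (While (Sub b (Load x (Const 0)))
       (Seq c (Store x (Const 0) (Add (Load x (Const 0)) (Const 1)))))"

text \<open>\<open>J (Suc i)\<close> is required of the store after the increment, while the body
  must leave the counter alone. The bound expression is evaluated anew in every iteration, hence the
  condition that it keeps the value \<open>m\<close>.\<close>

lemma wp_For:
  assumes init: "J 0 (s(x := (s x)(0 := 0)))"
    and step: "\<And>i s. i < m \<Longrightarrow> J i s \<Longrightarrow> s x 0 = i \<Longrightarrow>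
      wp N c (\<lambda>s'. s' x 0 = i \<and> J (Suc i) (s'(x := (s' x)(0 := Suc i)))) s"
    and bound: "\<And>i s. J i s \<Longrightarrow> s x 0 = i \<Longrightarrow> aval b s = m"
    and exit: "\<And>s. J m s \<Longrightarrow> s x 0 = m \<Longrightarrow> Q s"
    and m: "m < N"
  shows "wp N (For x b c) Q s"
proof -
  have "wp N (While (Sub b (Load x (Const 0)))
       (Seq c (Store x (Const 0) (Add (Load x (Const 0)) (Const 1))))) Q (s(x := (s x)(0 := 0)))"
  proof (rule wp_while[where I = "\<lambda>s. s x 0 \<le> m \<and> J (s x 0) s" and \<mu> = "\<lambda>s. m - s x 0"])
    fix s assume I: "s x 0 \<le> m \<and> J (s x 0) s" and "aval (Sub b (Load x (Const 0))) s \<noteq> 0"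
    then have less: "s x 0 < m" using bound[of "s x 0" s] by simp
    have "log_cost (Suc (s x 0)) \<le> N" using less m by (intro log_cost_leI) simp
    with less show "wp N (Seq c (Store x (Const 0) (Add (Load x (Const 0)) (Const 1))))
        (\<lambda>s'. (s' x 0 \<le> m \<and> J (s' x 0) s') \<and> m - s' x 0 < m - s x 0) s"
      using I by (auto intro!: wp_mono[OF step[of "s x 0" s]])
  next
    fix s assume "s x 0 \<le> m \<and> J (s x 0) s" "aval (Sub b (Load x (Const 0))) s = 0"
    then show "Q s" using bound[of "s x 0" s] exit[of s] by auto
  qed (use init m in auto)
  then show ?thesis using m by (simp add: For_def log_cost_leI)
qed

text \<open>At least one of the two truncated differences is 0, so their sum is the absolute
  difference.\<close>

definition Equal :: "aexp \<Rightarrow> aexp \<Rightarrow> aexp" where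
  "Equal a b = Sub (Const 1) (Add (Sub a b) (Sub b a))"

lemma aval_Equal [simp]: "aval (Equal a b) s = of_bool (aval a s = aval b s)"
  by (auto simp: Equal_def)

definition frame :: "nat set \<Rightarrow> store \<Rightarrow> store \<Rightarrow> bool" where
  "frame A s s' \<longleftrightarrow> (\<forall>a. a \<notin> A \<longrightarrow> s' a = s a)"

lemma frame_refl [simp]: "frame A s s"
  by (simp add: frame_def)

lemma frame_upd [simp]: "frame A s s' \<Longrightarrow> a \<in> A \<Longrightarrow> frame A s (s'(a := v))"
  by (simp add: frame_def)

lemma frameD: "frame A s s' \<Longrightarrow> a \<notin> A \<Longrightarrow> s' a = s a"
  by (simp add: frame_def)

lemma frame_trans: "frame A s s' \<Longrightarrow> frame B s' s'' \<Longrightarrow> A \<subseteq> C \<Longrightarrow> B \<subseteq> C \<Longrightarrow> frame C s s''"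
  unfolding frame_def by (metis subsetD)

lemma index_eq_iff: "t < n \<Longrightarrow> t' < n \<Longrightarrow> x * n + t = x' * n + t' \<longleftrightarrow> x = x' \<and> t = (t' :: nat)"
  by (metis div_mult_self3 div_less add_cancel_left_right mod_mult_self3 mod_less add_left_imp_eq
      gr_implies_not0)

lemma index_less: "x < m \<Longrightarrow> t < n \<Longrightarrow> x * n + t < m * (n :: nat)"
proof -
  assume "x < m" "t < n"
  then have "x * n + t < Suc x * n" by simp
  also have "\<dots> \<le> m * n" using \<open>x < m\<close> by (intro mult_le_mono1) simp
  finally show ?thesis .
qed

lemma index_div_less: "p < m * n \<Longrightarrow> p div n < (m :: nat)"
  by (simp add: less_mult_imp_div_less)

section \<open>The algorithm\<close>

text \<open>Array 7 holds the distances \<open>d\<close> in the graph, array 8 marks the chosen edges, array 9 holds the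
  distances with respect to these; arrays 6 and 21 mark the vertices that have a tree edge already.
  The arrays 10 to 20 are used as scalar variables: 14 is the root, 17 the total flow, and 19 and 20
  are the numerator and the denominator of the private share.\<close>

abbreviation var :: "nat \<Rightarrow> aexp" where "var x \<equiv> Load x (Const 0)"
abbreviation assign :: "nat \<Rightarrow> aexp \<Rightarrow> com" where "assign x e \<equiv> Store x (Const 0) e"

abbreviation vertex_count :: aexp where "vertex_count \<equiv> var 0"
abbreviation edge_count :: aexp where "edge_count \<equiv> Load 0 (Const 1)"
abbreviation tail_of :: "aexp \<Rightarrow> aexp" where "tail_of e \<equiv> Load 0 (Add (Const 3) (Mul (Const 3) e))"
abbreviation head_of :: "aexp \<Rightarrow> aexp" where "head_of e \<equiv> Load 0 (Add (Const 4) (Mul (Const 3) e))"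
abbreviation pair_index :: "aexp \<Rightarrow> aexp \<Rightarrow> aexp" where
  "pair_index x y \<equiv> Add (Mul x vertex_count) y"

text \<open>Entry \<open>x * n + t\<close> is for the way from \<open>x\<close> to \<open>t\<close>.
  The value \<open>q + 1\<close> stands for infinity, as no shortest path has more than
  \<open>q\<close> edges.\<close>

definition init_distances :: "nat \<Rightarrow> com" where
  "init_distances d =
     Seq (For 10 (Mul vertex_count vertex_count) (Store d (var 10) (Add edge_count (Const 1))))
       (For 10 vertex_count (Store d (pair_index (var 10) (var 10)) (Const 0)))"

text \<open>Variable 10 codes an edge \<open>l\<close> and a target \<open>t\<close> as
  \<open>l * n + t\<close>. Every improvement restarts the scan at 0, so the loop ends only after a
  full scan without improvement. This keeps the invariant simple and the number of steps polynomial,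
  since each improvement lowers the sum of the entries.\<close>

definition relax_step :: "nat \<Rightarrow> aexp \<Rightarrow> com" where
  "relax_step d marked =
     Seq (assign 11 (Div (var 10) vertex_count))
       (Seq (assign 12 (Sub (var 10) (Mul (var 11) vertex_count)))
         (Cond (Mul marked (Sub (Load d (pair_index (tail_of (var 11)) (var 12)))
             (Add (Load d (pair_index (head_of (var 11)) (var 12))) (Const 1))))
           (Seq (Store d (pair_index (tail_of (var 11)) (var 12))
               (Add (Load d (pair_index (head_of (var 11)) (var 12))) (Const 1)))
             (assign 10 (Const 0)))
           (assign 10 (Add (var 10) (Const 1)))))"

definition relax_all :: "nat \<Rightarrow> aexp \<Rightarrow> com" where
  "relax_all d marked =
     Seq (assign 10 (Const 0))
       (While (Sub (Mul edge_count vertex_count) (var 10))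
         (relax_step d marked))"

locale program_input =
  fixes N n q :: nat and tl hd inp :: "nat \<Rightarrow> nat"
  assumes inp: "inp 0 = n" "inp (Suc 0) = q"
      "\<And>l. l < q \<Longrightarrow> inp (3 + 3 * l) = tl l" "\<And>l. l < q \<Longrightarrow> inp (4 + 3 * l) = hd l"
    and ends: "\<And>l. l < q \<Longrightarrow> tl l < n" "\<And>l. l < q \<Longrightarrow> hd l < n"
    and N_large: "(n + 2) ^ 3 * (q + 2) ^ 2 < N"
begin

lemma size_bounds:
  "n < N" "q + 2 < N" "q * n < N" "n * n < N" "n * n * (q + 1) < N" "n * n * q < N"
  "n * n * (q + 1) * (q * n + 1) + q * n < N" "2 * n * (q + 1) + 2 < N" "2 < N"
proof -
  let ?M = "(n + 2) ^ 3 * (q + 2) ^ 2"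
  have M: "x < N" if "x \<le> ?M" for x using that N_large by linarith
  have main: "n * n * (q + 1) * (q * n + 1) + q * n \<le> ?M"
    by (simp add: power3_eq_cube power2_eq_square algebra_simps)
  show "n * n * (q + 1) * (q * n + 1) + q * n < N" using main by (rule M)
  show "n < N" "q + 2 < N" "q * n < N" "n * n < N" "n * n * (q + 1) < N" "n * n * q < N"
    "2 * n * (q + 1) + 2 < N" "2 < N"
    by (rule M, simp add: power3_eq_cube power2_eq_square algebra_simps)+
qed

text \<open>Speaks of edges rather than walks: from every finite entry off the diagonal a marked
  edge leads to a smaller one. Following such edges yields a walk no longer than the entry.\<close>

definition upper_dist :: "(nat \<Rightarrow> bool) \<Rightarrow> (nat \<Rightarrow> nat) \<Rightarrow> bool" where
  "upper_dist M D \<longleftrightarrow> (\<forall>t<n. D (t * n + t) = 0) \<and> (\<forall>i. D i \<le> q + 1) \<and>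
     (\<forall>x<n. \<forall>t<n. x \<noteq> t \<longrightarrow> D (x * n + t) \<le> q \<longrightarrow>
       (\<exists>l<q. M l \<and> tl l = x \<and> D (hd l * n + t) + 1 \<le> D (x * n + t)))"

definition relaxed :: "(nat \<Rightarrow> bool) \<Rightarrow> (nat \<Rightarrow> nat) \<Rightarrow> nat \<Rightarrow> bool" where
  "relaxed M D p \<longleftrightarrow> (M (p div n) \<longrightarrow>
     D (tl (p div n) * n + p mod n) \<le> D (hd (p div n) * n + p mod n) + 1)"

text \<open>Upper bounds realised by walks, together with the absence of improvable edges, determine
  the exact distances and leave \<open>q + 1\<close> for unreachable pairs.\<close>

definition is_dist :: "(nat \<Rightarrow> bool) \<Rightarrow> (nat \<Rightarrow> nat) \<Rightarrow> bool" where
  "is_dist M D \<longleftrightarrow> upper_dist M D \<and> (\<forall>p<q * n. relaxed M D p)"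

text \<open>The new entry is witnessed by \<open>l\<close> itself, and other witnesses persist
  because entries at heads only decrease. Diagonal entries are 0 and never lowered.\<close>

lemma upper_dist_step:
  assumes D: "upper_dist M D" and l: "l < q" "M l" "t < n"
    and less: "D (hd l * n + t) + 1 < D (tl l * n + t)"
  shows "upper_dist M (D(tl l * n + t := D (hd l * n + t) + 1))" (is "upper_dist M ?D")
proof -
  have le: "?D i \<le> D i" for i using less by simp
  have tlt: "tl l \<noteq> t" using D l less by (auto simp: upper_dist_def)
  have "hd l * n + t \<noteq> tl l * n + t" using less by (metis add_lessD1 less_irrefl)
  then have hd_same: "?D (hd l * n + t) = D (hd l * n + t)" by (simp only: fun_upd_other not_False_eq_True)
  show ?thesis
    unfolding upper_dist_def
  proof (intro conjI allI impI)
    fix t' assume "t' < n"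
    then show "?D (t' * n + t') = 0"
      using D tlt l index_eq_iff[of t' n t t' "tl l"] by (auto simp: upper_dist_def)
  next
    fix i show "?D i \<le> q + 1" using D le[of i] by (meson order_trans upper_dist_def)
  next
    fix x t' assume x: "x < n" "t' < n" "x \<noteq> t'" "?D (x * n + t') \<le> q"
    show "\<exists>l<q. M l \<and> tl l = x \<and> ?D (hd l * n + t') + 1 \<le> ?D (x * n + t')"
    proof (cases "x = tl l \<and> t' = t")
      case True
      then show ?thesis using l hd_same by (intro exI[of _ l]) auto
    next
      case False
      then have same: "?D (x * n + t') = D (x * n + t')"
        using index_eq_iff[of t' n t x "tl l"] x l by auto
      then have "D (x * n + t') \<le> q" using x(4) by (simp only:)
      with x(1-3) D obtain l' where "l' < q" "M l'" "tl l' = x" "D (hd l' * n + t') + 1 \<le> D (x * n + t')"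
        unfolding upper_dist_def by meson
      then show ?thesis using le[of "hd l' * n + t'"] same by (intro exI[of _ l']) auto
    qed
  qed
qed

lemma wp_init_distances:
  assumes "s 0 = inp" "d \<noteq> 0" "d \<noteq> 10" "\<And>i. s d i = 0"
    and Q: "\<And>s'. frame {d, 10} s s' \<Longrightarrow> upper_dist M (s' d) \<Longrightarrow> Q s'"
  shows "wp N (init_distances d) Q s"
  unfolding init_distances_def wp.simps
proof (rule wp_For[where m = "n * n" and
      J = "\<lambda>i s'. frame {d, 10} s s' \<and> (\<forall>j. s' d j = (if j < i then q + 1 else 0))"])
  fix s' assume J: "frame {d, 10} s s' \<and> (\<forall>j. s' d j = (if j < n * n then q + 1 else 0))"
  show "wp N (For 10 vertex_count (Store d (pair_index (var 10) (var 10)) (Const 0))) Q s'"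
  proof (rule wp_For[where m = n and
        J = "\<lambda>i s'. frame {d, 10} s s' \<and> (\<forall>j<i. s' d (j * n + j) = 0) \<and> (\<forall>j. s' d j \<le> q + 1) \<and>
          (\<forall>x<n. \<forall>t<n. x \<noteq> t \<longrightarrow> s' d (x * n + t) = q + 1)"])
    fix i s'
    assume i: "i < n" and J: "frame {d, 10} s s' \<and> (\<forall>j<i. s' d (j * n + j) = 0) \<and>
      (\<forall>j. s' d j \<le> q + 1) \<and> (\<forall>x<n. \<forall>t<n. x \<noteq> t \<longrightarrow> s' d (x * n + t) = q + 1)" and "s' 10 0 = i"
    moreover have "s' 0 = inp" using J assms frameD[of "{d, 10}" s s' 0] by auto
    moreover have "log_cost 0 \<le> N" using size_bounds by (intro log_cost_leI) auto
    ultimately show "wp N (Store d (pair_index (var 10) (var 10)) (Const 0))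
         (\<lambda>s'. s' 10 0 = i \<and> frame {d, 10} s (s'(10 := (s' 10)(0 := Suc i))) \<and>
           (\<forall>j<Suc i. (s'(10 := (s' 10)(0 := Suc i))) d (j * n + j) = 0) \<and>
           (\<forall>j. (s'(10 := (s' 10)(0 := Suc i))) d j \<le> q + 1) \<and>
           (\<forall>x<n. \<forall>t<n. x \<noteq> t \<longrightarrow> (s'(10 := (s' 10)(0 := Suc i))) d (x * n + t) = q + 1)) s'"
      using assms(2,3) i by (auto simp: inp less_Suc_eq index_eq_iff)
  next
    fix s' :: store assume J: "frame {d, 10} s s' \<and> (\<forall>j<n. s' d (j * n + j) = 0) \<and>
      (\<forall>j. s' d j \<le> q + 1) \<and> (\<forall>x<n. \<forall>t<n. x \<noteq> t \<longrightarrow> s' d (x * n + t) = q + 1)"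
    then show "Q s'" by (intro Q) (auto simp: upper_dist_def)
  next
    fix i s' assume "frame {d, 10} s s' \<and> (\<forall>j<i. s' d (j * n + j) = 0) \<and>
      (\<forall>j. s' d j \<le> q + 1) \<and> (\<forall>x<n. \<forall>t<n. x \<noteq> t \<longrightarrow> s' d (x * n + t) = q + 1)"
    then have "s' 0 = inp" using assms frameD[of "{d, 10}" s s' 0] by auto
    then show "aval vertex_count s' = n" by (simp add: inp)
  qed (use J assms size_bounds in \<open>simp_all add: index_less\<close>)
next
  fix i s' assume "i < n * n" "frame {d, 10} s s' \<and> (\<forall>j. s' d j = (if j < i then q + 1 else 0))"
    "s' 10 0 = i"
  moreover have "log_cost (q + 1) \<le> N" using size_bounds by (intro log_cost_leI) auto
  moreover have "s' 0 = inp" using calculation assms frameD[of "{d, 10}" s s' 0] by auto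
  ultimately show "wp N (Store d (var 10) (Add edge_count (Const 1))) (\<lambda>s'. s' 10 0 = i \<and>
      frame {d, 10} s (s'(10 := (s' 10)(0 := Suc i))) \<and>
      (\<forall>j. (s'(10 := (s' 10)(0 := Suc i))) d j = (if j < Suc i then q + 1 else 0))) s'"
    using assms(2,3) by (auto simp: inp less_Suc_eq)
next
  fix i s' assume "frame {d, 10} s s' \<and> (\<forall>j. s' d j = (if j < i then q + 1 else 0))"
  then have "s' 0 = inp" using assms frameD[of "{d, 10}" s s' 0] by auto
  then show "aval (Mul vertex_count vertex_count) s' = n * n" by (simp add: inp)
qed (use assms size_bounds in simp_all)

lemma wp_relax_all:
  assumes "s 0 = inp" "d \<notin> {0, 10, 11, 12}" "upper_dist M (s d)"
    and marked: "\<And>s'. frame {d, 10, 11, 12} s s' \<Longrightarrow> s' 11 0 < q \<Longrightarrow> aval marked s' = of_bool (M (s' 11 0))"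
    and Q: "\<And>s'. frame {d, 10, 11, 12} s s' \<Longrightarrow> is_dist M (s' d) \<Longrightarrow> Q s'"
  shows "wp N (relax_all d marked) Q s"
proof -
  let ?I = "\<lambda>s'. frame {d, 10, 11, 12} s s' \<and> upper_dist M (s' d) \<and> (\<forall>p<s' 10 0. relaxed M (s' d) p) \<and>
    s' 10 0 \<le> q * n"
  let ?total = "\<lambda>s'. (\<Sum>i<n * n. s' d i)"
  have d: "d \<noteq> 0" "d \<noteq> 10" "d \<noteq> 11" "d \<noteq> 12" using assms(2) by auto
  have N1: "log_cost 0 \<le> N" using size_bounds by (intro log_cost_leI) auto
  have "wp N (While (Sub (Mul edge_count vertex_count) (var 10))
         (relax_step d marked)) Q (s(10 := (s 10)(0 := 0)))"
  \<comment> \<open>A lexicographic measure: an improvement lowers the sum of the entries, worth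
    \<open>q * n + 1\<close>, which outweighs the restarted scan of \<open>q * n\<close>
    steps.\<close>
  proof (rule wp_while[where I = ?I and \<mu> = "\<lambda>s'. ?total s' * (q * n + 1) + (q * n - s' 10 0)"])
    show "?I (s(10 := (s 10)(0 := 0)))" using assms d by simp
    have "?total s \<le> (\<Sum>i<n * n. q + 1)"
      using assms(3) by (intro sum_mono) (simp add: upper_dist_def)
    then have "?total s \<le> n * n * (q + 1)" by simp
    then have "?total s * (q * n + 1) \<le> n * n * (q + 1) * (q * n + 1)" by (rule mult_le_mono1)
    then show "?total (s(10 := (s 10)(0 := 0))) * (q * n + 1) + (q * n - (s(10 := (s 10)(0 := 0))) 10 0) \<le> N"
      using size_bounds(7) d by simp
  next
    fix s' assume I: "?I s'" and "aval (Sub (Mul edge_count vertex_count) (var 10)) s' = 0"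
    moreover have "s' 0 = inp" using I assms frameD[of "{d, 10, 11, 12}" s s' 0] by auto
    ultimately show "Q s'" by (intro Q) (auto simp: inp is_dist_def)
  next
    fix s' assume I: "?I s'" and "aval (Sub (Mul edge_count vertex_count) (var 10)) s' \<noteq> 0"
    define p where "p = s' 10 0"
    define l where "l = p div n"
    define t where "t = p mod n"
    have s0: "s' 0 = inp" using I assms frameD[of "{d, 10, 11, 12}" s s' 0] by auto
    then have p: "p < q * n" using \<open>aval _ s' \<noteq> 0\<close> by (simp add: inp p_def)
    then have "0 < n" by (cases n) auto
    have l: "l < q" using p by (simp add: l_def index_div_less)
    have t: "t < n" "p - l * n = t" using \<open>0 < n\<close> by (auto simp: t_def l_def minus_div_mult_eq_mod)
    let ?s1 = "s'(11 := (s' 11)(0 := l), 12 := (s' 12)(0 := t))"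
    have "frame {d, 10, 11, 12} s ?s1" using I by simp
    then have mk: "aval marked ?s1 = of_bool (M l)" using marked[of ?s1] l by simp
    have logs: "log_cost l \<le> N" "log_cost t \<le> N" "log_cost (Suc p) \<le> N"
      using l t p size_bounds by (auto intro!: log_cost_leI)
    have bound: "s' d i \<le> q + 1" for i using I by (simp add: upper_dist_def)
    show "wp N (relax_step d marked)
      (\<lambda>s''. ?I s'' \<and> ?total s'' * (q * n + 1) + (q * n - s'' 10 0)
        < ?total s' * (q * n + 1) + (q * n - s' 10 0)) s'"
    proof (cases "M l \<and> s' d (hd l * n + t) + 1 < s' d (tl l * n + t)")
      case True
      let ?D = "(s' d)(tl l * n + t := Suc (s' d (hd l * n + t)))"
      have upper: "upper_dist M ?D"
        using upper_dist_step[of M "s' d" l t] I l t True by simp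
      have "tl l * n + t < n * n" using ends(1)[OF l] t(1) by (rule index_less)
      then have "(\<Sum>i<n * n. ?D i) < (\<Sum>i<n * n. s' d i)"
        using True by (intro sum_strict_mono_ex1) auto
      then have "Suc (\<Sum>i<n * n. ?D i) * (q * n + 1) \<le> ?total s' * (q * n + 1)"
        by (intro mult_le_mono1) simp
      then have less: "(\<Sum>i<n * n. ?D i) * (q * n + 1) + q * n < ?total s' * (q * n + 1) + (q * n - p)"
        by simp
      have "Suc (s' d (hd l * n + t)) \<le> q + 1" using True bound[of "tl l * n + t"] by linarith
      then have "log_cost (Suc (s' d (hd l * n + t))) \<le> N"
        using size_bounds by (intro log_cost_leI) auto
      then show ?thesis
        using True mk logs N1 s0 l t d I upper less
        by (simp add: relax_step_def inp p_def[symmetric] l_def[symmetric])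
    next
      case False
      have "relaxed M (s' d) p"
        using False by (auto simp: relaxed_def l_def[symmetric] t_def[symmetric])
      then have "\<forall>p'<Suc p. relaxed M (s' d) p'" using I by (auto simp: p_def less_Suc_eq)
      then show ?thesis
        using False mk logs N1 s0 l t d I p
        by (auto simp: relax_step_def inp p_def[symmetric] l_def[symmetric])
    qed
  qed
  then show ?thesis using N1 by (simp add: relax_all_def)
qed

end

section \<open>Root selection, tree marking and routing\<close>

definition sum_distances :: com where
  "sum_distances =
     For 11 vertex_count
       (assign 15 (Add (var 15) (Add (Load 7 (pair_index (var 10) (var 11)))
         (Load 7 (pair_index (var 11) (var 10))))))"

definition better_root :: com where
  "better_root = Cond (Sub (var 13) (var 15)) (Seq (assign 13 (var 15)) (assign 14 (var 10))) Skip"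

definition try_root :: com where
  "try_root = Seq (assign 15 (Const 0)) (Seq sum_distances better_root)"

text \<open>The initial value of variable 13 exceeds all possible sums of distances, so the first
  vertex tried replaces it.\<close>

definition select_root :: com where
  "select_root =
     Seq (assign 13 (Add (Mul (Mul (Const 2) vertex_count) (Add edge_count (Const 1))) (Const 1)))
       (For 10 vertex_count
         try_root)"

text \<open>Picks the first tight edge for each key. With heads as keys it selects the parent edges
  of the out-tree, with tails as keys those of the in-tree.\<close>

definition mark_tree :: "nat \<Rightarrow> aexp \<Rightarrow> aexp \<Rightarrow> com" where
  "mark_tree seen key tight =
     For 10 edge_count
       (Cond (Mul tight (Equal (Load seen key) (Const 0)))
         (Seq (Store 8 (var 10) (Const 1)) (Store seen key (Const 1)))
         Skip)"

definition tight_edge :: aexp where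
  "tight_edge =
     Mul (Load 8 (var 11)) (Mul (Equal (tail_of (var 11)) (var 18))
       (Equal (Load 9 (pair_index (var 18) (var 12)))
         (Add (Load 9 (pair_index (head_of (var 11)) (var 12))) (Const 1))))"

definition follow_edge :: com where
  "follow_edge =
     Cond tight_edge
       (Seq (Store 1 (Add (Mul (var 10) edge_count) (var 11)) (Const 1))
         (Seq (assign 18 (head_of (var 11))) (assign 11 (Const 0))))
       (assign 11 (Add (var 11) (Const 1)))"

definition route :: com where
  "route =
     Seq (assign 11 (Const 0))
       (While (Mul (Sub (Const 1) (Equal (var 18) (var 12))) (Sub edge_count (var 11)))
         follow_edge)"

definition route_pair :: com where
  "route_pair =
     Seq (assign 17 (Add (var 17) (Load 9 (var 10))))
       (Seq (assign 18 (Div (var 10) vertex_count))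
         (Seq (assign 12 (Sub (var 10) (Mul (var 18) vertex_count))) route))"

definition route_all :: com where
  "route_all =
     Seq (assign 17 (Const 0))
       (For 10 (Mul vertex_count vertex_count)
         route_pair)"

context program_input
begin

text \<open>A sum rather than a maximum, so the chosen root is a median. Summed over all
  \<open>v\<close> it counts each distance twice, as the averaging demands.\<close>

definition eccentricity :: "(nat \<Rightarrow> nat) \<Rightarrow> nat \<Rightarrow> nat" where
  "eccentricity D v = (\<Sum>u<n. D (v * n + u) + D (u * n + v))"

lemma eccentricity_le:
  assumes "\<forall>i. D i \<le> q + 1" "k \<le> n"
  shows "(\<Sum>u<k. D (v * n + u) + D (u * n + v)) \<le> 2 * n * (q + 1)"
proof -
  have "(\<Sum>u<k. D (v * n + u) + D (u * n + v)) \<le> (\<Sum>u<k. 2 * (q + 1))"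
  proof (rule sum_mono)
    fix u
    show "D (v * n + u) + D (u * n + v) \<le> 2 * (q + 1)"
      using assms(1)[rule_format, of "v * n + u"] assms(1)[rule_format, of "u * n + v"] by simp
  qed
  also have "\<dots> = k * (2 * (q + 1))" by simp
  also have "\<dots> \<le> n * (2 * (q + 1))" using assms(2) by (intro mult_le_mono1)
  finally show ?thesis by (simp add: algebra_simps)
qed

lemma log_cost_const: "log_cost 0 \<le> N" "log_cost (Suc 0) \<le> N"
  using size_bounds by (auto intro!: log_cost_leI)

lemma wp_select_root:
  assumes "s 0 = inp" "\<forall>i. s 7 i \<le> q + 1"
    and Q: "\<And>s'. frame {10, 11, 13, 14, 15} s s' \<Longrightarrow>
      0 < n \<longrightarrow> s' 14 0 < n \<and> (\<forall>v<n. eccentricity (s 7) (s' 14 0) \<le> eccentricity (s 7) v) \<Longrightarrow> Q s'"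
  shows "wp N select_root Q s"
proof -
  let ?F = "{10, 11, 13, 14, 15} :: nat set"
  let ?M = "2 * n * (q + 1) + 1"
  have M: "log_cost ?M \<le> N" using size_bounds by (intro log_cost_leI) simp
  have inp': "s' 0 = inp" "s' 7 = s 7" if "frame ?F s s'" for s'
    using that assms(1) frameD[OF that, of 0] frameD[OF that, of 7] by simp_all
  \<comment> \<open>Variable 13 holds either the initial value or the value attained at the stored
    root.\<close>
  let ?J = "\<lambda>i s'. frame ?F s s' \<and> (\<forall>v<i. s' 13 0 \<le> eccentricity (s 7) v) \<and>
      (s' 13 0 = ?M \<or> s' 14 0 < n \<and> s' 13 0 = eccentricity (s 7) (s' 14 0))"
  have "wp N (For 10 vertex_count
         try_root)
       Q (s(13 := (s 13)(0 := ?M)))"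
  proof (rule wp_For[where J = ?J and m = n])
    show "n < N" by (rule size_bounds)
    show "?J 0 ((s(13 := (s 13)(0 := ?M)))(10 := ((s(13 := (s 13)(0 := ?M))) 10)(0 := 0)))"
      by simp
  next
    fix s' assume J: "?J n s'"
    show "Q s'"
    proof (rule Q)
      show "0 < n \<longrightarrow> s' 14 0 < n \<and> (\<forall>v<n. eccentricity (s 7) (s' 14 0) \<le> eccentricity (s 7) v)"
      proof
        assume "0 < n"
        then have "s' 13 0 \<le> eccentricity (s 7) 0" using J by blast
        also have "\<dots> \<le> 2 * n * (q + 1)"
          unfolding eccentricity_def using assms(2) by (intro eccentricity_le) auto
        finally have "s' 13 0 \<noteq> ?M" by simp
        then show "s' 14 0 < n \<and> (\<forall>v<n. eccentricity (s 7) (s' 14 0) \<le> eccentricity (s 7) v)"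
          using J by auto
      qed
    qed (use J in blast)
  next
    fix i s' assume "?J i s'"
    then show "aval vertex_count s' = n" using inp'[of s'] by (simp add: inp)
  next
    fix i s' assume i: "i < n" and J: "?J i s'" "s' 10 0 = i"
    let ?K = "\<lambda>k s''. frame ?F s s'' \<and> s'' 10 0 = i \<and> s'' 13 = s' 13 \<and> s'' 14 = s' 14 \<and>
      s'' 15 0 = (\<Sum>u<k. s 7 (i * n + u) + s 7 (u * n + i))"
    have "wp N sum_distances
       (wp N better_root
         (\<lambda>s'. s' 10 0 = i \<and> ?J (Suc i) (s'(10 := (s' 10)(0 := Suc i))))) (s'(15 := (s' 15)(0 := 0)))"
    unfolding sum_distances_def
    proof (rule wp_For[where J = ?K and m = n])
      show "n < N" by (rule size_bounds)
      show "?K 0 ((s'(15 := (s' 15)(0 := 0)))(11 := ((s'(15 := (s' 15)(0 := 0))) 11)(0 := 0)))"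
        using J by simp
    next
      fix k s'' assume K: "?K n s''"
      then have ecc: "s'' 15 0 = eccentricity (s 7) i" by (simp add: eccentricity_def)
      have "s'' 15 0 \<le> 2 * n * (q + 1)"
        unfolding ecc eccentricity_def using assms(2) by (intro eccentricity_le) auto
      then have "s'' 15 0 < N" using size_bounds by linarith
      then have logs: "log_cost (eccentricity (s 7) i) \<le> N" "log_cost i \<le> N"
        using i size_bounds ecc by (auto intro!: log_cost_leI)
      show "wp N better_root
         (\<lambda>s'. s' 10 0 = i \<and> ?J (Suc i) (s'(10 := (s' 10)(0 := Suc i)))) s''"
        using J K logs i ecc by (fastforce simp: better_root_def less_Suc_eq)
    next
      fix k s'' assume "?K k s''"
      then show "aval vertex_count s'' = n" using inp'[of s''] by (simp add: inp)
    next
      fix k s'' assume k: "k < n" and K: "?K k s''" "s'' 11 0 = k"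
      have "(\<Sum>u<Suc k. s 7 (i * n + u) + s 7 (u * n + i)) \<le> 2 * n * (q + 1)"
        using assms(2) k by (intro eccentricity_le) auto
      then have "log_cost (\<Sum>u<Suc k. s 7 (i * n + u) + s 7 (u * n + i)) \<le> N"
        using size_bounds by (intro log_cost_leI) linarith
      then show "wp N (assign 15 (Add (var 15) (Add (Load 7 (pair_index (var 10) (var 11)))
                 (Load 7 (pair_index (var 11) (var 10))))))
         (\<lambda>s'. s' 11 0 = k \<and> ?K (Suc k) (s'(11 := (s' 11)(0 := Suc k)))) s''"
        using K inp'[of s''] by (simp add: inp)
    qed
    then show "wp N try_root
         (\<lambda>s'. s' 10 0 = i \<and> ?J (Suc i) (s'(10 := (s' 10)(0 := Suc i)))) s'"
      by (simp only: try_root_def wp.simps aval.simps log_cost_const simp_thms)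
  qed
  then show ?thesis using M assms(1) by (simp add: select_root_def inp)
qed

lemma sum_fun_upd_le:
  fixes m :: "nat \<Rightarrow> nat"
  assumes "i < k"
  shows "(\<Sum>l<k. (m(i := 1)) l) \<le> (\<Sum>l<k. m l) + 1" "m i = 0 \<Longrightarrow> (\<Sum>l<k. (m(i := 1)) l) = (\<Sum>l<k. m l) + 1"
proof -
  have "(\<Sum>l\<in>{..<k} - {i}. (m(i := 1)) l) = (\<Sum>l\<in>{..<k} - {i}. m l)" by (intro sum.cong) auto
  moreover have "i \<in> {..<k}" using assms by simp
  ultimately show "(\<Sum>l<k. (m(i := 1)) l) \<le> (\<Sum>l<k. m l) + 1"
    "m i = 0 \<Longrightarrow> (\<Sum>l<k. (m(i := 1)) l) = (\<Sum>l<k. m l) + 1"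
    by (simp_all only: sum.remove[OF finite_lessThan] fun_upd_same)
qed

text \<open>Each newly marked edge fills a fresh cell of \<open>seen\<close>, and the cell of
  \<open>r\<close> stays empty, whence at most \<open>n - 1\<close> new marks. Earlier marks are
  kept because both trees are collected in array 8.\<close>

lemma wp_mark_tree:
  assumes "s 0 = inp" "seen \<notin> {0, 8, 10}" "\<And>v. s seen v = 0" "\<And>l. s 8 l \<le> 1"
    and tight: "\<And>s'. frame {8, 10, seen} s s' \<Longrightarrow> s' 10 0 < q \<Longrightarrow> aval tight s' = of_bool (C (s' 10 0))"
    and key: "\<And>s'. frame {8, 10, seen} s s' \<Longrightarrow> s' 10 0 < q \<Longrightarrow> aval key s' = k (s' 10 0)"
    and k: "\<And>l. l < q \<Longrightarrow> k l < n" "\<And>l. l < q \<Longrightarrow> C l \<Longrightarrow> k l \<noteq> r" "0 < q \<Longrightarrow> r < n"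
    and Q: "\<And>s'. frame {8, 10, seen} s s' \<Longrightarrow> \<forall>l. s 8 l \<le> s' 8 l \<and> s' 8 l \<le> 1 \<Longrightarrow>
      (\<Sum>l<q. s' 8 l) \<le> (\<Sum>l<q. s 8 l) + (n - 1) \<Longrightarrow>
      \<forall>l<q. C l \<longrightarrow> (\<exists>l'<q. s' 8 l' = 1 \<and> k l' = k l \<and> C l') \<Longrightarrow> Q s'"
  shows "wp N (mark_tree seen key tight) Q s"
proof -
  let ?F = "{8, 10, seen}"
  let ?J = "\<lambda>i s'. frame ?F s s' \<and> (\<forall>l. s 8 l \<le> s' 8 l \<and> s' 8 l \<le> 1) \<and>
    (\<Sum>l<q. s' 8 l) \<le> (\<Sum>l<q. s 8 l) + (\<Sum>v<n. s' seen v) \<and>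
    (\<forall>v. s' seen v \<le> 1) \<and> (0 < q \<longrightarrow> s' seen r = 0) \<and>
    (\<forall>l<i. C l \<longrightarrow> s' seen (k l) = 1) \<and>
    (\<forall>v. s' seen v = 1 \<longrightarrow> (\<exists>l'<q. s' 8 l' = 1 \<and> k l' = v \<and> C l'))"
  have seen: "seen \<noteq> 0" "seen \<noteq> 8" "seen \<noteq> 10" using assms(2) by auto
  have inp': "s' 0 = inp" if "frame ?F s s'" for s'
    using that assms(1,2) frameD[OF that, of 0] by simp
  show ?thesis
    unfolding mark_tree_def
  proof (rule wp_For[where J = ?J and m = q])
    show "q < N" using size_bounds by simp
    show "?J 0 (s(10 := (s 10)(0 := 0)))" using assms(3,4) seen by simp
  next
    fix i s' assume "?J i s'"
    then show "aval edge_count s' = q" using inp'[of s'] by (simp add: inp)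
  next
    fix s' assume J: "?J q s'"
    have "(\<Sum>v<n. s' seen v) \<le> n - 1" if "0 < q"
    proof -
      have "(\<Sum>v<n. s' seen v) = (\<Sum>v\<in>{..<n} - {r}. s' seen v)"
        using J k(3) that by (simp add: sum.remove[of "{..<n}" r])
      also have "\<dots> \<le> (\<Sum>v\<in>{..<n} - {r}. 1)" using J by (intro sum_mono) blast
      also have "\<dots> = n - 1" using k(3) that by simp
      finally show ?thesis .
    qed
    then have sum: "(\<Sum>l<q. s' 8 l) \<le> (\<Sum>l<q. s 8 l) + (n - 1)"
      using J by (cases "0 < q") fastforce+
    show "Q s'"
    proof (rule Q)
      show "\<forall>l<q. C l \<longrightarrow> (\<exists>l'<q. s' 8 l' = 1 \<and> k l' = k l \<and> C l')"
        using J by blast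
    qed (use J sum in blast)+
  next
    fix i s' assume i: "i < q" and J: "?J i s'" "s' 10 0 = i"
    then have eqs: "aval tight s' = of_bool (C i)" "aval key s' = k i" using tight[of s'] key[of s'] by auto
    let ?s = "s'(8 := (s' 8)(i := 1))"
    have key': "aval key ?s = k i" using key[of ?s] J i by simp
    show "wp N (Cond (Mul tight (Equal (Load seen key) (Const 0)))
         (Seq (Store 8 (var 10) (Const 1)) (Store seen key (Const 1))) Skip)
       (\<lambda>s'. s' 10 0 = i \<and> ?J (Suc i) (s'(10 := (s' 10)(0 := Suc i)))) s'"
    proof (cases "C i \<and> s' seen (k i) = 0")
      case True
      let ?t = "s'(8 := (s' 8)(i := 1), seen := (s' seen)(k i := 1), 10 := (s' 10)(0 := Suc i))"
      have "?J (Suc i) ?t"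
      proof (intro conjI)
        have "(\<Sum>l<q. ((s' 8)(i := 1)) l) \<le> (\<Sum>l<q. s' 8 l) + 1"
          using i by (rule sum_fun_upd_le)
        moreover have "(\<Sum>v<n. ((s' seen)(k i := 1)) v) = (\<Sum>v<n. s' seen v) + 1"
          using True k(1)[OF i] by (intro sum_fun_upd_le(2)) auto
        ultimately show "(\<Sum>l<q. ?t 8 l) \<le> (\<Sum>l<q. s 8 l) + (\<Sum>v<n. ?t seen v)"
          using J seen by simp
      next
        show "\<forall>v. ?t seen v = 1 \<longrightarrow> (\<exists>l'<q. ?t 8 l' = 1 \<and> k l' = v \<and> C l')"
        proof (intro allI impI)
          fix v assume v: "?t seen v = 1"
          show "\<exists>l'<q. ?t 8 l' = 1 \<and> k l' = v \<and> C l'"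
          proof (cases "v = k i")
            case True
            then show ?thesis using i \<open>C i \<and> _\<close> seen by (intro exI[of _ i]) simp
          next
            case False
            then have "s' seen v = 1" using v seen by simp
            then obtain l' where "l' < q" "s' 8 l' = 1" "k l' = v" "C l'" using J by blast
            then show ?thesis using seen by (intro exI[of _ l']) simp
          qed
        qed
      qed (use J seen i k(2)[OF i] True assms(4) in \<open>auto simp: less_Suc_eq\<close>)
      then show ?thesis
        using True eqs key' J seen log_cost_const by simp
    next
      case False
      then have "C i \<longrightarrow> s' seen (k i) = 1" using J by (metis One_nat_def le_SucE le_zero_eq)
      then show ?thesis
        using False eqs J seen by (auto simp: less_Suc_eq)
    qed
  qed
qed

end

section \<open>Correctness of the routing\<close>

context program_input
begin

text \<open>The invariant of the routing: \<open>f\<close> is the part built so far of a route from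
  \<open>i\<close> towards \<open>t\<close>, which has arrived at \<open>x\<close>. The bounds on
  distances confine the used edges to the stretch between \<open>i\<close> and \<open>x\<close>, so
  no edge is used twice and the source is not entered again.\<close>

definition path_to :: "nat \<Rightarrow> nat \<Rightarrow> (nat \<Rightarrow> bool) \<Rightarrow> (nat \<Rightarrow> nat) \<Rightarrow> nat \<Rightarrow> (nat \<Rightarrow> nat) \<Rightarrow> bool" where
  "path_to i t M D x f \<longleftrightarrow> x < n \<and>
     (\<forall>l<q. f l \<le> 1 \<and> (f l = 1 \<longrightarrow> M l \<and> D (tl l * n + t) = D (hd l * n + t) + 1 \<and>
        D (tl l * n + t) \<le> D (i * n + t) \<and> D (x * n + t) \<le> D (hd l * n + t))) \<and>
     (\<forall>v. (\<Sum>l | l < q \<and> hd l = v. f l) + of_bool (v = i) = (\<Sum>l | l < q \<and> tl l = v. f l) + of_bool (v = x)) \<and>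
     (\<Sum>l<q. f l) + D (x * n + t) = D (i * n + t)"

lemma path_to_start: "i < n \<Longrightarrow> path_to i t M D i (\<lambda>l. 0)"
  by (simp add: path_to_def)

lemma path_to_step:
  assumes P: "path_to i t M D x f" and l: "l < q" "M l" "tl l = x"
    and D: "D (x * n + t) = D (hd l * n + t) + 1"
  shows "path_to i t M D (hd l) (f(l := 1))"
proof -
  \<comment> \<open>Used edges end at least as far from \<open>t\<close> as \<open>x\<close>,
    whereas \<open>l\<close> ends closer.\<close>
  have fl: "f l = 0"
  proof (rule ccontr)
    assume "f l \<noteq> 0"
    then have "f l = 1" using P l(1) by (auto simp: path_to_def le_Suc_eq)
    then have "D (x * n + t) \<le> D (hd l * n + t)" using P l(1) by (simp add: path_to_def)
    then show False using D by simp
  qed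
  have upd: "sum (f(l := 1)) {l'. l' < q \<and> h l' = v} = sum f {l'. l' < q \<and> h l' = v} + of_bool (v = h l)"
    for h :: "nat \<Rightarrow> nat" and v
  proof (cases "v = h l")
    case True
    have "sum (f(l := 1)) ({l'. l' < q \<and> h l' = v} - {l}) = sum f ({l'. l' < q \<and> h l' = v} - {l})"
      by (intro sum.cong) auto
    then show ?thesis
      using True l(1) fl by (simp add: sum.remove[of _ l])
  next
    case False
    then show ?thesis by (simp, intro sum.cong) auto
  qed
  have tot: "(\<Sum>l'<q. (f(l := 1)) l') = (\<Sum>l'<q. f l') + 1"
    using l(1) fl by (rule sum_fun_upd_le)
  have xi: "D (x * n + t) \<le> D (i * n + t)"
    using P by (auto simp: path_to_def)
  show ?thesis
    unfolding path_to_def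
  proof (intro conjI allI impI)
    show "hd l < n" using ends l by simp
  next
    fix l' assume l': "l' < q"
    show "(f(l := 1)) l' \<le> 1" using P l' by (simp add: path_to_def)
    assume f: "(f(l := 1)) l' = 1"
    show "M l'" "D (tl l' * n + t) = D (hd l' * n + t) + 1" "D (tl l' * n + t) \<le> D (i * n + t)"
      using P l l' f D xi by (auto simp: path_to_def split: if_splits)
    show "D (hd l * n + t) \<le> D (hd l' * n + t)"
    proof (cases "l' = l")
      case False
      then have "D (x * n + t) \<le> D (hd l' * n + t)" using P l' f by (simp add: path_to_def)
      then show ?thesis using D by simp
    qed simp
  next
    fix v
    have "(\<Sum>l | l < q \<and> hd l = v. f l) + of_bool (v = i) = (\<Sum>l | l < q \<and> tl l = v. f l) + of_bool (v = x)"
      using P by (simp add: path_to_def)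
    then show "sum (f(l := 1)) {l'. l' < q \<and> hd l' = v} + of_bool (v = i)
        = sum (f(l := 1)) {l'. l' < q \<and> tl l' = v} + of_bool (v = hd l)"
      unfolding upd l(3) by simp
  next
    show "(\<Sum>l'<q. (f(l := 1)) l') + D (hd l * n + t) = D (i * n + t)"
      using P D tot by (simp add: path_to_def)
  qed
qed

lemma path_to_cong:
  assumes "\<And>l. l < q \<Longrightarrow> f l = g l"
  shows "path_to i t M D x f \<longleftrightarrow> path_to i t M D x g"
proof -
  have "sum f {l. l < q \<and> h l = v} = sum g {l. l < q \<and> h l = v}" for h :: "nat \<Rightarrow> nat" and v
    using assms by (intro sum.cong) auto
  moreover have "(\<Sum>l<q. f l) = (\<Sum>l<q. g l)" using assms by (intro sum.cong) auto
  ultimately show ?thesis using assms by (simp add: path_to_def)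
qed

text \<open>Unreachable targets may occur, as no solution is assumed to exist. For them the scan
  simply runs out of edges, and only the untouched ranges of array 1 are claimed.\<close>

lemma wp_route:
  assumes "s 0 = inp" "s 10 0 = p" "s 18 0 = i" "s 12 0 = t" "i < n" "t < n"
    and marked: "\<And>l. s 8 l = of_bool (M l)" and D: "is_dist M (s 9)"
    and zero: "\<And>j. p * q \<le> j \<Longrightarrow> s 1 j = 0"
    and Q: "\<And>s'. frame {1, 11, 18} s s' \<Longrightarrow> \<forall>j<p * q. s' 1 j = s 1 j \<Longrightarrow>
      \<forall>j\<ge>Suc p * q. s' 1 j = 0 \<Longrightarrow>
      s 9 (i * n + t) \<le> q \<longrightarrow> path_to i t M (s 9) t (\<lambda>l. s' 1 (p * q + l)) \<Longrightarrow> Q s'"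
  shows "wp N route Q s"
proof -
  let ?F = "{1, 11, 18} :: nat set"
  let ?D = "s 9"
  define adm where "adm x l \<longleftrightarrow> M l \<and> tl l = x \<and> ?D (x * n + t) = ?D (hd l * n + t) + 1" for x l
  let ?I = "\<lambda>s'. frame ?F s s' \<and> (\<forall>j<p * q. s' 1 j = s 1 j) \<and> (\<forall>j\<ge>Suc p * q. s' 1 j = 0) \<and>
    path_to i t M ?D (s' 18 0) (\<lambda>l. s' 1 (p * q + l)) \<and> s' 11 0 \<le> q \<and> (\<forall>l<s' 11 0. \<not> adm (s' 18 0) l)"
  have upper: "?D j \<le> q + 1" for j using D by (simp add: is_dist_def upper_dist_def)
  have same: "s' 0 = inp" "s' 8 = s 8" "s' 9 = s 9" "s' 10 0 = p" "s' 12 0 = t" if "frame ?F s s'" for s'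
    using that assms frameD[OF that, of 0] frameD[OF that, of 8] frameD[OF that, of 9]
      frameD[OF that, of 10] frameD[OF that, of 12] by simp_all
  
  have "wp N (While (Mul (Sub (Const 1) (Equal (var 18) (var 12))) (Sub edge_count (var 11)))
         follow_edge) Q (s(11 := (s 11)(0 := 0)))"
  \<comment> \<open>Lexicographic again: a step along an edge lowers the remaining distance and
    resets the scan of the edges.\<close>
  proof (rule wp_while[where I = ?I and \<mu> = "\<lambda>s'. ?D (s' 18 0 * n + t) * (q + 1) + (q - s' 11 0)"])
    have "path_to i t M ?D i (\<lambda>l. s 1 (p * q + l))"
      using path_to_start[OF assms(5)] zero by simp
    then show "?I (s(11 := (s 11)(0 := 0)))" using assms by simp
    have "?D (i * n + t) * (q + 1) + q \<le> (q + 1) * (q + 1) + q"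
      using mult_le_mono1[OF upper, of "i * n + t" "q + 1"] by simp
    also have "\<dots> \<le> (n + 2) ^ 3 * (q + 2) ^ 2"
      by (simp add: power3_eq_cube power2_eq_square algebra_simps)
    finally show "?D ((s(11 := (s 11)(0 := 0))) 18 0 * n + t) * (q + 1) + (q - (s(11 := (s 11)(0 := 0))) 11 0) \<le> N"
      using N_large assms(3) by simp
  next
    fix s' assume I: "?I s'" and "aval (Mul (Sub (Const 1) (Equal (var 18) (var 12))) (Sub edge_count (var 11))) s' = 0"
    with same[of s'] have exit: "s' 18 0 = t \<or> s' 11 0 = q"
      by (cases "s' 18 0 = t") (auto simp: inp)
    let ?x = "s' 18 0"
    have P: "path_to i t M ?D ?x (\<lambda>l. s' 1 (p * q + l))" using I by blast
    \<comment> \<open>If the scan ran out elsewhere, no tight marked edge would leave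
      \<open>?x\<close>, although \<open>is_dist\<close> provides one for every finite distance to
      another vertex.\<close>
    have "?x = t" if le: "?D (i * n + t) \<le> q"
    proof (rule ccontr)
      assume ne: "?x \<noteq> t"
      then have none: "\<forall>l<q. \<not> adm ?x l" using exit I by simp
      have x: "?x < n" "?D (?x * n + t) \<le> q" using P le by (auto simp: path_to_def)
      then obtain l where l: "l < q" "M l" "tl l = ?x" "?D (hd l * n + t) + 1 \<le> ?D (?x * n + t)"
        using D ne \<open>t < n\<close> unfolding is_dist_def upper_dist_def by meson
      have "l * n + t < q * n" using l(1) \<open>t < n\<close> by (rule index_less)
      then have "relaxed M ?D (l * n + t)" using D by (simp add: is_dist_def)
      then have "?D (?x * n + t) \<le> ?D (hd l * n + t) + 1" using \<open>t < n\<close> l by (simp add: relaxed_def)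
      then have "adm ?x l" using l by (simp add: adm_def)
      then show False using none l(1) by blast
    qed
    then show "Q s'" using I P by (intro Q) auto
  next
    fix s' assume I: "?I s'" and "aval (Mul (Sub (Const 1) (Equal (var 18) (var 12))) (Sub edge_count (var 11))) s' \<noteq> 0"
    with same[of s'] have l: "s' 11 0 < q" by (auto simp: inp)
    let ?x = "s' 18 0" and ?l = "s' 11 0"
    have cond: "aval tight_edge s' = of_bool (adm ?x ?l)"
      using same[of s'] I l by (auto simp: tight_edge_def inp adm_def marked)
    have "hd ?l < N" using ends(2)[OF l] size_bounds by linarith
    then have logs: "log_cost (hd ?l) \<le> N" "log_cost (Suc ?l) \<le> N"
      using l size_bounds by (auto intro!: log_cost_leI)
    show "wp N follow_edge
         (\<lambda>s''. ?I s'' \<and> ?D (s'' 18 0 * n + t) * (q + 1) + (q - s'' 11 0) <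
           ?D (s' 18 0 * n + t) * (q + 1) + (q - s' 11 0)) s'"
    proof (cases "adm ?x ?l")
      case True
      let ?t = "s'(1 := (s' 1)(p * q + ?l := 1), 18 := (s' 18)(0 := hd ?l), 11 := (s' 11)(0 := 0))"
      have step: "path_to i t M ?D (hd ?l) ((\<lambda>l. s' 1 (p * q + l))(?l := 1))"
        using True I l by (intro path_to_step) (auto simp: adm_def)
      have path: "path_to i t M ?D (hd ?l) (\<lambda>l. ?t 1 (p * q + l))"
        by (rule iffD1[OF path_to_cong step]) simp
      have "Suc p * q > p * q + ?l" using l by simp
      then have I': "?I ?t" using I path l by auto
      have "Suc (?D (hd ?l * n + t)) * (q + 1) = ?D (?x * n + t) * (q + 1)"
        using True by (simp only: adm_def Suc_eq_plus1)
      then have "?D (hd ?l * n + t) * (q + 1) + q < ?D (?x * n + t) * (q + 1) + (q - ?l)"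
        by simp
      then have less: "?D (?t 18 0 * n + t) * (q + 1) + (q - ?t 11 0) < ?D (?x * n + t) * (q + 1) + (q - ?l)"
        by simp
      have body: "wp N (Seq (Store 1 (Add (Mul (var 10) edge_count) (var 11)) (Const 1))
             (Seq (assign 18 (head_of (var 11))) (assign 11 (Const 0)))) P s' \<longleftrightarrow> P ?t" for P
        using same[of s'] I l logs log_cost_const by (simp add: inp)
      have cond': "aval tight_edge s' \<noteq> 0" unfolding cond using True by simp
      show ?thesis unfolding follow_edge_def wp.simps(4) if_P[OF cond'] body by (rule conjI[OF I' less])
    next
      case False
      let ?t = "s'(11 := (s' 11)(0 := Suc ?l))"
      have body: "wp N (assign 11 (Add (var 11) (Const 1))) P s' \<longleftrightarrow> P ?t" for P
        using logs by simp
      have I': "?I ?t" using I l False by (auto simp: less_Suc_eq)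
      have less: "?D (?t 18 0 * n + t) * (q + 1) + (q - ?t 11 0) < ?D (?x * n + t) * (q + 1) + (q - ?l)"
        using l by simp
      have cond': "\<not> aval tight_edge s' \<noteq> 0" unfolding cond using False by simp
      show ?thesis unfolding follow_edge_def wp.simps(4) if_not_P[OF cond'] body by (rule conjI[OF I' less])
    qed
  qed
  then show ?thesis using log_cost_const by (simp add: route_def)
qed

lemma wp_route_all:
  assumes "s 0 = inp" and marked: "\<And>l. s 8 l = of_bool (M l)" and D: "is_dist M (s 9)"
    and zero: "\<And>j. s 1 j = 0"
    and Q: "\<And>s'. frame {1, 10, 11, 12, 17, 18} s s' \<Longrightarrow> s' 17 0 = (\<Sum>p<n * n. s 9 p) \<Longrightarrow>
      \<forall>i<n. \<forall>t<n. s 9 (i * n + t) \<le> q \<longrightarrow>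
        path_to i t M (s 9) t (\<lambda>l. s' 1 ((i * n + t) * q + l)) \<Longrightarrow> Q s'"
  shows "wp N route_all Q s"
proof -
  let ?F = "{1, 10, 11, 12, 17, 18} :: nat set"
  let ?ok = "\<lambda>s' p. s 9 p \<le> q \<longrightarrow> path_to (p div n) (p mod n) M (s 9) (p mod n) (\<lambda>l. s' (1::nat) (p * q + l))"
  let ?J = "\<lambda>k s'. frame ?F s s' \<and> s' 17 0 = (\<Sum>p<k. s 9 p) \<and> (\<forall>p<k. ?ok s' p) \<and> (\<forall>j\<ge>k * q. s' 1 j = 0)"
  have same: "s' 0 = inp" "s' 8 = s 8" "s' 9 = s 9" if "frame ?F s s'" for s'
    using that assms frameD[OF that, of 0] frameD[OF that, of 8] frameD[OF that, of 9] by simp_all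
  have "wp N (For 10 (Mul vertex_count vertex_count)
         route_pair)
      Q (s(17 := (s 17)(0 := 0)))"
  proof (rule wp_For[where J = ?J and m = "n * n"])
    show "n * n < N" by (rule size_bounds)
    show "?J 0 ((s(17 := (s 17)(0 := 0)))(10 := ((s(17 := (s 17)(0 := 0))) 10)(0 := 0)))"
      using zero by simp
  next
    fix i s' assume "?J i s'"
    then show "aval (Mul vertex_count vertex_count) s' = n * n" using same[of s'] by (simp add: inp)
  next
    fix s' assume J: "?J (n * n) s'"
    show "Q s'"
    proof (rule Q)
      show "\<forall>i<n. \<forall>t<n. s 9 (i * n + t) \<le> q \<longrightarrow>
        path_to i t M (s 9) t (\<lambda>l. s' 1 ((i * n + t) * q + l))"
      proof (intro allI impI)
        fix i t assume it: "i < n" "t < n" "s 9 (i * n + t) \<le> q"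
        have "?ok s' (i * n + t)" using J index_less[OF it(1,2)] by blast
        then show "path_to i t M (s 9) t (\<lambda>l. s' 1 ((i * n + t) * q + l))"
          using it by simp
      qed
    qed (use J in blast)+
  next
    fix k s' assume k: "k < n * n" and J: "?J k s'" "s' 10 0 = k"
    then have n: "0 < n" by (cases n) auto
    define i where "i = k div n"
    define t where "t = k mod n"
    have it: "i < n" "t < n" "k - i * n = t" "i * n + t = k"
      using k n by (auto simp: i_def t_def index_div_less minus_div_mult_eq_mod)
    let ?s = "s'(17 := (s' 17)(0 := \<Sum>p<Suc k. s 9 p), 18 := (s' 18)(0 := i), 12 := (s' 12)(0 := t))"
    have "(\<Sum>p<Suc k. s 9 p) \<le> (\<Sum>p<Suc k. q + 1)"
      using D by (intro sum_mono) (simp add: is_dist_def upper_dist_def)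
    then have "(\<Sum>p<Suc k. s 9 p) \<le> Suc k * (q + 1)" by simp
    also have "\<dots> \<le> n * n * (q + 1)" using k by (intro mult_le_mono1) simp
    finally have logs: "log_cost (\<Sum>p<Suc k. s 9 p) \<le> N" "log_cost i \<le> N" "log_cost t \<le> N"
      using size_bounds it by (auto intro!: log_cost_leI)
    have "wp N route (\<lambda>s'. s' 10 0 = k \<and> ?J (Suc k) (s'(10 := (s' 10)(0 := Suc k)))) ?s"
    proof (rule wp_route[where p = k and i = i and t = t and M = M])
      show "?s 0 = inp" "?s 8 l = of_bool (M l)" for l
        using same[of s'] J marked by simp_all
      show "is_dist M (?s 9)" using same[of s'] J D by simp
      show "\<And>j. k * q \<le> j \<Longrightarrow> ?s 1 j = 0" using J by simp
    next
      fix s'' assume fr: "frame {1, 11, 18} ?s s''" and below: "\<forall>j<k * q. s'' 1 j = ?s 1 j"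
        and above: "\<forall>j\<ge>Suc k * q. s'' 1 j = 0"
        and path: "?s 9 (i * n + t) \<le> q \<longrightarrow> path_to i t M (?s 9) t (\<lambda>l. s'' 1 (k * q + l))"
      let ?t = "s''(10 := (s'' 10)(0 := Suc k))"
      have "frame ?F s ?s" using J by simp
      then have frame: "frame ?F s ?t" using frame_trans[OF _ fr, of ?F s ?F] by simp
      have scalars: "s'' 10 0 = k" "s'' 17 0 = (\<Sum>p<Suc k. s 9 p)"
        using frameD[OF fr, of 10] frameD[OF fr, of 17] J by simp_all
      have "\<forall>p<Suc k. ?ok ?t p"
      proof (intro allI impI)
        fix p assume p: "p < Suc k" "s 9 p \<le> q"
        show "path_to (p div n) (p mod n) M (s 9) (p mod n) (\<lambda>l. ?t 1 (p * q + l))"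
        proof (cases "p = k")
          case True
          then show ?thesis using path p same[of s'] J it by (simp add: i_def[symmetric] t_def[symmetric])
        next
          case False
          then have "p < k" using p by simp
          then have old: "path_to (p div n) (p mod n) M (s 9) (p mod n) (\<lambda>l. s' 1 (p * q + l))"
            using J p by blast
          show ?thesis
          proof (rule iffD1[OF path_to_cong old])
            fix l assume "l < q"
            then have "p * q + l < k * q" using \<open>p < k\<close> by (intro index_less)
            then show "s' 1 (p * q + l) = ?t 1 (p * q + l)" using below by simp
          qed
        qed
      qed
      then show "s'' 10 0 = k \<and> ?J (Suc k) ?t" using frame scalars above by simp
    qed (use J it in simp_all)
    moreover note logs
    moreover have "s' 17 0 + s 9 k = (\<Sum>p<Suc k. s 9 p)" using J by simp
    ultimately show "wp N route_pair
         (\<lambda>s'. s' 10 0 = k \<and> ?J (Suc k) (s'(10 := (s' 10)(0 := Suc k)))) s'"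
      using same[of s'] J it by (simp add: route_pair_def inp i_def[symmetric] del: sum.lessThan_Suc)
  qed
  then show ?thesis using log_cost_const by (simp add: route_all_def)
qed

end

section \<open>The private share and the output arrays\<close>

text \<open>Index \<open>k\<close> of the rational parameters starts behind the graph and the demand.\<close>

abbreviation param :: "nat \<Rightarrow> aexp" where
  "param k \<equiv> Load 0 (Add (Add (Add (Const 3) (Mul (Const 3) edge_count))
    (Mul vertex_count vertex_count)) (Const k))"

text \<open>Parameters 2 and 3 form the fraction for \<open>\<tau>\<^sub>0\<close>, 10 and 11 that
  for \<open>\<tau>\<^sub>1\<close>. The truncated difference of the cross products is positive
  exactly when public transport is slower.\<close>

definition slowdown :: aexp where
  "slowdown = Sub (Mul (param 10) (param 3)) (Mul (param 2) (param 11))"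

text \<open>The private share of the flow, with all denominators cleared: with
  \<open>\<tau>\<^sub>i\<close>, \<open>\<eta>\<^sub>i\<close> and \<open>a\<close> replaced by fractions, the quotient is \<open>private_target a U / U\<close>.\<close>

definition share_num :: aexp where
  "share_num =
     Sub (Add (Mul (param 10) (Mul (var 17) (Mul (param 4) (Mul (param 3) (Mul (param 13) (param 20))))))
         (Mul (Const 2) (Mul (param 12) (Mul slowdown (Mul (param 5) (param 20))))))
       (Mul (Const 2) (Mul (param 19) (Mul (param 4) (Mul (param 3) (Mul (param 11) (param 13))))))"

definition share_den :: aexp where
  "share_den = Mul slowdown (Mul (param 4) (Mul (var 17) (Mul (param 13) (param 20))))"

text \<open>Parameter 18 is 0 if there is no time bound. The truncated subtraction in the numerator
  clips the share at 0; the inner condition holds iff the numerator is at least the denominator, and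
  clips it at 1.\<close>

definition compute_share :: com where
  "compute_share =
     Cond (Mul (param 18) slowdown)
       (Seq (assign 19 share_num)
         (Seq (assign 20 share_den)
           (Cond (Sub (Add (var 19) (Const 1)) (var 20))
             (Seq (assign 19 (Const 1)) (assign 20 (Const 1))) Skip)))
       (Seq (assign 19 (Const 0)) (assign 20 (Const 1)))"

definition fill_entry :: com where
  "fill_entry =
     Seq (Store 2 (var 10) (Const 1))
       (Seq (Store 4 (Mul (Const 2) (var 10)) (var 19))
         (Seq (Store 5 (Mul (Const 2) (var 10)) (var 20))
           (Seq (Store 4 (Add (Mul (Const 2) (var 10)) (Const 1)) (Sub (var 20) (var 19)))
             (Store 5 (Add (Mul (Const 2) (var 10)) (Const 1)) (var 20)))))"

definition fill_split :: com where
  "fill_split =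
     For 10 (Mul (Mul vertex_count vertex_count) edge_count)
       fill_entry"

text \<open>Equal numerator and denominator mean that all flow is private, and then no vehicles are
  placed.\<close>

definition fill_layout :: com where
  "fill_layout =
     For 10 edge_count
       (Store 3 (var 10) (Mul (Load 8 (var 10)) (Sub (Const 1) (Equal (var 19) (var 20)))))"

definition tight_from_root :: aexp where
  "tight_from_root = Equal (Load 7 (pair_index (var 14) (head_of (var 10))))
     (Add (Load 7 (pair_index (var 14) (tail_of (var 10)))) (Const 1))"

definition tight_to_root :: aexp where
  "tight_to_root = Equal (Load 7 (pair_index (tail_of (var 10)) (var 14)))
     (Add (Load 7 (pair_index (head_of (var 10)) (var 14))) (Const 1))"

definition msp_algorithm :: com where
  "msp_algorithm =
     Seq (init_distances 7) (Seq (relax_all 7 (Const 1)) (Seq select_root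
       (Seq (mark_tree 6 (head_of (var 10)) tight_from_root)
         (Seq (mark_tree 21 (tail_of (var 10)) tight_to_root)
           (Seq (init_distances 9) (Seq (relax_all 9 (Load 8 (var 11)))
             (Seq route_all (Seq compute_share (Seq fill_split fill_layout)))))))))"

definition share_pair :: "(nat \<Rightarrow> nat) \<Rightarrow> nat \<Rightarrow> nat \<times> nat" where
  "share_pair P U =
    (let \<Delta> = P 10 * P 3 - P 2 * P 11;
       x = P 10 * (U * (P 4 * (P 3 * (P 13 * P 20)))) + 2 * (P 12 * (\<Delta> * (P 5 * P 20)))
         - 2 * (P 19 * (P 4 * (P 3 * (P 11 * P 13))));
       y = \<Delta> * (P 4 * (U * (P 13 * P 20)))
     in if P 18 * \<Delta> = 0 then (0, 1) else if y \<le> x then (1, 1) else (x, y))"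

context program_input
begin

abbreviation P :: "nat \<Rightarrow> nat" where
  "P k \<equiv> inp (3 + 3 * q + n * n + k)"

lemma aval_param: "s 0 = inp \<Longrightarrow> aval (param k) s = P k"
  by (simp add: inp)

lemma wp_compute_share:
  assumes "s 0 = inp" and logs: "log_cost (aval share_num s) \<le> N" "log_cost (aval share_den s) \<le> N"
    and Q: "\<And>s'. frame {19, 20} s s' \<Longrightarrow> share_pair P (s 17 0) = (s' 19 0, s' 20 0) \<Longrightarrow>
      log_cost (s' 19 0) \<le> N \<and> log_cost (s' 20 0) \<le> N \<Longrightarrow> Q s'"
  shows "wp N compute_share Q s"
proof -
  define \<Delta> where "\<Delta> = P 10 * P 3 - P 2 * P 11"
  define x where "x = P 10 * (s 17 0 * (P 4 * (P 3 * (P 13 * P 20)))) + 2 * (P 12 * (\<Delta> * (P 5 * P 20)))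
         - 2 * (P 19 * (P 4 * (P 3 * (P 11 * P 13))))"
  define y where "y = \<Delta> * (P 4 * (s 17 0 * (P 13 * P 20)))"
  have pair: "share_pair P (s 17 0) =
      (if P 18 * \<Delta> = 0 then (0, 1) else if y \<le> x then (1, 1) else (x, y))"
    unfolding share_pair_def Let_def \<Delta>_def[symmetric] x_def[symmetric] y_def[symmetric] ..
  have \<Delta>: "aval slowdown s' = \<Delta>" if "s' 0 = inp" for s'
    using aval_param[where s = s', OF that] by (simp only: slowdown_def aval.simps \<Delta>_def)
  have x: "aval share_num s' = x" if "s' 0 = inp" "s' 17 0 = s 17 0" for s'
    using aval_param[where s = s', OF that(1)] \<Delta>[of s', OF that(1)] that(2) by (simp only: share_num_def aval.simps x_def)
  have y: "aval share_den s' = y" if "s' 0 = inp" "s' 17 0 = s 17 0" for s'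
    using aval_param[where s = s', OF that(1)] \<Delta>[of s', OF that(1)] that(2) by (simp only: share_den_def aval.simps y_def)
  have cond: "aval (Mul (param 18) slowdown) s = P 18 * \<Delta>"
    using aval_param[where s = s and k = 18, OF assms(1)] \<Delta>[of s, OF assms(1)] by (simp only: aval.simps)
  have logs': "log_cost x \<le> N" "log_cost y \<le> N" using logs x[of s, OF assms(1)] y[of s, OF assms(1)] by simp_all
  show ?thesis
  proof (cases "P 18 * \<Delta> = 0")
    case True
    then have cond': "\<not> aval (Mul (param 18) slowdown) s \<noteq> 0" using cond by simp
    show ?thesis
      unfolding compute_share_def wp.simps(4) if_not_P[OF cond']
      using log_cost_const True pair by (auto intro!: Q)
  next
    case False
    then have cond': "aval (Mul (param 18) slowdown) s \<noteq> 0" using cond by simp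
    have "aval share_num s = x" "aval share_den (s(19 := (s 19)(0 := x))) = y"
      using assms(1) by (auto intro!: x y)
    then show ?thesis
      unfolding compute_share_def wp.simps(4)[of _ "Mul (param 18) slowdown"] if_P[OF cond']
      using log_cost_const logs' False pair by (auto intro!: Q)
  qed
qed

lemma wp_fill_split:
  assumes "s 0 = inp" "log_cost (s 19 0) \<le> N" "log_cost (s 20 0) \<le> N"
    and Q: "\<And>s'. frame {2, 4, 5, 10} s s' \<Longrightarrow> \<forall>p<n * n * q. s' 2 p = 1 \<and>
      s' 4 (2 * p) = s 19 0 \<and> s' 5 (2 * p) = s 20 0 \<and>
      s' 4 (2 * p + 1) = s 20 0 - s 19 0 \<and> s' 5 (2 * p + 1) = s 20 0 \<Longrightarrow> Q s'"
  shows "wp N fill_split Q s"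
  unfolding fill_split_def
proof (rule wp_For[where m = "n * n * q" and J = "\<lambda>k s'. frame {2, 4, 5, 10} s s' \<and>
    (\<forall>p<k. s' 2 p = 1 \<and> s' 4 (2 * p) = s 19 0 \<and> s' 5 (2 * p) = s 20 0 \<and>
      s' 4 (2 * p + 1) = s 20 0 - s 19 0 \<and> s' 5 (2 * p + 1) = s 20 0)"])
  show "n * n * q < N" by (rule size_bounds)
next
  fix k s' assume k: "k < n * n * q"
    and J: "frame {2, 4, 5, 10} s s' \<and> (\<forall>p<k. s' 2 p = 1 \<and>
      s' 4 (2 * p) = s 19 0 \<and> s' 5 (2 * p) = s 20 0 \<and>
      s' 4 (2 * p + 1) = s 20 0 - s 19 0 \<and> s' 5 (2 * p + 1) = s 20 0)" "s' 10 0 = k"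
  have same: "s' 19 = s 19" "s' 20 = s 20" using J by (simp_all add: frame_def)
  have "log_cost (s 20 0 - s 19 0) \<le> N"
    using assms(3) log_cost_mono[of "s 20 0 - s 19 0" "s 20 0"] by simp
  moreover have "Suc (2 * p) \<noteq> 2 * k" "2 * p \<noteq> Suc (2 * k)" for p :: nat by presburger+
  ultimately show "wp N fill_entry
      (\<lambda>s'. s' 10 0 = k \<and> frame {2, 4, 5, 10} s (s'(10 := (s' 10)(0 := Suc k))) \<and>
        (\<forall>p<Suc k. (s'(10 := (s' 10)(0 := Suc k))) 2 p = 1 \<and>
          (s'(10 := (s' 10)(0 := Suc k))) 4 (2 * p) = s 19 0 \<and>
          (s'(10 := (s' 10)(0 := Suc k))) 5 (2 * p) = s 20 0 \<and>
          (s'(10 := (s' 10)(0 := Suc k))) 4 (2 * p + 1) = s 20 0 - s 19 0 \<and>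
          (s'(10 := (s' 10)(0 := Suc k))) 5 (2 * p + 1) = s 20 0)) s'"
    using J same log_cost_const assms(2,3) by (simp add: fill_entry_def less_Suc_eq)
next
  fix k s' assume "frame {2, 4, 5, 10} s s' \<and> (\<forall>p<k. s' 2 p = 1 \<and>
      s' 4 (2 * p) = s 19 0 \<and> s' 5 (2 * p) = s 20 0 \<and>
      s' 4 (2 * p + 1) = s 20 0 - s 19 0 \<and> s' 5 (2 * p + 1) = s 20 0)"
  then have "s' 0 = inp" using assms(1) by (simp add: frame_def)
  then show "aval (Mul (Mul vertex_count vertex_count) edge_count) s' = n * n * q"
    by (simp add: inp)
qed (use Q in auto)

lemma wp_fill_layout:
  assumes "s 0 = inp" and marked: "\<And>l. s 8 l = of_bool (M l)"
    and Q: "\<And>s'. frame {3, 10} s s' \<Longrightarrow> \<forall>l<q. s' 3 l = of_bool (M l \<and> s 19 0 \<noteq> s 20 0) \<Longrightarrow> Q s'"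
  shows "wp N fill_layout Q s"
  unfolding fill_layout_def
proof (rule wp_For[where m = q and J = "\<lambda>k s'. frame {3, 10} s s' \<and>
    (\<forall>l<k. s' 3 l = of_bool (M l \<and> s 19 0 \<noteq> s 20 0))"])
  show "q < N" using size_bounds by simp
next
  fix k s' assume k: "k < q"
    and J: "frame {3, 10} s s' \<and> (\<forall>l<k. s' 3 l = of_bool (M l \<and> s 19 0 \<noteq> s 20 0))" "s' 10 0 = k"
  have same: "s' 19 = s 19" "s' 20 = s 20" "s' 8 = s 8" using J by (simp_all add: frame_def)
  then have val: "aval (Mul (Load 8 (var 10)) (Sub (Const 1) (Equal (var 19) (var 20)))) s'
      = of_bool (M k \<and> s 19 0 \<noteq> s 20 0)"
    using J marked by auto
  have "log_cost (of_bool (M k \<and> s 19 0 \<noteq> s 20 0)) \<le> N" using log_cost_const by simp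
  then show "wp N (Store 3 (var 10) (Mul (Load 8 (var 10)) (Sub (Const 1) (Equal (var 19) (var 20)))))
      (\<lambda>s'. s' 10 0 = k \<and> frame {3, 10} s (s'(10 := (s' 10)(0 := Suc k))) \<and>
        (\<forall>l<Suc k. (s'(10 := (s' 10)(0 := Suc k))) 3 l = of_bool (M l \<and> s 19 0 \<noteq> s 20 0))) s'"
    unfolding wp.simps val using J by (simp add: less_Suc_eq)
next
  fix k s' assume "frame {3, 10} s s' \<and> (\<forall>l<k. s' 3 l = of_bool (M l \<and> s 19 0 \<noteq> s 20 0))"
  then have "s' 0 = inp" using assms(1) by (simp add: frame_def)
  then show "aval edge_count s' = q" by (simp add: inp)
qed (use Q in auto)

text \<open>The trees are described locally, by tight edges, and without assuming that the root
  reaches everything. Walks are obtained later, by induction on the distance.\<close>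

definition spanning_trees :: "(nat \<Rightarrow> nat) \<Rightarrow> nat \<Rightarrow> (nat \<Rightarrow> bool) \<Rightarrow> bool" where
  "spanning_trees D r M \<longleftrightarrow>
     (\<Sum>l<q. of_bool (M l)) \<le> 2 * (n - 1) \<and>
     (\<forall>l<q. D (r * n + hd l) = D (r * n + tl l) + 1 \<longrightarrow>
       (\<exists>l'<q. M l' \<and> hd l' = hd l \<and> D (r * n + hd l') = D (r * n + tl l') + 1)) \<and>
     (\<forall>l<q. D (tl l * n + r) = D (hd l * n + r) + 1 \<longrightarrow>
       (\<exists>l'<q. M l' \<and> tl l' = tl l \<and> D (tl l' * n + r) = D (hd l' * n + r) + 1))"

text \<open>The facts about the final memory in terms of indices. They hold for inputs without
  solutions as well, since the run has to be analysed for these too.\<close>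

definition output_ok :: "store \<Rightarrow> bool" where
  "output_ok s \<longleftrightarrow> (\<exists>D r M D' x y.
     is_dist (\<lambda>_. True) D \<and>
     (0 < n \<longrightarrow> r < n \<and> (\<forall>v<n. eccentricity D r \<le> eccentricity D v)) \<and>
     spanning_trees D r M \<and> is_dist M D' \<and>
     (\<forall>i<n. \<forall>t<n. D' (i * n + t) \<le> q \<longrightarrow> path_to i t M D' t (\<lambda>l. s 1 ((i * n + t) * q + l))) \<and>
     share_pair P (\<Sum>p<n * n. D' p) = (x, y) \<and>
     (\<forall>p<n * n * q. s 2 p = 1 \<and> s 4 (2 * p) = x \<and> s 5 (2 * p) = y \<and>
        s 4 (2 * p + 1) = y - x \<and> s 5 (2 * p + 1) = y) \<and>
     (\<forall>l<q. s 3 l = of_bool (M l \<and> x \<noteq> y)))"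

lemma wp_mark_from_root:
  assumes "s 0 = inp" "is_dist (\<lambda>_. True) (s 7)" "0 < n \<longrightarrow> s 14 0 < n"
    "\<And>v. s 6 v = 0" "\<And>l. s 8 l = 0"
    and Q: "\<And>s'. frame {6, 8, 10} s s' \<Longrightarrow> \<forall>l. s' 8 l \<le> 1 \<Longrightarrow> (\<Sum>l<q. s' 8 l) \<le> n - 1 \<Longrightarrow>
      \<forall>l<q. s 7 (s 14 0 * n + hd l) = s 7 (s 14 0 * n + tl l) + 1 \<longrightarrow>
       (\<exists>l'<q. s' 8 l' = 1 \<and> hd l' = hd l \<and> s 7 (s 14 0 * n + hd l') = s 7 (s 14 0 * n + tl l') + 1) \<Longrightarrow> Q s'"
  shows "wp N (mark_tree 6 (head_of (var 10)) tight_from_root) Q s"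
proof (rule wp_mark_tree[where r = "s 14 0" and k = hd and
      C = "\<lambda>l. s 7 (s 14 0 * n + hd l) = s 7 (s 14 0 * n + tl l) + 1"])
  fix s' assume fr: "frame {8, 10, 6} s s'" and l: "s' 10 0 < q"
  have same: "s' 0 = inp" "s' 7 = s 7" "s' 14 = s 14" using fr assms(1) by (simp_all add: frame_def)
  show "aval tight_from_root s' = of_bool (s 7 (s 14 0 * n + hd (s' 10 0)) = s 7 (s 14 0 * n + tl (s' 10 0)) + 1)"
    using same l by (simp add: tight_from_root_def inp)
  show "aval (head_of (var 10)) s' = hd (s' 10 0)" using same l by (simp add: inp)
next
  fix l assume l: "l < q" "s 7 (s 14 0 * n + hd l) = s 7 (s 14 0 * n + tl l) + 1"
  have "s 7 (hd l * n + hd l) = 0"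
    using assms(2) ends(2)[OF l(1)] by (simp add: is_dist_def upper_dist_def)
  then show "hd l \<noteq> s 14 0" using l(2) by auto
next
  show "0 < q \<Longrightarrow> s 14 0 < n" using assms(3) ends(1)[of 0] by auto
next
  fix s' assume "frame {8, 10, 6} s s'" "\<forall>l. s 8 l \<le> s' 8 l \<and> s' 8 l \<le> 1"
    "(\<Sum>l<q. s' 8 l) \<le> (\<Sum>l<q. s 8 l) + (n - 1)"
    "\<forall>l<q. s 7 (s 14 0 * n + hd l) = s 7 (s 14 0 * n + tl l) + 1 \<longrightarrow>
       (\<exists>l'<q. s' 8 l' = 1 \<and> hd l' = hd l \<and> s 7 (s 14 0 * n + hd l') = s 7 (s 14 0 * n + tl l') + 1)"
  then show "Q s'" using assms(5) by (intro Q) (simp_all add: insert_commute)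
qed (use assms ends in auto)

lemma wp_mark_to_root:
  assumes "s 0 = inp" "is_dist (\<lambda>_. True) (s 7)" "0 < n \<longrightarrow> s 14 0 < n"
    "\<And>v. s 21 v = 0" "\<And>l. s 8 l \<le> 1"
    and Q: "\<And>s'. frame {8, 10, 21} s s' \<Longrightarrow> \<forall>l. s 8 l \<le> s' 8 l \<and> s' 8 l \<le> 1 \<Longrightarrow>
      (\<Sum>l<q. s' 8 l) \<le> (\<Sum>l<q. s 8 l) + (n - 1) \<Longrightarrow>
      \<forall>l<q. s 7 (tl l * n + s 14 0) = s 7 (hd l * n + s 14 0) + 1 \<longrightarrow>
       (\<exists>l'<q. s' 8 l' = 1 \<and> tl l' = tl l \<and> s 7 (tl l' * n + s 14 0) = s 7 (hd l' * n + s 14 0) + 1) \<Longrightarrow> Q s'"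
  shows "wp N (mark_tree 21 (tail_of (var 10)) tight_to_root) Q s"
proof (rule wp_mark_tree[where r = "s 14 0" and k = tl and
      C = "\<lambda>l. s 7 (tl l * n + s 14 0) = s 7 (hd l * n + s 14 0) + 1"])
  fix s' assume fr: "frame {8, 10, 21} s s'" and l: "s' 10 0 < q"
  have same: "s' 0 = inp" "s' 7 = s 7" "s' 14 = s 14" using fr assms(1) by (simp_all add: frame_def)
  show "aval tight_to_root s' = of_bool (s 7 (tl (s' 10 0) * n + s 14 0) = s 7 (hd (s' 10 0) * n + s 14 0) + 1)"
    using same l by (simp add: tight_to_root_def inp)
  show "aval (tail_of (var 10)) s' = tl (s' 10 0)" using same l by (simp add: inp)
next
  fix l assume l: "l < q" "s 7 (tl l * n + s 14 0) = s 7 (hd l * n + s 14 0) + 1"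
  have "s 7 (tl l * n + tl l) = 0"
    using assms(2) ends(1)[OF l(1)] by (simp add: is_dist_def upper_dist_def)
  then show "tl l \<noteq> s 14 0" using l(2) by auto
next
  show "0 < q \<Longrightarrow> s 14 0 < n" using assms(3) ends(1)[of 0] by auto
qed (use assms ends in auto)

text \<open>The share is a quotient of long products, so \<open>N\<close> has to exceed the bound
  \<open>K\<close> on the numbers in them by the size of the expressions.\<close>

lemma log_cost_share:
  assumes "s 0 = inp" "\<And>i. log_cost (inp i) \<le> K" "log_cost (s 17 0) \<le> K"
    "expr_size share_num * K \<le> N" "expr_size share_den * K \<le> N"
  shows "log_cost (aval share_num s) \<le> N" "log_cost (aval share_den s) \<le> N"
proof -
  \<comment> \<open>This store agrees with \<open>s\<close> on all cells that the two expressions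
    read, and all of its cells are bounded by \<open>K\<close>.\<close>
  let ?s = "\<lambda>a i. if a = 0 then inp i else s 17 0"
  have "cells_bounded K ?s" using assms(2,3) by (simp add: cells_bounded_def)
  then have "log_cost (aval share_num ?s) \<le> expr_size share_num * K"
    "log_cost (aval share_den ?s) \<le> expr_size share_den * K"
    by (rule log_cost_aval)+
  moreover have "aval share_num ?s = aval share_num s" "aval share_den ?s = aval share_den s"
    using assms(1) by (simp_all add: share_num_def share_den_def slowdown_def)
  ultimately show "log_cost (aval share_num s) \<le> N" "log_cost (aval share_den s) \<le> N"
    using assms(4,5) by (simp_all add: order_trans)
qed

lemma wp_msp_algorithm:
  assumes s: "s 0 = inp" "\<And>a i. a \<noteq> 0 \<Longrightarrow> s a i = 0"
    and K: "\<And>i. log_cost (inp i) \<le> K" "n * n * (q + 1) < K"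
      "expr_size share_num * K \<le> N" "expr_size share_den * K \<le> N"
  shows "wp N msp_algorithm output_ok s"
proof -
  let ?Q8 = "wp N fill_layout output_ok"
  let ?Q7 = "wp N fill_split ?Q8"
  let ?Q6 = "wp N compute_share ?Q7"
  let ?Q5 = "wp N route_all ?Q6"
  let ?Q4 = "wp N (relax_all 9 (Load 8 (var 11))) ?Q5"
  let ?Q3 = "wp N (init_distances 9) ?Q4"
  let ?Q2 = "wp N (mark_tree 21 (tail_of (var 10)) tight_to_root) ?Q3"
  let ?Q1 = "wp N (mark_tree 6 (head_of (var 10)) tight_from_root) ?Q2"
  let ?Q0 = "wp N select_root ?Q1"
  show ?thesis
    unfolding msp_algorithm_def wp.simps
  proof (rule wp_init_distances[where M = "\<lambda>_. True"])
    fix s1 assume f1: "frame {7, 10} s s1" and D1: "upper_dist (\<lambda>_. True) (s1 7)"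
    have in1: "s1 0 = inp" using f1 s by (simp add: frame_def)
    show "wp N (relax_all 7 (Const 1)) ?Q0 s1"
    proof (rule wp_relax_all[where M = "\<lambda>_. True"])
      fix s2 assume f2: "frame {7, 10, 11, 12} s1 s2" and D2: "is_dist (\<lambda>_. True) (s2 7)"
      have in2: "s2 0 = inp" using f2 in1 by (simp add: frame_def)
      have upper: "\<forall>i. s2 7 i \<le> q + 1" using D2 by (simp add: is_dist_def upper_dist_def)
      show "?Q0 s2"
      proof (rule wp_select_root[where s = s2, OF in2 upper])
        fix s3 assume f3: "frame {10, 11, 13, 14, 15} s2 s3"
          and root: "0 < n \<longrightarrow> s3 14 0 < n \<and> (\<forall>v<n. eccentricity (s2 7) (s3 14 0) \<le> eccentricity (s2 7) v)"
        have in3: "s3 0 = inp" and D3: "s3 7 = s2 7" using f3 in2 by (simp_all add: frame_def)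
        have fresh3: "s3 a i = 0" if "a \<notin> {0, 7, 10, 11, 12, 13, 14, 15}" for a i
          using that f1 f2 f3 s(2) by (simp add: frame_def)
        show "?Q1 s3"
        proof (rule wp_mark_from_root[where s = s3, OF in3])
          fix s4 assume f4: "frame {6, 8, 10} s3 s4" and m4: "\<forall>l. s4 8 l \<le> 1" "(\<Sum>l<q. s4 8 l) \<le> n - 1"
            and out: "\<forall>l<q. s3 7 (s3 14 0 * n + hd l) = s3 7 (s3 14 0 * n + tl l) + 1 \<longrightarrow>
              (\<exists>l'<q. s4 8 l' = 1 \<and> hd l' = hd l \<and> s3 7 (s3 14 0 * n + hd l') = s3 7 (s3 14 0 * n + tl l') + 1)"
          have in4: "s4 0 = inp" and D4: "s4 7 = s2 7" and r4: "s4 14 0 = s3 14 0"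
            using f4 in3 D3 by (simp_all add: frame_def)
          have fresh4: "s4 a i = 0" if "a \<notin> {0, 6, 7, 8, 10, 11, 12, 13, 14, 15}" for a i
            using that f4 fresh3 by (simp add: frame_def)
          show "?Q2 s4"
          proof (rule wp_mark_to_root[where s = s4, OF in4])
            fix s5 assume f5: "frame {8, 10, 21} s4 s5" and m5: "\<forall>l. s4 8 l \<le> s5 8 l \<and> s5 8 l \<le> 1"
              "(\<Sum>l<q. s5 8 l) \<le> (\<Sum>l<q. s4 8 l) + (n - 1)"
              and into: "\<forall>l<q. s4 7 (tl l * n + s4 14 0) = s4 7 (hd l * n + s4 14 0) + 1 \<longrightarrow>
                (\<exists>l'<q. s5 8 l' = 1 \<and> tl l' = tl l \<and> s4 7 (tl l' * n + s4 14 0) = s4 7 (hd l' * n + s4 14 0) + 1)"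
            have in5: "s5 0 = inp" using f5 in4 by (simp add: frame_def)
            have fresh5: "s5 a i = 0" if "a \<notin> {0, 6, 7, 8, 10, 11, 12, 13, 14, 15, 21}" for a i
              using that f5 fresh4 by (simp add: frame_def)
            define M where "M l \<longleftrightarrow> s5 8 l = 1" for l
            have M: "s5 8 l = of_bool (M l)" for l
              using m5(1)[rule_format, of l] by (cases "s5 8 l") (auto simp: M_def)
            have trees: "spanning_trees (s2 7) (s3 14 0) M"
              unfolding spanning_trees_def
            proof (intro conjI allI impI)
              show "(\<Sum>l<q. of_bool (M l)) \<le> 2 * (n - 1)"
                using m4(2) m5(2) unfolding M[symmetric] by linarith
            next
              fix l assume "l < q" "s2 7 (s3 14 0 * n + hd l) = s2 7 (s3 14 0 * n + tl l) + 1"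
              then obtain l' where l': "l' < q" "s4 8 l' = 1" "hd l' = hd l"
                "s2 7 (s3 14 0 * n + hd l') = s2 7 (s3 14 0 * n + tl l') + 1"
                using out unfolding D3 by blast
              then have "M l'" using m5(1)[rule_format, of l'] by (simp add: M_def)
              then show "\<exists>l'<q. M l' \<and> hd l' = hd l \<and> s2 7 (s3 14 0 * n + hd l') = s2 7 (s3 14 0 * n + tl l') + 1"
                using l' by blast
            next
              fix l assume "l < q" "s2 7 (tl l * n + s3 14 0) = s2 7 (hd l * n + s3 14 0) + 1"
              then show "\<exists>l'<q. M l' \<and> tl l' = tl l \<and> s2 7 (tl l' * n + s3 14 0) = s2 7 (hd l' * n + s3 14 0) + 1"
                using into unfolding D4 r4 M_def by blast
            qed
            show "?Q3 s5"
            proof (rule wp_init_distances[where M = M and s = s5, OF in5])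
              fix s6 assume f6: "frame {9, 10} s5 s6" and D6: "upper_dist M (s6 9)"
              have in6: "s6 0 = inp" and M6: "s6 8 l = of_bool (M l)" for l
                using f6 in5 M by (simp_all add: frame_def)
              show "?Q4 s6"
              proof (rule wp_relax_all[where s = s6, OF in6 _ D6])
                fix s' assume "frame {9, 10, 11, 12} s6 s'"
                then show "aval (Load 8 (var 11)) s' = of_bool (M (s' 11 0))"
                  using M6 by (simp add: frame_def)
              next
                fix s7 assume f7: "frame {9, 10, 11, 12} s6 s7" and D7: "is_dist M (s7 9)"
                have in7: "s7 0 = inp" and M7: "s7 8 l = of_bool (M l)" for l
                  using f7 in6 M6 by (simp_all add: frame_def)
                have fresh7: "s7 1 j = 0" for j
                  using f6 f7 fresh5 by (simp add: frame_def)
                show "?Q5 s7"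
                proof (rule wp_route_all[where s = s7, OF in7 M7 D7 fresh7])
                  fix s8 assume f8: "frame {1, 10, 11, 12, 17, 18} s7 s8" and U: "s8 17 0 = (\<Sum>p<n * n. s7 9 p)"
                    and paths: "\<forall>i<n. \<forall>t<n. s7 9 (i * n + t) \<le> q \<longrightarrow>
                      path_to i t M (s7 9) t (\<lambda>l. s8 1 ((i * n + t) * q + l))"
                  have in8: "s8 0 = inp" and M8: "s8 8 l = of_bool (M l)" for l
                    using f8 in7 M7 by (simp_all add: frame_def)
                  have "s8 17 0 \<le> (\<Sum>p<n * n. q + 1)"
                    unfolding U using D7 by (intro sum_mono) (simp add: is_dist_def upper_dist_def)
                  then have "s8 17 0 < K" using K(2) by simp
                  then have "log_cost (s8 17 0) \<le> K" by (rule log_cost_leI)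
                  note logs = log_cost_share[where s = s8, OF in8 K(1) this K(3,4)]
                  show "?Q6 s8"
                  proof (rule wp_compute_share[where s = s8, OF in8 logs])
                    fix s9 assume f9: "frame {19, 20} s8 s9" and share: "share_pair P (s8 17 0) = (s9 19 0, s9 20 0)"
                      and logs: "log_cost (s9 19 0) \<le> N \<and> log_cost (s9 20 0) \<le> N"
                    have in9: "s9 0 = inp" and M9: "s9 8 l = of_bool (M l)" for l
                      using f9 in8 M8 by (simp_all add: frame_def)
                    show "?Q7 s9"
                    proof (rule wp_fill_split[where s = s9, OF in9])
                      fix s10 assume f10: "frame {2, 4, 5, 10} s9 s10"
                        and split: "\<forall>p<n * n * q. s10 2 p = 1 \<and>
                          s10 4 (2 * p) = s9 19 0 \<and> s10 5 (2 * p) = s9 20 0 \<and>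
                          s10 4 (2 * p + 1) = s9 20 0 - s9 19 0 \<and> s10 5 (2 * p + 1) = s9 20 0"
                      have in10: "s10 0 = inp" and M10: "s10 8 l = of_bool (M l)" for l
                        using f10 in9 M9 by (simp_all add: frame_def)
                      have share10: "s10 19 0 = s9 19 0" "s10 20 0 = s9 20 0"
                        using f10 by (simp_all add: frame_def)
                      show "?Q8 s10"
                      proof (rule wp_fill_layout[where s = s10, OF in10 M10])
                        fix s11 assume f11: "frame {3, 10} s10 s11"
                          and lay: "\<forall>l<q. s11 3 l = of_bool (M l \<and> s10 19 0 \<noteq> s10 20 0)"
                        have arrays: "s11 1 = s8 1" "s11 2 = s10 2" "s11 4 = s10 4" "s11 5 = s10 5"
                          using f9 f10 f11 by (simp_all add: frame_def)
                        show "output_ok s11"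
                          unfolding output_ok_def arrays
                          using D2 root trees D7 paths share split lay
                          unfolding U share10 by blast
                      qed
                    qed (use logs in auto)
                  qed
                qed
              qed simp
            qed (use fresh5 in simp_all)
          qed (use D2 D4 root r4 fresh4 m4 in auto)
        qed (use D2 D3 root fresh3 in auto)
      qed
    qed (use in1 D1 in auto)
  qed (use s in auto)
qed

end

section \<open>Correctness of the output\<close>

lemma sum_index: "(\<Sum>p<m * n. f p) = (\<Sum>i<m. \<Sum>t<n. f (i * n + t :: nat))"
proof -
  have "(\<Sum>p<m * n. f p) = (\<Sum>i<m. sum f {i * n..<i * n + n})"
    by (rule sum.nat_group[symmetric])
  also have "\<dots> = (\<Sum>i<m. \<Sum>t<n. f (i * n + t))"
    using sum.shift_bounds_nat_ivl[of f 0 "i * n" n for i]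
    by (simp add: lessThan_atLeast0 add.commute)
  finally show ?thesis .
qed

lemma sum_off_diagonal:
  fixes g :: "nat \<Rightarrow> nat"
  shows "(\<Sum>s<n. \<Sum>t\<in>{..<n} - {s}. g t) = (\<Sum>t<n. (n - 1) * g t)"
proof -
  have "(\<Sum>s<n. g s) + (\<Sum>s<n. \<Sum>t\<in>{..<n} - {s}. g t) = (\<Sum>s<n. \<Sum>t<n. g t)"
    unfolding sum.distrib[symmetric] by (intro sum.cong) (simp_all add: sum.remove[symmetric])
  also have "\<dots> = (\<Sum>s<n. g s) + (\<Sum>t<n. (n - 1) * g t)"
    by (cases n) (simp_all only: sum_distrib_left[symmetric] sum_constant card_lessThan, simp_all)
  finally show ?thesis by simp
qed

section \<open>Distances and the two trees\<close>

context program_input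
begin

definition arcs_of :: "(nat \<Rightarrow> bool) \<Rightarrow> (nat \<times> nat) set" where
  "arcs_of M = (\<lambda>l. (tl l, hd l)) ` {l. l < q \<and> M l}"

lemma arcs_ofI: "l < q \<Longrightarrow> M l \<Longrightarrow> (tl l, hd l) \<in> arcs_of M"
  by (auto simp: arcs_of_def)

lemma arcs_ofE:
  assumes "(x, y) \<in> arcs_of M"
  obtains l where "l < q" "M l" "tl l = x" "hd l = y"
  using assms by (auto simp: arcs_of_def)

lemma is_dist_relaxed:
  assumes "is_dist M D" "l < q" "M l" "t < n"
  shows "D (tl l * n + t) \<le> D (hd l * n + t) + 1"
proof -
  have "relaxed M D (l * n + t)"
    using assms index_less[of l q t n] by (simp add: is_dist_def)
  then show ?thesis using assms by (simp add: relaxed_def)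
qed

lemma is_dist_self: "is_dist M D \<Longrightarrow> t < n \<Longrightarrow> D (t * n + t) = 0"
  by (simp add: is_dist_def upper_dist_def)

lemma is_dist_le_walk:
  assumes D: "is_dist M D" and "(x, t) \<in> arcs_of M ^^ k" "t < n"
  shows "D (x * n + t) \<le> k"
  using assms(2)
proof (induction k arbitrary: x)
  case 0
  then show ?case using is_dist_self[OF D assms(3)] by simp
next
  case (Suc k)
  then obtain y where y: "(x, y) \<in> arcs_of M" "(y, t) \<in> arcs_of M ^^ k"
    by (meson relpow_Suc_D2)
  obtain l where l: "l < q" "M l" "tl l = x" "hd l = y" using y(1) by (rule arcs_ofE)
  have "D (x * n + t) \<le> D (y * n + t) + 1"
    using is_dist_relaxed[OF D l(1,2) assms(3)] l by simp
  then show ?case using Suc.IH[OF y(2)] by simp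
qed

lemma is_dist_first_edge:
  assumes D: "is_dist M D" and "x < n" "t < n" "x \<noteq> t" "D (x * n + t) \<le> q"
  obtains l where "l < q" "M l" "tl l = x" "D (x * n + t) = D (hd l * n + t) + 1"
proof -
  obtain l where l: "l < q" "M l" "tl l = x" "D (hd l * n + t) + 1 \<le> D (x * n + t)"
    using assms unfolding is_dist_def upper_dist_def by meson
  then show ?thesis using that[of l] is_dist_relaxed[OF D l(1,2) assms(3)] by simp
qed

lemma is_dist_walk:
  assumes D: "is_dist M D" and "x < n" "t < n" "D (x * n + t) \<le> q"
  shows "(x, t) \<in> arcs_of M ^^ D (x * n + t)"
  using assms(2,4)
proof (induction "D (x * n + t)" arbitrary: x rule: less_induct)
  case less
  show ?case
  proof (cases "x = t")
    case True
    then show ?thesis using is_dist_self[OF D assms(3)] by simp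
  next
    case False
    then obtain l where l: "l < q" "M l" "tl l = x" "D (x * n + t) = D (hd l * n + t) + 1"
      using is_dist_first_edge[OF D less.prems(1) assms(3) _ less.prems(2)] by blast
    have "(hd l, t) \<in> arcs_of M ^^ D (hd l * n + t)"
      using l less.prems ends(2)[OF l(1)] by (intro less.hyps) auto
    then show ?thesis using relpow_Suc_I2[OF arcs_ofI[of l M, OF l(1,2)]] l by simp
  qed
qed

text \<open>A reachable vertex is reached by a walk with at most as many steps as there are arcs, so
  the value for infinity does not occur.\<close>

lemma is_dist_reachable:
  assumes "is_dist M D" "(x, t) \<in> (arcs_of M)\<^sup>*" "t < n"
  shows "D (x * n + t) \<le> q"
proof -
  have fin: "finite (arcs_of M)" by (simp add: arcs_of_def)
  then obtain k where k: "k \<le> card (arcs_of M)" "(x, t) \<in> arcs_of M ^^ k"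
    using assms(2) unfolding rtrancl_finite_eq_relpow[OF fin] by auto
  have "card (arcs_of M) \<le> card {l. l < q \<and> M l}"
    unfolding arcs_of_def by (intro card_image_le) simp
  also have "\<dots> \<le> card {..<q}" by (intro card_mono) auto
  finally have "card (arcs_of M) \<le> q" by simp
  then show ?thesis using is_dist_le_walk[OF assms(1) k(2) assms(3)] k(1) by simp
qed

lemma is_dist_pos:
  assumes "is_dist M D" "x < n" "t < n" "x \<noteq> t"
  shows "1 \<le> D (x * n + t)"
proof (rule ccontr)
  assume "\<not> 1 \<le> D (x * n + t)"
  then have 0: "D (x * n + t) = 0" by simp
  then show False using is_dist_walk[OF assms(1-3)] assms(4) by simp
qed

context
  fixes D D' r M
  assumes D: "is_dist (\<lambda>_. True) D" and r: "r < n"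
    and center: "\<forall>v<n. eccentricity D r \<le> eccentricity D v"
    and trees: "spanning_trees D r M" and D': "is_dist M D'"
    and connected: "\<And>x y. x < n \<Longrightarrow> y < n \<Longrightarrow> (x, y) \<in> (arcs_of (\<lambda>_. True))\<^sup>*"
begin

lemma dist_finite: "x < n \<Longrightarrow> y < n \<Longrightarrow> D (x * n + y) \<le> q"
  using is_dist_reachable[OF D connected] .

text \<open>The last edge of a shortest walk from \<open>r\<close> is tight, and a marked tight edge
  with the same head starts one step closer to \<open>r\<close>. As \<open>is_dist\<close> describes
  distances by first edges, the last edge has to be extracted from a walk.\<close>

lemma tree_walk_from_root: "t < n \<Longrightarrow> (r, t) \<in> arcs_of M ^^ D (r * n + t)"
proof (induction "D (r * n + t)" arbitrary: t rule: less_induct)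
  case less
  show ?case
  proof (cases "t = r")
    case True
    then show ?thesis using is_dist_self[OF D r] by simp
  next
    case False
    have walk: "(r, t) \<in> arcs_of (\<lambda>_. True) ^^ D (r * n + t)"
      using is_dist_walk[OF D r less.prems dist_finite[OF r less.prems]] .
    have "D (r * n + t) \<noteq> 0" using is_dist_pos[OF D r less.prems] False by simp
    then obtain k where k: "D (r * n + t) = Suc k" using not0_implies_Suc by blast
    then obtain u where u: "(r, u) \<in> arcs_of (\<lambda>_. True) ^^ k" "(u, t) \<in> arcs_of (\<lambda>_. True)"
      using walk by (metis relpow_Suc_E)
    obtain l where l: "l < q" "tl l = u" "hd l = t" using u(2) by (rule arcs_ofE)
    have un: "u < n" using ends(1)[OF l(1)] l(2) by simp
    have "(r, t) \<in> arcs_of (\<lambda>_. True) ^^ Suc (D (r * n + u))"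
      using is_dist_walk[OF D r un dist_finite[OF r un]] u(2) by (rule relpow_Suc_I)
    then have "D (r * n + t) \<le> Suc (D (r * n + u))"
      using is_dist_le_walk[OF D _ less.prems] by blast
    moreover have "D (r * n + u) \<le> k" using is_dist_le_walk[OF D u(1) un] .
    ultimately have "D (r * n + hd l) = D (r * n + tl l) + 1" using k l by simp
    then obtain l' where l': "l' < q" "M l'" "hd l' = t" "D (r * n + t) = D (r * n + tl l') + 1"
      using trees l unfolding spanning_trees_def by metis
    have "(r, tl l') \<in> arcs_of M ^^ D (r * n + tl l')"
      using l' ends(1)[OF l'(1)] by (intro less.hyps) auto
    then show ?thesis using relpow_Suc_I[OF _ arcs_ofI[of l' M, OF l'(1,2)]] l' by simp
  qed
qed

lemma tree_walk_to_root: "s < n \<Longrightarrow> (s, r) \<in> arcs_of M ^^ D (s * n + r)"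
proof (induction "D (s * n + r)" arbitrary: s rule: less_induct)
  case less
  show ?case
  proof (cases "s = r")
    case True
    then show ?thesis using is_dist_self[OF D r] by simp
  next
    case False
    then obtain l where l: "l < q" "tl l = s" "D (s * n + r) = D (hd l * n + r) + 1"
      using is_dist_first_edge[OF D less.prems r _ dist_finite[OF less.prems r]] by blast
    then obtain l' where l': "l' < q" "M l'" "tl l' = s" "D (s * n + r) = D (hd l' * n + r) + 1"
      using trees unfolding spanning_trees_def by metis
    have "(hd l', r) \<in> arcs_of M ^^ D (hd l' * n + r)"
      using l' ends(2)[OF l'(1)] by (intro less.hyps) auto
    then show ?thesis using relpow_Suc_I2[OF arcs_ofI[of l' M, OF l'(1,2)]] l' by simp
  qed
qed

lemma tree_dist_le:
  assumes "s < n" "t < n"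
  shows "D' (s * n + t) \<le> D (s * n + r) + D (r * n + t)" "D' (s * n + t) \<le> q"
proof -
  have walk: "(s, t) \<in> arcs_of M ^^ (D (s * n + r) + D (r * n + t))"
    using tree_walk_to_root[OF assms(1)] tree_walk_from_root[OF assms(2)]
    by (auto simp: relpow_add)
  then show "D' (s * n + t) \<le> D (s * n + r) + D (r * n + t)"
    by (rule is_dist_le_walk[OF D' _ assms(2)])
  show "D' (s * n + t) \<le> q"
    using is_dist_reachable[OF D' relpow_imp_rtrancl[OF walk] assms(2)] .
qed

text \<open>On routes via \<open>r\<close>, each distance to or from \<open>r\<close> occurs in
  \<open>n - 1\<close> pairs, so \<open>U \<le> (n - 1) * eccentricity D r\<close>. As
  \<open>r\<close> is a minimiser and the eccentricities sum to \<open>2 * W\<close>, this gives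
  \<open>n * U \<le> (n - 1) * (2 * W)\<close>. Distances between different vertices are at least 1,
  so the missing \<open>2 * W\<close> is at least \<open>n * (2 * (n - 1))\<close>.\<close>

lemma sum_tree_dist_le: "(\<Sum>p<n * n. D' p) + 2 * (n - 1) \<le> 2 * (\<Sum>p<n * n. D p)"
proof -
  define W where "W = (\<Sum>p<n * n. D p)"
  define U where "U = (\<Sum>p<n * n. D' p)"
  have n: "0 < n" using r by simp
  have "U \<le> (n - 1) * eccentricity D r"
  proof -
    have "U = (\<Sum>s<n. \<Sum>t<n. D' (s * n + t))" unfolding U_def by (rule sum_index)
    also have "\<dots> = (\<Sum>s<n. \<Sum>t\<in>{..<n} - {s}. D' (s * n + t))"
    proof (rule sum.cong)
      fix s assume "s \<in> {..<n}"
      then show "(\<Sum>t<n. D' (s * n + t)) = (\<Sum>t\<in>{..<n} - {s}. D' (s * n + t))"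
        using sum.remove[of "{..<n}" s "\<lambda>t. D' (s * n + t)"] is_dist_self[OF D'] by simp
    qed simp
    also have "\<dots> \<le> (\<Sum>s<n. \<Sum>t\<in>{..<n} - {s}. D (s * n + r) + D (r * n + t))"
      using tree_dist_le(1) by (intro sum_mono) auto
    also have "\<dots> = (\<Sum>s<n. (n - 1) * D (s * n + r)) + (\<Sum>s<n. \<Sum>t\<in>{..<n} - {s}. D (r * n + t))"
      by (simp add: sum.distrib)
    also have "(\<Sum>s<n. \<Sum>t\<in>{..<n} - {s}. D (r * n + t)) = (\<Sum>t<n. (n - 1) * D (r * n + t))"
      by (rule sum_off_diagonal)
    also have "(\<Sum>s<n. (n - 1) * D (s * n + r)) + \<dots> = (n - 1) * eccentricity D r"
      by (simp add: eccentricity_def sum.distrib sum_distrib_left[symmetric] add.commute distrib_left)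
    finally show ?thesis .
  qed
  then have "n * U \<le> n * ((n - 1) * eccentricity D r)" by simp
  also have "\<dots> = (n - 1) * (\<Sum>v<n. eccentricity D r)" by simp
  also have "\<dots> \<le> (n - 1) * (\<Sum>v<n. eccentricity D v)"
    using center by (intro mult_le_mono2 sum_mono) auto
  also have "(\<Sum>v<n. eccentricity D v) = 2 * W"
  proof -
    have "(\<Sum>v<n. \<Sum>u<n. D (u * n + v)) = (\<Sum>u<n. \<Sum>v<n. D (u * n + v))" by (rule sum.swap)
    then show ?thesis by (simp add: eccentricity_def sum.distrib W_def sum_index)
  qed
  finally have nU: "n * U \<le> (n - 1) * (2 * W)" .
  have "n * (n - 1) = (\<Sum>s<n. \<Sum>t\<in>{..<n} - {s}. 1)" by simp
  also have "\<dots> \<le> (\<Sum>s<n. \<Sum>t\<in>{..<n} - {s}. D (s * n + t))"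
    using is_dist_pos[OF D] by (intro sum_mono) auto
  also have "\<dots> \<le> (\<Sum>s<n. \<Sum>t<n. D (s * n + t))"
    by (intro sum_mono sum_mono2) auto
  also have "\<dots> = W" unfolding W_def by (rule sum_index[symmetric])
  finally have W: "n * (n - 1) \<le> W" .
  have "n * (U + 2 * (n - 1)) \<le> (n - 1) * (2 * W) + 2 * W"
    using nU W by (simp add: distrib_left)
  also have "\<dots> = n * (2 * W)"
    using n by (cases n) (simp_all add: algebra_simps)
  finally show ?thesis using n by (simp add: U_def W_def)
qed

end

end

section \<open>Reading the input\<close>

lemma encode_rat_fraction:
  assumes "0 \<le> r"
  shows "\<exists>a b. encode_rat r = [a, b] \<and> 0 < b \<and> of_rat r = real a / real b"
proof -
  obtain p d where pd: "quotient_of r = (p, d)" by (cases "quotient_of r") auto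
  have d: "0 < d" using quotient_of_denom_pos[OF pd] .
  have r: "r = of_int p / of_int d" using quotient_of_div[OF pd] .
  then have p: "0 \<le> p" using assms d by (simp add: zero_le_divide_iff)
  have "(of_rat r :: real) = of_int p / of_int d" unfolding r by (simp add: of_rat_divide)
  then have "of_rat r = real (nat p) / real (nat d)" using p d by simp
  then show ?thesis using pd d by (simp add: encode_rat_def)
qed

lemma length_concat_map:
  assumes "\<And>x. length (f x) = k"
  shows "length (concat (map f xs)) = k * length xs"
  by (induction xs) (simp_all add: assms)

lemma nth_concat_map:
  assumes "\<And>x. length (f x) = k" "l < length xs" "j < k"
  shows "concat (map f xs) ! (k * l + j) = f (xs ! l) ! j"
  using assms(2)
proof (induction xs arbitrary: l)
  case (Cons x xs)
  then show ?case using assms(1,3) by (cases l) (simp_all add: nth_append)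
qed simp

lemma nth_position:
  assumes "x \<in> set xs"
  shows "position xs x < length xs" "xs ! position xs x = x"
  using assms by (induction xs) (auto simp: position_def)

lemma position_nth: "distinct xs \<Longrightarrow> i < length xs \<Longrightarrow> position xs (xs ! i) = i"
  using nth_position[of "xs ! i" xs] by (simp add: nth_eq_iff_index_eq)

text \<open>The power 5 collects \<open>(n + 2) ^ 3 * (q + 2) ^ 2\<close>, the factor allows for the
  length of the numbers in the share, and the summand 1 makes the bound strict.\<close>

definition resource_poly :: "nat poly" where
  "resource_poly = smult (expr_size share_num + expr_size share_den + 1) ([:2, 1:] ^ 5) + 1"

lemma poly_resource_poly:
  "poly resource_poly S = (expr_size share_num + expr_size share_den + 1) * (S + 2) ^ 5 + 1"
  by (simp add: resource_poly_def)

locale encoded_msp =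
  fixes I :: "'v msp" and vs :: "'v list" and es :: "('v \<times> 'v) list"
  assumes enumerates: "enumerates I vs es"
    and edges_within: "edges I \<subseteq> vertices I \<times> vertices I"
    and one_mode: "modes I = 1"
begin

definition n where "n = length vs"
definition q where "q = length es"
definition tl where "tl l = position vs (fst (es ! l))"
definition hd where "hd l = position vs (snd (es ! l))"
definition code where "code = encode_msp I vs es"
definition inp where "inp = input_store code 0"
definition size where "size = input_size code"

definition edge_part where
  "edge_part = concat (map (\<lambda>e. [position vs (fst e), position vs (snd e), weight I e]) es)"
definition demand_part where "demand_part = map (demand I) (List.product vs vs)"
text \<open>Two numbers per fraction: the budget at 0, mode 0 from 2 to 9, mode 1 from 10 to 17,
  each in the order travel time, energy, cost, capacity. The flag of the time bound is at 18, its
  fraction at 19 and 20.\<close>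

definition rational_part where
  "rational_part = encode_rat (budget I)
     @ encode_rat (travel_time I 0) @ encode_rat (msp.energy I 0)
     @ encode_rat (cost I 0) @ encode_rat (capacity I 0)
     @ encode_rat (travel_time I 1) @ encode_rat (msp.energy I 1)
     @ encode_rat (cost I 1) @ encode_rat (capacity I 1)
     @ (case time_bound I of None \<Rightarrow> [0] | Some a \<Rightarrow> 1 # encode_rat a)"

lemma code_eq: "code = [n, q, 1] @ edge_part @ demand_part @ rational_part"
  by (simp add: code_def encode_msp_def one_mode edge_part_def demand_part_def rational_part_def
      n_def q_def upt_rec)

lemma length_parts: "length edge_part = 3 * q" "length demand_part = n * n"
  by (simp_all add: edge_part_def length_concat_map demand_part_def n_def q_def)

lemma inp_eq: "inp i = (if i < length code then code ! i else 0)"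
  by (simp add: inp_def input_store_def)

lemma inp_rational: "inp (3 + 3 * q + n * n + k) = (if k < length rational_part then rational_part ! k else 0)"
proof -
  have "code ! (3 + 3 * q + n * n + k) = rational_part ! k"
    using length_parts by (simp add: code_eq nth_append)
  moreover have "length code = 3 + 3 * q + n * n + length rational_part"
    by (simp add: code_eq length_parts)
  ultimately show ?thesis by (simp add: inp_eq)
qed

lemma inp_edge:
  assumes "l < q" "j < 3"
  shows "inp (3 + 3 * l + j) = [tl l, hd l, weight I (es ! l)] ! j"
proof -
  have "edge_part ! (3 * l + j) = [tl l, hd l, weight I (es ! l)] ! j"
    unfolding edge_part_def tl_def hd_def using assms by (subst nth_concat_map) (auto simp: q_def)
  moreover have "3 * l + j < 3 * q" using assms by linarith
  then have "code ! (3 + 3 * l + j) = edge_part ! (3 * l + j)"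
    by (simp add: code_eq nth_append length_parts)
  moreover have "3 + 3 * l + j < length code"
    using \<open>3 * l + j < 3 * q\<close> by (simp add: code_eq length_parts)
  ultimately show ?thesis by (simp add: inp_eq)
qed

lemma edge_nth: "l < q \<Longrightarrow> es ! l \<in> edges I"
  using enumerates by (auto simp: enumerates_def q_def)

lemma vertex_position:
  assumes "v \<in> vertices I"
  shows "position vs v < n" "vs ! position vs v = v"
  using nth_position[of v vs] assms enumerates by (auto simp: enumerates_def n_def)

lemma ends_less:
  assumes "l < q"
  shows "tl l < n" "hd l < n"
  using edge_nth[OF assms] edges_within vertex_position(1)
  by (auto simp: tl_def hd_def)

lemma length_le_size: "length code \<le> size"
proof -
  have "length xs \<le> sum_list (map log_cost xs)" for xs
  proof (induction xs)
    case (Cons x xs)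
    then show ?case using log_cost_ge_1[of x] by simp
  qed simp
  then show ?thesis by (simp add: size_def input_size_def)
qed

lemma log_cost_inp: "log_cost (inp i) \<le> (size + 2) ^ 5"
proof -
  have "log_cost (inp i) \<le> size + 2"
  proof (cases "i < length code")
    case True
    then have "log_cost (code ! i) \<le> sum_list (map log_cost code)"
      by (intro member_le_sum_list) auto
    then show ?thesis using True by (simp add: inp_eq size_def input_size_def)
  next
    case False
    then show ?thesis by (simp add: inp_eq log_cost_def floorlog_def)
  qed
  also have "size + 2 \<le> (size + 2) ^ 5" using power_increasing[of 1 5 "size + 2"] by simp
  finally show ?thesis .
qed

lemma graph_le_size: "n \<le> size" "q \<le> size"
proof -
  have "3 + 3 * q + n * n \<le> length code" by (simp add: code_eq length_parts)
  moreover have "n \<le> n * n" by simp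
  ultimately show "n \<le> size" "q \<le> size" using length_le_size by linarith+
qed

sublocale program_input "poly resource_poly size" n q tl hd inp
proof
  show "inp 0 = n" "inp (Suc 0) = q" by (simp_all add: inp_eq code_eq)
  show "inp (3 + 3 * l) = tl l" "inp (4 + 3 * l) = hd l" if "l < q" for l
    using inp_edge[OF that, of 0] inp_edge[OF that, of 1] by simp_all
  show "tl l < n" "hd l < n" if "l < q" for l using ends_less[OF that] .
  have "(n + 2) ^ 3 * (q + 2) ^ 2 \<le> (size + 2) ^ 3 * (size + 2) ^ 2"
    using graph_le_size by (intro mult_le_mono power_mono) auto
  also have "\<dots> = (size + 2) ^ 5" by (simp flip: power_add)
  also have "\<dots> < poly resource_poly size"
    by (simp add: poly_resource_poly less_Suc_eq_le)
  finally show "(n + 2) ^ 3 * (q + 2) ^ 2 < poly resource_poly size" .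
qed

lemma execution:
  "\<exists>steps final. exec msp_algorithm (input_store code) steps final \<and>
     steps \<le> poly (pcompose (time_poly msp_algorithm) resource_poly) size \<and> output_ok final"
proof -
  let ?N = "poly resource_poly size" and ?K = "(size + 2) ^ 5"
  have K: "?K \<le> ?N" by (simp add: poly_resource_poly)
  have zero: "input_store code a i = 0" if "a \<noteq> 0" for a i using that by (simp add: input_store_def)
  have "log_cost 0 \<le> ?K" by (simp add: log_cost_def floorlog_def)
  then have "log_cost (input_store code a i) \<le> ?N" for a i
    using log_cost_inp[of i] K zero[of a i] by (cases "a = 0") (auto simp: inp_def)
  then have bounded: "cells_bounded ?N (input_store code)" by (simp add: cells_bounded_def)
  have "n * n * (q + 1) \<le> size * size * (size + 1)"
    using graph_le_size by (intro mult_le_mono) auto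
  also have "\<dots> < (size + 2) ^ 3"
    by (simp add: power3_eq_cube algebra_simps)
  also have "\<dots> \<le> ?K" by (intro power_increasing) auto
  finally have "n * n * (q + 1) < ?K" .
  then have "wp ?N msp_algorithm output_ok (input_store code)"
    using log_cost_inp zero
    by (intro wp_msp_algorithm[where K = ?K]) (auto simp: inp_def poly_resource_poly algebra_simps)
  from wp_sound[OF this bounded] show ?thesis
    by (auto simp: poly_pcompose)
qed

end

section \<open>Rational arithmetic of the share\<close>

context unit_demand_instance
begin

text \<open>Multiplying \<open>private_target\<close> by \<open>y'\<close> clears all denominators
  and leaves \<open>U * (pos - neg)\<close> over the reals. Truncation of the difference realises
  the maximum with 0, the comparison with \<open>y'\<close> the minimum with 1.\<close>

lemma share_pair_private_share:
  assumes tau: "of_rat (travel_time I 0) = real (p 2) / real (p 3)" "0 < p 3"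
      "of_rat (travel_time I 1) = real (p 10) / real (p 11)" "0 < p 11"
    and eta: "of_rat (msp.energy I 0) = real (p 4) / real (p 5)" "0 < p 5"
      "of_rat (msp.energy I 1) = real (p 12) / real (p 13)" "0 < p 13"
    and bound: "time_bound I = None \<Longrightarrow> p 18 = 0"
      "\<And>b. time_bound I = Some b \<Longrightarrow> p 18 = 1 \<and> of_rat b = real (p 19) / real (p 20) \<and> 0 < p 20"
    and U: "0 < U" and pair: "share_pair p U = (x, y)"
  shows "0 < y" "x \<le> y" "private_share (real U) = real x / real y"
proof -
  define \<Delta> where "\<Delta> = p 10 * p 3 - p 2 * p 11"
  define pos where "pos = p 10 * (U * (p 4 * (p 3 * (p 13 * p 20)))) + 2 * (p 12 * (\<Delta> * (p 5 * p 20)))"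
  define neg where "neg = 2 * (p 19 * (p 4 * (p 3 * (p 11 * p 13))))"
  define y' where "y' = \<Delta> * (p 4 * (U * (p 13 * p 20)))"
  have pair': "(x, y) = (if p 18 * \<Delta> = 0 then (0, 1) else if y' \<le> pos - neg then (1, 1) else (pos - neg, y'))"
    using pair unfolding share_pair_def Let_def \<Delta>_def[symmetric] pos_def[symmetric] neg_def[symmetric]
      y'_def[symmetric] by simp
  have slower: "travel_time I 0 < travel_time I 1 \<longleftrightarrow> \<Delta> \<noteq> 0"
  proof -
    have "travel_time I 0 < travel_time I 1 \<longleftrightarrow> real (p 2) / real (p 3) < real (p 10) / real (p 11)"
      using tau(1,3) of_rat_less[where 'a = real] by metis
    also have "\<dots> \<longleftrightarrow> real (p 2) * real (p 11) < real (p 10) * real (p 3)"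
      using tau(2,4) by (simp add: divide_simps mult.commute)
    also have "\<dots> \<longleftrightarrow> p 2 * p 11 < p 10 * p 3"
      by (simp only: of_nat_mult[symmetric] of_nat_less_iff)
    finally show ?thesis by (auto simp: \<Delta>_def)
  qed
  show "0 < y" using pair' by (auto split: if_splits)
  show "x \<le> y" using pair' by (auto split: if_splits)
  show "private_share (real U) = real x / real y"
  proof (cases "p 18 * \<Delta> = 0")
    case True
    then show ?thesis
      using pair' bound slower by (auto simp: private_share_def split: option.split)
  next
    case False
    then obtain b where b: "time_bound I = Some b" using bound(1) by (cases "time_bound I") auto
    note b' = bound(2)[OF b]
    have \<Delta>: "real \<Delta> = real (p 10) * real (p 3) - real (p 2) * real (p 11)" "0 < real \<Delta>"
    proof -
      show "0 < real \<Delta>" using False by simp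
      then have "p 2 * p 11 \<le> p 10 * p 3" by (simp add: \<Delta>_def)
      then show "real \<Delta> = real (p 10) * real (p 3) - real (p 2) * real (p 11)"
        unfolding \<Delta>_def by (simp only: of_nat_diff of_nat_mult)
    qed
    \<comment> \<open>The denominator contains the numerator of \<open>\<eta>\<^sub>0\<close>, which
      is positive because \<open>\<eta>\<^sub>0 > \<eta>\<^sub>1 \<ge> 0\<close>.\<close>
    have p4: "0 < real (p 4)" using \<eta>\<^sub>0_pos eta(1,2) by (simp add: zero_less_divide_iff)
    have y': "0 < real y'" using \<Delta>(2) p4 U eta(4) b' by (simp add: y'_def)
    have diff: "real (p 10) / real (p 11) - real (p 2) / real (p 3) = real \<Delta> / (real (p 3) * real (p 11))"
      using tau(2,4) by (simp add: \<Delta>(1) divide_simps mult.commute)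
    have "private_target (of_rat b) (real U) * real y' = real U * (real pos - real neg)"
    proof -
      let ?s = "real (p 3) * real (p 11) * (real (p 10) / real (p 11) * real U - 2 * (real (p 19) / real (p 20)))"
      have "private_target (of_rat b) (real U) =
        ?s / real \<Delta> + 2 * (real (p 12) / real (p 13) / (real (p 4) / real (p 5)))"
        unfolding private_target_def
        unfolding tau(1,3) eta(1,3) b'[THEN conjunct2, THEN conjunct1] diff
        by (simp add: mult.commute)
      moreover have "?s / real \<Delta> * real y' = ?s * (real (p 4) * (real U * (real (p 13) * real (p 20))))"
        using \<Delta>(2) by (simp add: y'_def)
      moreover have "?s = real (p 3) * (real (p 10) * real U) - 2 * real (p 3) * real (p 11) * (real (p 19) / real (p 20))"
        using tau(4) by (simp add: right_diff_distrib)
      moreover have "(real (p 3) * (real (p 10) * real U) - 2 * real (p 3) * real (p 11) * (real (p 19) / real (p 20)))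
          * (real (p 4) * (real U * (real (p 13) * real (p 20))))
        = real U * (real (p 10) * (real U * (real (p 4) * (real (p 3) * (real (p 13) * real (p 20))))) - real neg)"
        using b' by (simp add: neg_def algebra_simps)
      moreover have "2 * (real (p 12) / real (p 13) / (real (p 4) / real (p 5))) * real y'
        = real U * (2 * (real (p 12) * (real \<Delta> * (real (p 5) * real (p 20)))))"
        using p4 eta(2,4) by (simp add: y'_def)
      ultimately show ?thesis
        by (simp add: distrib_right pos_def algebra_simps)
    qed
    then have target: "private_target (of_rat b) (real U) = real U * ((real pos - real neg) / real y')"
      using y' by (simp add: field_simps)
    have share: "private_share (real U) = min 1 (max 0 ((real pos - real neg) / real y'))"
    proof -
      have scale: "min (real U) (max 0 (real U * z)) = real U * min 1 (max 0 z)" for z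
        using U by (auto simp: max_def min_def mult_le_0_iff zero_le_mult_iff)
      have "private_share (real U) = min (real U) (max 0 (private_target (of_rat b) (real U))) / real U"
        using b slower False by (simp add: private_share_def)
      then show ?thesis
        unfolding target scale using U by simp
    qed
    show ?thesis
    proof (cases "y' \<le> pos - neg")
      case True
      then have "real y' \<le> real pos - real neg" using y' by (simp add: of_nat_diff)
      then have "1 \<le> (real pos - real neg) / real y'" using y' by simp
      then show ?thesis using share pair' False True by simp
    next
      case le: False
      have "real (pos - neg) = max 0 (real pos - real neg)" by (simp add: max_def of_nat_diff)
      then have "real (pos - neg) / real y' = max 0 ((real pos - real neg) / real y')"
        using y' by (simp add: max_def divide_le_0_iff zero_le_divide_iff)
      moreover have "real (pos - neg) / real y' \<le> 1" using le y' by simp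
      ultimately show ?thesis using share pair' False le by simp
    qed
  qed
qed

end

section \<open>From indices to vertices\<close>

locale encoded_unit_instance = unit_demand_instance I + encoded_msp I vs es
  for I :: "'v msp" and vs :: "'v list" and es :: "('v \<times> 'v) list"
begin

definition pos where "pos v = position vs v"
definition pair_pos where "pair_pos \<kappa> = pos (fst \<kappa>) * n + pos (snd \<kappa>)"

lemma pos_less: "v \<in> vertices I \<Longrightarrow> pos v < n" and nth_pos: "v \<in> vertices I \<Longrightarrow> vs ! pos v = v"
  using vertex_position by (auto simp: pos_def)

lemma vs_props: "distinct vs" "set vs = vertices I" "distinct es" "set es = edges I"
  using enumerates by (auto simp: enumerates_def)

lemma pos_nth: "i < n \<Longrightarrow> pos (vs ! i) = i"
  using position_nth vs_props(1) by (simp add: pos_def n_def)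

lemma nth_vertex: "i < n \<Longrightarrow> vs ! i \<in> vertices I"
  using nth_mem[of i vs] vs_props(2) by (simp add: n_def)

lemma pos_eq_iff: "u \<in> vertices I \<Longrightarrow> v \<in> vertices I \<Longrightarrow> pos u = pos v \<longleftrightarrow> u = v"
  using nth_pos by metis

lemma card_vertices: "card (vertices I) = n"
  using distinct_card[OF vs_props(1)] vs_props(2) by (simp add: n_def)

lemma bij_vertices: "bij_betw pos (vertices I) {..<n}"
  by (rule bij_betw_byWitness[where f' = "nth vs"]) (auto simp: nth_pos pos_nth pos_less nth_vertex)

lemma bij_edges: "bij_betw (nth es) {..<q} (edges I)"
  using bij_betw_nth[OF vs_props(3), of "{..<q}" "edges I"] vs_props(4) by (simp add: q_def)

lemma edge_ends:
  assumes "l < q"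
  shows "pos (fst (es ! l)) = tl l" "pos (snd (es ! l)) = hd l"
    "fst (es ! l) \<in> vertices I" "snd (es ! l) \<in> vertices I"
  using edge_nth[OF assms] edges_within by (auto simp: pos_def tl_def hd_def)

lemma sum_edges: "(\<Sum>e\<in>edges I. f e) = (\<Sum>l<q. f (es ! l))"
  using sum.reindex_bij_betw[OF bij_edges, of f] by simp

lemma edge_index: "e \<in> edges I \<Longrightarrow> \<exists>l<q. e = es ! l"
  using bij_edges by (auto simp: bij_betw_def)

lemma edge_position: "l < q \<Longrightarrow> position es (es ! l) = l"
  using position_nth vs_props(3) by (simp add: q_def)

lemma sum_K:
  assumes "\<And>v. v \<in> vertices I \<Longrightarrow> f v v = 0"
  shows "(\<Sum>(s, t)\<in>K. f s t) = (\<Sum>s\<in>vertices I. \<Sum>t\<in>vertices I. f s t)"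
proof -
  have "(\<Sum>(s, t)\<in>K. f s t) = (\<Sum>s\<in>vertices I. \<Sum>t\<in>vertices I - {s}. f s t)"
    unfolding K_def by (rule sum.Sigma[symmetric]) (auto simp: finite_V)
  also have "\<dots> = (\<Sum>s\<in>vertices I. \<Sum>t\<in>vertices I. f s t)"
  proof (rule sum.cong)
    fix s assume "s \<in> vertices I"
    then show "(\<Sum>t\<in>vertices I - {s}. f s t) = (\<Sum>t\<in>vertices I. f s t)"
      using sum.remove[OF finite_V, of s "f s"] assms by simp
  qed simp
  finally show ?thesis .
qed

lemma sum_K_index:
  fixes f :: "nat \<Rightarrow> 'b :: comm_monoid_add"
  assumes "\<And>i. i < n \<Longrightarrow> f (i * n + i) = 0"
  shows "(\<Sum>\<kappa>\<in>K. f (pair_pos \<kappa>)) = (\<Sum>p<n * n. f p)"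
proof -
  have "(\<Sum>\<kappa>\<in>K. f (pair_pos \<kappa>)) = (\<Sum>(s, t)\<in>K. f (pos s * n + pos t))"
    by (simp add: pair_pos_def case_prod_unfold)
  also have "\<dots> = (\<Sum>s\<in>vertices I. \<Sum>t\<in>vertices I. f (pos s * n + pos t))"
    using assms pos_less by (intro sum_K) auto
  also have "\<dots> = (\<Sum>s\<in>vertices I. \<Sum>t<n. f (pos s * n + t))"
    using sum.reindex_bij_betw[OF bij_vertices] by (intro sum.cong) auto
  also have "\<dots> = (\<Sum>s<n. \<Sum>t<n. f (s * n + t))"
    by (rule sum.reindex_bij_betw[OF bij_vertices])
  finally show ?thesis by (simp add: sum_index)
qed

lemma net_index:
  assumes "v \<in> vertices I"
  shows "net (edges I) f v = (\<Sum>l | l < q \<and> hd l = pos v. f (es ! l)) - (\<Sum>l | l < q \<and> tl l = pos v. f (es ! l))"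
proof -
  have "(\<Sum>e | e \<in> edges I \<and> h e = v. f e) = (\<Sum>l | l < q \<and> k l = pos v. f (es ! l))"
    if "\<And>l. l < q \<Longrightarrow> pos (h (es ! l)) = k l \<and> h (es ! l) \<in> vertices I" for h k
  proof -
    have "{e. e \<in> edges I \<and> h e = v} = nth es ` {l. l < q \<and> k l = pos v}"
    proof (intro set_eqI iffI)
      fix e assume e: "e \<in> {e. e \<in> edges I \<and> h e = v}"
      then obtain l where "l < q" "e = es ! l" using edge_index by blast
      then show "e \<in> nth es ` {l. l < q \<and> k l = pos v}"
        using e that by (intro image_eqI[of _ _ l]) auto
    next
      fix e assume "e \<in> nth es ` {l. l < q \<and> k l = pos v}"
      then obtain l where "l < q" "e = es ! l" "k l = pos v" by blast
      then show "e \<in> {e. e \<in> edges I \<and> h e = v}"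
        using that[of l] pos_eq_iff[of "h e" v] assms edge_nth[of l] by simp
    qed
    moreover have "inj_on (nth es) {l. l < q \<and> k l = pos v}"
      by (rule inj_on_nth[OF vs_props(3)]) (simp add: q_def)
    ultimately show ?thesis by (simp add: sum.reindex)
  qed
  from this[of snd hd] this[of fst tl] show ?thesis
    using edge_ends by (simp add: net_def)
qed

definition solution_of :: "store \<Rightarrow> 'v msp_solution" where
  "solution_of s =
    \<lparr>flow = \<lambda>\<kappa> e. real (s 1 (pair_pos \<kappa> * q + position es e)),
     layout = \<lambda>e i. s 3 (position es e),
     modal_split = \<lambda>\<kappa> e r. let p = 2 * (pair_pos \<kappa> * q + position es e) + r in real (s 4 p) / real (s 5 p)\<rparr>"

lemma params:
  "of_rat (travel_time I 0) = real (P 2) / real (P 3)" "0 < P 3"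
  "of_rat (travel_time I 1) = real (P 10) / real (P 11)" "0 < P 11"
  "of_rat (msp.energy I 0) = real (P 4) / real (P 5)" "0 < P 5"
  "of_rat (msp.energy I 1) = real (P 12) / real (P 13)" "0 < P 13"
  "time_bound I = None \<Longrightarrow> P 18 = 0"
  "\<And>b. time_bound I = Some b \<Longrightarrow> P 18 = 1 \<and> of_rat b = real (P 19) / real (P 20) \<and> 0 < P 20"
proof -
  have nonneg: "0 \<le> budget I" "0 \<le> travel_time I 0" "0 \<le> msp.energy I 0" "0 \<le> cost I 0"
    "0 \<le> capacity I 0" "0 \<le> travel_time I 1" "0 \<le> msp.energy I 1" "0 \<le> cost I 1" "0 \<le> capacity I 1"
    using inst by (simp_all add: msp_instance_def modes)
  obtain a0 b0 where 0: "encode_rat (budget I) = [a0, b0]"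
    using encode_rat_fraction[OF nonneg(1)] by blast
  obtain a1 b1 where 1: "encode_rat (travel_time I 0) = [a1, b1]" "0 < b1"
      "of_rat (travel_time I 0) = real a1 / real b1"
    using encode_rat_fraction[OF nonneg(2)] by blast
  obtain a2 b2 where 2: "encode_rat (msp.energy I 0) = [a2, b2]" "0 < b2"
      "of_rat (msp.energy I 0) = real a2 / real b2"
    using encode_rat_fraction[OF nonneg(3)] by blast
  obtain a3 b3 where 3: "encode_rat (cost I 0) = [a3, b3]"
    using encode_rat_fraction[OF nonneg(4)] by blast
  obtain a4 b4 where 4: "encode_rat (capacity I 0) = [a4, b4]"
    using encode_rat_fraction[OF nonneg(5)] by blast
  obtain a5 b5 where 5: "encode_rat (travel_time I 1) = [a5, b5]" "0 < b5"
      "of_rat (travel_time I 1) = real a5 / real b5"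
    using encode_rat_fraction[OF nonneg(6)] by blast
  obtain a6 b6 where 6: "encode_rat (msp.energy I 1) = [a6, b6]" "0 < b6"
      "of_rat (msp.energy I 1) = real a6 / real b6"
    using encode_rat_fraction[OF nonneg(7)] by blast
  obtain a7 b7 where 7: "encode_rat (cost I 1) = [a7, b7]"
    using encode_rat_fraction[OF nonneg(8)] by blast
  obtain a8 b8 where 8: "encode_rat (capacity I 1) = [a8, b8]"
    using encode_rat_fraction[OF nonneg(9)] by blast
  have rational: "rational_part = [a0, b0, a1, b1, a2, b2, a3, b3, a4, b4, a5, b5, a6, b6, a7, b7, a8, b8]
      @ (case time_bound I of None \<Rightarrow> [0] | Some a \<Rightarrow> 1 # encode_rat a)"
    by (simp add: rational_part_def 0 1(1) 2(1) 3 4 5(1) 6(1) 7 8)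
  have "P 2 = a1" "P 3 = b1" "P 4 = a2" "P 5 = b2" "P 10 = a5" "P 11 = b5" "P 12 = a6" "P 13 = b6"
    unfolding inp_rational rational by simp_all
  then show "of_rat (travel_time I 0) = real (P 2) / real (P 3)" "0 < P 3"
    "of_rat (travel_time I 1) = real (P 10) / real (P 11)" "0 < P 11"
    "of_rat (msp.energy I 0) = real (P 4) / real (P 5)" "0 < P 5"
    "of_rat (msp.energy I 1) = real (P 12) / real (P 13)" "0 < P 13"
    using 1 2 5 6 by simp_all
  show "time_bound I = None \<Longrightarrow> P 18 = 0"
    unfolding inp_rational rational by simp
  fix b assume b: "time_bound I = Some b"
  then have "0 \<le> b" using inst by (simp add: msp_instance_def)
  then obtain a9 b9 where 9: "encode_rat b = [a9, b9]" "0 < b9" "of_rat b = real a9 / real b9"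
    using encode_rat_fraction by blast
  have "P 18 = 1" "P 19 = a9" "P 20 = b9"
    unfolding inp_rational rational by (simp_all add: b 9(1))
  with 9 show "P 18 = 1 \<and> of_rat b = real (P 19) / real (P 20) \<and> 0 < P 20" by simp
qed

text \<open>Every ordered pair of different vertices is a commodity, so any solution at all
  witnesses a path. This supplies the connectivity on which the trees rely.\<close>

lemma strongly_connected:
  assumes "is_solution I Y" "x < n" "y < n"
  shows "(x, y) \<in> (arcs_of (\<lambda>_. True))\<^sup>*"
proof (cases "x = y")
  case False
  have pos_path: "(pos u, pos v) \<in> (arcs_of (\<lambda>_. True))\<^sup>*" if "(u, v) \<in> (edges I)\<^sup>*" for u v
    using that
  proof induction
    case (step v w)
    then obtain l where "l < q" "(v, w) = es ! l" using edge_index by blast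
    then have "(pos v, pos w) \<in> arcs_of (\<lambda>_. True)"
      using edge_ends[of l] arcs_ofI[of l "\<lambda>_. True"] by (metis fst_conv snd_conv)
    with step.IH show ?case by (rule rtrancl_into_rtrancl)
  qed simp
  have V: "vs ! x \<in> vertices I" "vs ! y \<in> vertices I" "vs ! x \<noteq> vs ! y"
    using nth_vertex[OF assms(2)] nth_vertex[OF assms(3)] pos_nth[OF assms(2)] pos_nth[OF assms(3)] False
    by auto
  then have "(vs ! x, vs ! y) \<in> K" by (simp add: mem_K)
  then have "unit_flow (vertices I) (edges I) (vs ! x, vs ! y) (flow Y (vs ! x, vs ! y))"
    using is_solution_feasible[OF assms(1)] by (simp add: feasible_def)
  from unit_flow_reachable[OF finite_V finite_E edges this V(1,2)]
  show ?thesis using pos_path[of "vs ! x" "vs ! y"] assms(2,3) by (simp add: pos_nth)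
qed simp

lemma pair_pos_less: "\<kappa> \<in> K \<Longrightarrow> pair_pos \<kappa> < n * n"
  using K_D[of \<kappa>] by (simp add: pair_pos_def index_less pos_less)

lemma path_to_unit_flow:
  assumes path: "path_to (pos s) t M D' t f" and s: "s \<in> vertices I" and t: "t = pos w" "w \<in> vertices I"
    and F: "\<And>l. l < q \<Longrightarrow> F (es ! l) = real (f l)"
  shows "unit_flow (vertices I) (edges I) (s, w) F"
proof -
  have "net (edges I) F v = of_bool (v = w) - of_bool (v = s)" if v: "v \<in> vertices I" for v
  proof -
    have "(\<Sum>l | l < q \<and> hd l = pos v. f l) + of_bool (pos v = pos s)
        = (\<Sum>l | l < q \<and> tl l = pos v. f l) + of_bool (pos v = t)"
      using path by (simp add: path_to_def)
    then have "real ((\<Sum>l | l < q \<and> hd l = pos v. f l) + of_bool (pos v = pos s))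
        = real ((\<Sum>l | l < q \<and> tl l = pos v. f l) + of_bool (pos v = pos w))"
      unfolding t(1) by (simp only:)
    then have "real (\<Sum>l | l < q \<and> hd l = pos v. f l) + of_bool (v = s)
        = real (\<Sum>l | l < q \<and> tl l = pos v. f l) + of_bool (v = w)"
      unfolding pos_eq_iff[OF v s] pos_eq_iff[OF v t(2)] by (simp only: of_nat_add of_nat_of_bool)
    moreover have index: "(\<Sum>l | l < q \<and> k l = pos v. F (es ! l)) = real (\<Sum>l | l < q \<and> k l = pos v. f l)"
      for k :: "nat \<Rightarrow> nat"
      unfolding of_nat_sum using F by (intro sum.cong) auto
    ultimately show ?thesis
      unfolding net_index[OF v] index by linarith
  qed
  moreover have "0 \<le> F e" if "e \<in> edges I" for e
    using edge_index[OF that] F by auto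
  ultimately show ?thesis by (simp add: unit_flow_def)
qed

lemma output_solution:
  assumes out: "output_ok s" and opt: "is_min_energy I H" "is_min_time_at_energy I H T"
  shows "\<exists>X. encodes_solution I vs es X s \<and> is_solution I X \<and>
    total_energy I X \<le> 2 * H \<and> total_travel_time I X \<le> 2 * T"
proof -
  obtain D r M D' x y where D: "is_dist (\<lambda>_. True) D"
    and r: "0 < n \<longrightarrow> r < n \<and> (\<forall>v<n. eccentricity D r \<le> eccentricity D v)"
    and trees: "spanning_trees D r M" and D': "is_dist M D'"
    and paths: "\<forall>i<n. \<forall>t<n. D' (i * n + t) \<le> q \<longrightarrow> path_to i t M D' t (\<lambda>l. s 1 ((i * n + t) * q + l))"
    and share: "share_pair P (\<Sum>p<n * n. D' p) = (x, y)"
    and split: "\<forall>p<n * n * q. s 2 p = 1 \<and> s 4 (2 * p) = x \<and> s 5 (2 * p) = y \<and>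
        s 4 (2 * p + 1) = y - x \<and> s 5 (2 * p + 1) = y"
    and lay: "\<forall>l<q. s 3 l = of_bool (M l \<and> x \<noteq> y)"
    using out unfolding output_ok_def by (elim exE conjE) (rule that)
  obtain Y where Y: "is_solution I Y"
    using opt(2) unfolding is_min_time_at_energy_def is_minimum_def by blast
  have n2: "2 \<le> n" using two_vertices' card_vertices by simp
  note connected = strongly_connected[OF Y]
  have rn: "r < n" and center: "\<forall>v<n. eccentricity D r \<le> eccentricity D v" using r n2 by auto
  note tree_facts = D rn center trees D' connected
  define X where "X = solution_of s"
  define F where "F i t l = s 1 ((i * n + t) * q + l)" for i t l
  define U where "U = (\<Sum>p<n * n. D' p)"
  have path: "path_to i t M D' t (F i t)" if "i < n" "t < n" for i t
  proof -
    have "F i t = (\<lambda>l. s 1 ((i * n + t) * q + l))" by (simp add: F_def fun_eq_iff)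
    then show ?thesis using paths[rule_format, OF that tree_dist_le(2)[OF tree_facts that]] by simp
  qed
  have flow_X: "flow X \<kappa> (es ! l) = real (F (pos (fst \<kappa>)) (pos (snd \<kappa>)) l)" if "l < q" for \<kappa> l
    using that by (simp add: X_def solution_of_def F_def pair_pos_def edge_position)
  \<comment> \<open>The share divides by the total flow, which is positive: there are two vertices,
    and the distance between indices 0 and 1 is at least 1.\<close>
  have "1 \<le> D' (0 * n + 1)" using is_dist_pos[OF D', of 0 1] n2 by simp
  also have "\<dots> \<le> U" unfolding U_def
    using n2 index_less[of 0 n 1 n] by (intro member_le_sum) auto
  finally have U: "0 < U" by simp
  note share' = share_pair_private_share[OF params U share[folded U_def]]
  have total_X: "total (flow X) = real U"
  proof -
    have "total (flow X) = (\<Sum>\<kappa>\<in>K. real (D' (pair_pos \<kappa>)))"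
      unfolding total_def
    proof (rule sum.cong)
      fix \<kappa> assume \<kappa>: "\<kappa> \<in> K"
      have "(\<Sum>e\<in>edges I. flow X \<kappa> e) = real (\<Sum>l<q. F (pos (fst \<kappa>)) (pos (snd \<kappa>)) l)"
        unfolding sum_edges using flow_X by simp
      also have "(\<Sum>l<q. F (pos (fst \<kappa>)) (pos (snd \<kappa>)) l) = D' (pair_pos \<kappa>)"
        using path[of "pos (fst \<kappa>)" "pos (snd \<kappa>)"] K_D[OF \<kappa>] pos_less is_dist_self[OF D']
        by (simp add: path_to_def pair_pos_def)
      finally show "(\<Sum>e\<in>edges I. flow X \<kappa> e) = real (D' (pair_pos \<kappa>))" .
    qed simp
    also have "\<dots> = real U"
      using sum_K_index[of "\<lambda>p. real (D' p)"] is_dist_self[OF D'] by (simp add: U_def)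
    finally show ?thesis .
  qed
  define S where "S = nth es ` {l. l < q \<and> M l}"
  define d where "d u v = D (pos u * n + pos v)" for u v
  have W: "(\<Sum>(u, v)\<in>K. d u v) = (\<Sum>p<n * n. D p)"
    using sum_K_index[of D] is_dist_self[OF D] by (simp add: d_def pair_pos_def case_prod_unfold)
  have in_S: "es ! l \<in> S \<longleftrightarrow> M l" if "l < q" for l
  proof
    assume "es ! l \<in> S"
    then obtain l' where l': "l' < q" "M l'" "es ! l = es ! l'" by (auto simp: S_def)
    have "l = l'" using edge_position[OF that] edge_position[OF l'(1)] unfolding l'(3) by metis
    then show "M l" using l'(2) by metis
  qed (use that in \<open>simp add: S_def\<close>)
  have "is_solution I X \<and> total_energy I X \<le> 2 * H \<and> total_travel_time I X \<le> 2 * T"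
  proof (rule two_approximation[OF opt, where d = d and S = S])
    show "d v v = 0" if "v \<in> vertices I" for v
      using is_dist_self[OF D pos_less[OF that]] by (simp add: d_def)
  next
    fix u v t assume e: "(u, v) \<in> edges I" and t: "t \<in> vertices I"
    obtain l where l: "l < q" "(u, v) = es ! l" using edge_index[OF e] by blast
    then have "pos u = tl l" "pos v = hd l" using edge_ends[OF l(1)] by (metis fst_conv snd_conv)+
    then show "d u t \<le> d v t + 1"
      using is_dist_relaxed[OF D l(1) TrueI pos_less[OF t]] by (simp add: d_def)
  next
    show "S \<subseteq> edges I" using edge_nth by (auto simp: S_def)
    have "card S \<le> card {l. l < q \<and> M l}" unfolding S_def by (intro card_image_le) simp
    also have "{l. l < q \<and> M l} = {..<q} \<inter> Collect M" by auto
    also have "card \<dots> = (\<Sum>l<q. of_bool (M l))" by simp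
    also have "\<dots> \<le> 2 * (n - 1)" using trees by (simp add: spanning_trees_def)
    finally have "real (card S) \<le> real (2 * (n - 1))" by (simp only: of_nat_le_iff)
    then show "real (card S) \<le> 2 * (real (card (vertices I)) - 1)"
      using n2 by (simp add: card_vertices of_nat_diff)
  next
    fix \<kappa> assume \<kappa>: "\<kappa> \<in> K"
    have P: "path_to (pos (fst \<kappa>)) (pos (snd \<kappa>)) M D' (pos (snd \<kappa>)) (F (pos (fst \<kappa>)) (pos (snd \<kappa>)))"
      using path K_D[OF \<kappa>] pos_less by blast
    show "unit_flow (vertices I) (edges I) \<kappa> (flow X \<kappa>)"
      using path_to_unit_flow[OF P _ refl, of "flow X \<kappa>"] K_D[OF \<kappa>] flow_X by simp
    fix e assume e: "e \<in> edges I"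
    obtain l where l: "l < q" "e = es ! l" using edge_index[OF e] by blast
    let ?f = "F (pos (fst \<kappa>)) (pos (snd \<kappa>)) l"
    have le1: "?f \<le> 1" using P l(1) by (simp add: path_to_def)
    show "flow X \<kappa> e \<le> of_bool (e \<in> S \<and> snd e \<noteq> fst \<kappa>)"
    proof (cases "?f = 1")
      case True
      then have f: "M l" "D' (tl l * n + pos (snd \<kappa>)) = D' (hd l * n + pos (snd \<kappa>)) + 1"
        "D' (tl l * n + pos (snd \<kappa>)) \<le> D' (pos (fst \<kappa>) * n + pos (snd \<kappa>))"
        using P l(1) True unfolding path_to_def by blast+
      \<comment> \<open>A used edge ends strictly closer to the target than the source lies, so it
        does not enter the source.\<close>
      then have "hd l \<noteq> pos (fst \<kappa>)" by auto
      then have "snd e \<noteq> fst \<kappa>" using edge_ends[OF l(1)] l(2) by auto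
      then show ?thesis using l in_S f(1) flow_X True by simp
    next
      case False
      then show ?thesis using le1 l flow_X by simp
    qed
    have p: "pair_pos \<kappa> * q + l < n * n * q" using pair_pos_less[OF \<kappa>] l(1) by (rule index_less)
    have "modal_split X \<kappa> e 0 = real x / real y" "modal_split X \<kappa> e 1 = real (y - x) / real y"
      using split[rule_format, OF p] l
      by (simp_all add: X_def solution_of_def Let_def edge_position)
    then show "modal_split X \<kappa> e 0 = private_share (total (flow X)) \<and>
        modal_split X \<kappa> e 1 = 1 - private_share (total (flow X))"
      using share' by (simp add: total_X of_nat_diff diff_divide_distrib)
  next
    show "0 < total (flow X)" using U total_X by simp
    have "real (U + 2 * (n - 1)) \<le> real (2 * (\<Sum>(u, v)\<in>K. d u v))"
      using sum_tree_dist_le[OF tree_facts] unfolding W U_def by (simp only: of_nat_le_iff)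
    then show "total (flow X) \<le> 2 * real (\<Sum>(s, t)\<in>K. d s t) - 2 * (real (card (vertices I)) - 1)"
      using n2 by (simp add: total_X card_vertices of_nat_diff del: of_nat_sum)
  next
    fix e assume "e \<in> edges I"
    then obtain l where l: "l < q" "e = es ! l" using edge_index by blast
    have "private_share (total (flow X)) < 1 \<longleftrightarrow> x \<noteq> y"
      using share' by (auto simp: total_X)
    then show "layout X e 1 = (if e \<in> S \<and> private_share (total (flow X)) < 1 then 1 else 0)"
      using lay l in_S by (simp add: X_def solution_of_def edge_position)
  qed
  moreover have "encodes_solution I vs es X s"
    unfolding encodes_solution_def Let_def n_def[symmetric] q_def[symmetric] modes
  proof (intro conjI allI impI ballI)
    fix i j l assume ijl: "i < n" "j < n" "l < q"
    have p: "(i * n + j) * q + l < n * n * q"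
      using index_less[OF ijl(1,2)] ijl(3) by (rule index_less)
    show "is_fraction (flow X (vs ! i, vs ! j) (es ! l)) (s 1 ((i * n + j) * q + l)) (s 2 ((i * n + j) * q + l))"
      using split[rule_format, OF p] ijl by (simp add: is_fraction_def flow_X F_def pos_nth)
    fix k :: nat assume "k \<le> 1"
    then consider "k = 0" | "k = 1" by linarith
    then show "is_fraction (modal_split X (vs ! i, vs ! j) (es ! l) k)
        (s 4 (((i * n + j) * q + l) * Suc 1 + k)) (s 5 (((i * n + j) * q + l) * Suc 1 + k))"
      using split[rule_format, OF p] ijl share'(1)
      by cases (simp_all add: is_fraction_def X_def solution_of_def Let_def pair_pos_def pos_nth
          edge_position mult.commute[of _ 2])
  next
    fix l k assume "l < q" "k \<in> {1..1::nat}"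
    then show "layout X (es ! l) k = s 3 (l * 1 + (k - 1))"
      by (simp add: X_def solution_of_def edge_position)
  qed
  ultimately show ?thesis by blast
qed

end

section \<open>Instances with at most one vertex\<close>

context encoded_msp
begin

text \<open>The graph may still have loops, but none is marked, since the trees have at most
  \<open>2 * (n - 1) = 0\<close> edges in truncated arithmetic. Without commodities all times
  vanish, and the empty layout has energy 0.\<close>

lemma output_solution_no_commodities:
  assumes out: "output_ok s" and inst: "msp_instance I" and "commodities I = {}" "n \<le> 1"
    and opt: "is_min_energy I H" "is_min_time_at_energy I H T"
  shows "\<exists>X. encodes_solution I vs es X s \<and> is_solution I X \<and>
    total_energy I X \<le> 2 * H \<and> total_travel_time I X \<le> 2 * T"
proof -
  obtain D r M x y where trees: "spanning_trees D r M"
    and lay: "\<forall>l<q. s 3 l = of_bool (M l \<and> x \<noteq> (y :: nat))"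
    using out unfolding output_ok_def by blast
  have layout0: "s 3 l = 0" if "l < q" for l
  proof -
    have "(\<Sum>l<q. of_bool (M l)) = (0 :: nat)" using trees assms(4) by (simp add: spanning_trees_def)
    then have "\<not> M l" using that by auto
    then show ?thesis using lay that by simp
  qed
  define X :: "'v msp_solution" where
    "X = \<lparr>flow = \<lambda>_ _. 0, layout = \<lambda>_ _. 0, modal_split = \<lambda>_ _ _. 0\<rparr>"
  have "encodes_solution I vs es X s"
    using assms(3) layout0 one_mode
    by (simp add: encodes_solution_def Let_def X_def n_def[symmetric] q_def[symmetric])
  moreover have "is_solution I X"
    using assms(3) inst by (simp add: is_solution_def feasible_layout_def feasible_modal_split_def X_def
        msp_instance_def)
  moreover have flow0: "total_flow I Z e = 0" for Z e by (simp add: total_flow_def assms(3))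
  have time0: "total_travel_time I Z = 0" for Z by (simp add: total_travel_time_def flow0)
  have "0 \<le> total_energy I Z" for Z
    unfolding total_energy_def using inst
    by (intro sum_nonneg mult_nonneg_nonneg add_nonneg_nonneg) (auto simp: flow0 total_split_def msp_instance_def)
  then have "0 \<le> H" "T = 0"
    using opt time0 unfolding is_min_energy_def is_min_time_at_energy_def is_minimum_def by auto
  moreover have "total_energy I X = 0" by (simp add: total_energy_def flow0) (simp add: X_def)
  ultimately show ?thesis using time0 by (intro exI[of _ X]) simp
qed

end

theorem corollary3p7:
  shows "\<exists>(algorithm :: com) (bound :: nat poly).
    \<forall>(I :: nat msp) vs es.
      msp_instance I \<and>
      modes I = 1 \<and>
      capacity I 1 \<ge> (of_nat (card (vertices I)) - 1)\<^sup>2 \<and>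
      cost I 1 \<le> 1 \<and>
      budget I \<ge> of_nat (card (edges I)) \<and>
      (\<forall>e\<in>edges I. weight I e = 1) \<and>
      energy I 0 > energy I 1 \<and>
      (\<forall>s\<in>vertices I. \<forall>t\<in>vertices I. s \<noteq> t \<longrightarrow> demand I (s, t) = 1) \<and>
      enumerates I vs es \<longrightarrow>
      (\<exists>steps final.
         exec algorithm (input_store (encode_msp I vs es)) steps final \<and>
         steps \<le> poly bound (input_size (encode_msp I vs es)) \<and>
         (\<forall>Hstar Tstar.
            is_min_energy I Hstar \<and> is_min_time_at_energy I Hstar Tstar \<longrightarrow>
            (\<exists>X. encodes_solution I vs es X final \<and>
                 is_solution I X \<and>
                 total_energy I X \<le> 2 * Hstar \<and>
                 total_travel_time I X \<le> 2 * Tstar)))"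
proof (intro exI[of _ msp_algorithm] exI[of _ "pcompose (time_poly msp_algorithm) resource_poly"]
    allI impI, elim conjE)
  fix I :: "nat msp" and vs es
  assume inst: "msp_instance I" and modes: "modes I = 1"
    and cap: "(of_nat (card (vertices I)) - 1)\<^sup>2 \<le> capacity I 1" and cost: "cost I 1 \<le> 1"
    and budget: "of_nat (card (edges I)) \<le> budget I" and weight: "\<forall>e\<in>edges I. weight I e = 1"
    and energy: "energy I 1 < energy I 0"
    and demand: "\<forall>s\<in>vertices I. \<forall>t\<in>vertices I. s \<noteq> t \<longrightarrow> demand I (s, t) = 1"
    and enum: "enumerates I vs es"
  have wf: "pair_fin_digraph (graph I)" using inst by (simp add: msp_instance_def)
  have "edges I \<subseteq> vertices I \<times> vertices I"
    using wf pair_wf_digraph.in_arcsD1 pair_wf_digraph.in_arcsD2 by (fastforce simp: pair_fin_digraph_def)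
  then interpret encoded_msp I vs es using enum modes by unfold_locales
  obtain steps final where run: "exec msp_algorithm (input_store code) steps final"
    "steps \<le> poly (pcompose (time_poly msp_algorithm) resource_poly) size" "output_ok final"
    using execution by blast
  have "\<exists>X. encodes_solution I vs es X final \<and> is_solution I X \<and>
      total_energy I X \<le> 2 * H \<and> total_travel_time I X \<le> 2 * T"
    if opt: "is_min_energy I H" "is_min_time_at_energy I H T" for H T
  proof (cases "2 \<le> card (vertices I)")
    case True
    then interpret encoded_unit_instance I vs es
      using inst modes cap cost budget weight energy demand by unfold_locales
    show ?thesis using output_solution[OF run(3) opt] .
  next
    case False
    have card: "card (vertices I) = n"
      using enum distinct_card[of vs] by (simp add: enumerates_def n_def)
    have "finite (vertices I)" using wf by (rule pair_fin_digraph.pair_finite_verts)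
    then have "s = t" if "s \<in> vertices I" "t \<in> vertices I" for s t
      using False that card_le_Suc0_iff_eq[of "vertices I"] by simp
    then have "commodities I = {}"
      using inst by (fastforce simp: commodities_def msp_instance_def)
    then show ?thesis
      using output_solution_no_commodities[OF run(3) inst _ _ opt] False card by simp
  qed
  with run show "\<exists>steps final. exec msp_algorithm (input_store (encode_msp I vs es)) steps final \<and>
      steps \<le> poly (pcompose (time_poly msp_algorithm) resource_poly) (input_size (encode_msp I vs es)) \<and>
      (\<forall>Hstar Tstar. is_min_energy I Hstar \<and> is_min_time_at_energy I Hstar Tstar \<longrightarrow>
        (\<exists>X. encodes_solution I vs es X final \<and> is_solution I X \<and>
          total_energy I X \<le> 2 * Hstar \<and> total_travel_time I X \<le> 2 * Tstar))"
    unfolding code_def size_def by blast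
qed

end
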